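(* Let $N\ge1$, let $m\ge2$ be even, let $\chi$ be an irreducible complex character of $\mathrm{SL}_2(\mathbb{Z}/N)$ that appears in its conjugation representation $\mathcal{O}(\mathrm{SL}_2(\mathbb{Z}/N))^{\mathrm{conj}}$, with irreducible module $V_\chi$, and let $f:\mathfrak{h}\to V_\chi$ be a vector valued modular form of weight $m$, level $N$ and character $\chi$. For each $\mathrm{SL}_2\times\mathrm{SL}_2(\mathbb{Z}/N)$-invariant function $$\varphi:S^{m-2}(\mathbf{e})\otimes V_\chi\to\mathcal{O}(\mathrm{SL}_2)^{\mathrm{conj}}\boxtimes\mathcal{O}(\mathrm{SL}_2(\mathbb{Z}/N))^{\mathrm{conj}},$$ the function $$F_{f,\varphi}:\alpha\mapsto\Big\langle\int_\alpha\omega_f(\varphi),\alpha\Big\rangle,\qquad\alpha\in\mathrm{SL}_2(\mathbb{Z}),$$ is a class function on $\mathrm{SL}_2(\mathbb{Z})$ that is the restriction of an element of $\mathcal{C}\!\ell_{\mathbb{C}}(\mathcal{G})$.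
   Context: All representations here are over $\mathbb{C}$. $\mathcal{O}(G)^{\mathrm{conj}}$ is the coordinate ring of $G$ (all functions, if $G$ is finite) with the conjugation action $(gF)(h)=F(g^{-1}hg)$. A vector valued modular form of weight $m$, level $N$ and character $\chi$ is a holomorphic function $f:\mathfrak{h}\to V_\chi$ on the upper half plane, holomorphic at the cusps, with $f(\gamma\tau)=(c\tau+d)^m\rho_\chi(\gamma)f(\tau)$ for all $\gamma=\begin{pmatrix}a&b\\c&d\end{pmatrix}\in\mathrm{SL}_2(\mathbb{Z})$, where $\rho_\chi:\mathrm{SL}_2(\mathbb{Z})\to\mathrm{SL}_2(\mathbb{Z}/N)\to\mathrm{Aut}\,V_\chi$. $S^k(\mathbf{e})$ is the irreducible $\mathrm{SL}_2$-module with highest weight vector $\mathbf{e}$ of weight $k$ with respect to the torus $t\mapsto\mathrm{diag}(t^{-1},t)$. Set $L=\begin{pmatrix}0&1\\0&0\end{pmatrix}$ and $\omega_f(\mathbf{e})=2\pi i\,f(\tau)\,e^{\tau L}(\mathbf{e})\,d\tau$, an $\mathrm{SL}_2(\mathbb{Z})$-invariant 1-form on $\mathfrak{h}$ with values in $S^{m-2}(\mathbf{e})\otimes V_\chi$, in the sense that $(\gamma^*\otimes1)\omega_f=(1\otimes\gamma)\omega_f$. Then $\omega_f(\varphi):=\varphi\circ\omega_f(\mathbf{e})$. The value $F_{f,\varphi}(\alpha)$ is computed by integrating $\omega_f(\varphi)$ along a path in $\mathfrak{h}$ from a chosen point $\tau_0$ to $\alpha\tau_0$ and evaluating the resulting element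 of $\mathcal{O}(\mathrm{SL}_2)\otimes\mathcal{O}(\mathrm{SL}_2(\mathbb{Z}/N))$ at $(\alpha,\alpha\bmod N)$. $\mathcal{G}$ (in its Betti form $\mathcal{G}^B$) is the affine $\mathbb{Q}$-group defined as the tannakian fundamental group of the category of finite dimensional $\mathbb{Q}$-representations of $\mathrm{SL}_2(\mathbb{Z})$ admitting a finite filtration whose graded quotients are restrictions of rational representations of $\mathrm{SL}_2\times\mathrm{SL}_2(\widehat{\mathbb{Z}})$ along the diagonal inclusion $\mathrm{SL}_2(\mathbb{Z})\to\mathrm{SL}_2(\mathbb{Q})\times\mathrm{SL}_2(\widehat{\mathbb{Z}})$. There is a canonical homomorphism $\mathrm{SL}_2(\mathbb{Z})\to\mathcal{G}(\mathbb{Q})$, along which functions are restricted. $\mathcal{C}\!\ell(\mathcal{G})\subset\mathcal{O}(\mathcal{G})$ is the ring of conjugation-invariant functions and $\mathcal{C}\!\ell_{\mathbb{C}}(\mathcal{G})=\mathcal{C}\!\ell(\mathcal{G})\otimes\mathbb{C}$. *)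

theory Defs
  imports
    "HOL-Complex_Analysis.Complex_Analysis"
    "HOL-Algebra.Product_Groups"
    "Jordan_Normal_Form.Determinant"
    "Jordan_Normal_Form.VS_Connect"
begin

hide_type (open) Finite_Cartesian_Product.vec
hide_const (open) Finite_Cartesian_Product.vec Finite_Cartesian_Product.mat
  Finite_Cartesian_Product.row Determinants.det Real_Vector_Spaces.subspace
unbundle no vec_syntax

section \<open>Matrix groups\<close>

definition mat2 :: "'a \<Rightarrow> 'a \<Rightarrow> 'a \<Rightarrow> 'a \<Rightarrow> 'a mat" where
  "mat2 a b c d = mat_of_rows_list 2 [[a, b], [c, d]]"

definition GL :: "nat \<Rightarrow> 'k::field mat monoid" where
  "GL n = units_of (ring_mat TYPE('k) n ())"

definition SL2 :: "'a::comm_ring_1 mat monoid" where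
  "SL2 = \<lparr>carrier = {A \<in> carrier_mat 2 2. det A = 1}, mult = (*), one = 1\<^sub>m 2\<rparr>"

abbreviation SL2_Z :: "int mat monoid" where
  "SL2_Z \<equiv> SL2"

definition reduce :: "nat \<Rightarrow> int mat \<Rightarrow> int mat" where
  "reduce N = map_mat (\<lambda>x. x mod int N)"

text \<open>\<open>SL\<^sub>2(\<int>/N)\<close> for \<open>N \<ge> 1\<close>: residue classes are represented by their representatives
  in \<open>{0..<N}\<close>. For \<open>N = 1\<close> this is the trivial group, consisting of the zero matrix.\<close>

definition SL2_mod :: "nat \<Rightarrow> int mat monoid" where
  "SL2_mod N =
     \<lparr>carrier = {A \<in> carrier_mat 2 2. reduce N A = A \<and> det A mod int N = 1 mod int N},
      mult = (\<lambda>A B. reduce N (A * B)),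
      one = reduce N (1\<^sub>m 2)\<rparr>"

text \<open>\<open>SL\<^sub>2\<close> of the profinite integers, as the inverse limit of the \<open>SL\<^sub>2(\<int>/M)\<close>, \<open>M \<ge> 1\<close>.\<close>

definition SL2_Zhat :: "(nat \<Rightarrow> int mat) monoid" where
  "SL2_Zhat = (product_group {1..} SL2_mod)
     \<lparr>carrier := {k \<in> carrier (product_group {1..} SL2_mod).
        \<forall>M\<ge>1. \<forall>L\<ge>1. M dvd L \<longrightarrow> reduce M (k L) = k M}\<rparr>"

definition diagonal :: "int mat \<Rightarrow> rat mat \<times> (nat \<Rightarrow> int mat)" where
  "diagonal \<gamma> = (map_mat of_int \<gamma>, \<lambda>M\<in>{1..}. reduce M \<gamma>)"

section \<open>Coordinate rings\<close>

text \<open>The coordinate ring of \<open>SL\<^sub>2\<close> over an infinite field \<open>k\<close> is the ring of polynomial functions in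
  the matrix entries on \<open>SL\<^sub>2(k)\<close>. Its elements are represented by functions on all matrices, of
  which only the restriction to \<open>SL\<^sub>2(k)\<close> is relevant.\<close>

inductive_set regular_SL2 :: "('k::field mat \<Rightarrow> 'k) set" where
  const: "(\<lambda>_. c) \<in> regular_SL2"
| entry: "i < 2 \<Longrightarrow> j < 2 \<Longrightarrow> (\<lambda>A. A $$ (i, j)) \<in> regular_SL2"
| add: "p \<in> regular_SL2 \<Longrightarrow> q \<in> regular_SL2 \<Longrightarrow> (\<lambda>A. p A + q A) \<in> regular_SL2"
| mult: "p \<in> regular_SL2 \<Longrightarrow> q \<in> regular_SL2 \<Longrightarrow> (\<lambda>A. p A * q A) \<in> regular_SL2"

text \<open>The coordinate ring of \<open>SL\<^sub>2 \<times> SL\<^sub>2(\<int>/N)\<close>, that is, the tensor product of that of \<open>SL\<^sub>2\<close> with the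
  ring of all functions on the finite group \<open>SL\<^sub>2(\<int>/N)\<close>.\<close>

definition regular_SL2_prod :: "nat \<Rightarrow> ('k::field mat \<times> int mat \<Rightarrow> 'k) set" where
  "regular_SL2_prod N =
     {F. \<forall>l\<in>carrier (SL2_mod N). \<exists>p\<in>regular_SL2. \<forall>h\<in>carrier SL2. F (h, l) = p h}"

section \<open>Representations\<close>

definition kron_mat :: "'k::semiring_0 mat \<Rightarrow> 'k mat \<Rightarrow> 'k mat" where
  "kron_mat A B = mat (dim_row A * dim_row B) (dim_col A * dim_col B)
     (\<lambda>(i, j). A $$ (i div dim_row B, j div dim_col B) * B $$ (i mod dim_row B, j mod dim_col B))"

definition kron_vec :: "'k::semiring_0 vec \<Rightarrow> 'k vec \<Rightarrow> 'k vec" where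
  "kron_vec u v = vec (dim_vec u * dim_vec v) (\<lambda>i. u $ (i div dim_vec v) * v $ (i mod dim_vec v))"

definition subspaces :: "nat \<Rightarrow> 'k::field vec set set" where
  "subspaces n = {W. subspace class_ring W (module_vec TYPE('k) n)}"

definition invariant_subspace ::
    "'g monoid \<Rightarrow> nat \<Rightarrow> ('g \<Rightarrow> 'k::field mat) \<Rightarrow> 'k vec set \<Rightarrow> bool" where
  "invariant_subspace G n \<rho> W \<longleftrightarrow>
     W \<in> subspaces n \<and> (\<forall>g\<in>carrier G. \<forall>v\<in>W. \<rho> g *\<^sub>v v \<in> W)"

definition irreducible_rep :: "'g monoid \<Rightarrow> nat \<Rightarrow> ('g \<Rightarrow> 'k::field mat) \<Rightarrow> bool" where
  "irreducible_rep G n \<rho> \<longleftrightarrow>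
     \<rho> \<in> hom G (GL n) \<and> n > 0 \<and>
     (\<forall>W. invariant_subspace G n \<rho> W \<longrightarrow> W = {0\<^sub>v n} \<or> W = carrier_vec n)"

text \<open>\<open>G\<close>-equivariant linear maps \<open>T\<close> from the representation \<open>\<rho>\<close> on \<open>k\<^sup>n\<close> to a ring \<open>A\<close> of functions on
  \<open>G\<close> with the conjugation action \<open>(g F) h = F (g\<inverse> h g)\<close>. Functions on \<open>G\<close> only matter on the carrier
  of \<open>G\<close>, so linearity and equivariance are tested there.\<close>

definition conj_hom ::
    "'g monoid \<Rightarrow> ('g \<Rightarrow> 'k) set \<Rightarrow> nat \<Rightarrow> ('g \<Rightarrow> 'k::field mat) \<Rightarrow> ('k vec \<Rightarrow> 'g \<Rightarrow> 'k) set" where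
  "conj_hom G A n \<rho> =
     {T. (\<forall>v\<in>carrier_vec n. T v \<in> A) \<and>
         (\<forall>u\<in>carrier_vec n. \<forall>v\<in>carrier_vec n. \<forall>h\<in>carrier G. T (u + v) h = T u h + T v h) \<and>
         (\<forall>c. \<forall>v\<in>carrier_vec n. \<forall>h\<in>carrier G. T (c \<cdot>\<^sub>v v) h = c * T v h) \<and>
         (\<forall>g\<in>carrier G. \<forall>v\<in>carrier_vec n. \<forall>h\<in>carrier G.
            T (\<rho> g *\<^sub>v v) h = T v (inv\<^bsub>G\<^esub> g \<otimes>\<^bsub>G\<^esub> h \<otimes>\<^bsub>G\<^esub> g))}"

definition appears_in_conj_rep :: "'g monoid \<Rightarrow> nat \<Rightarrow> ('g \<Rightarrow> 'k::field mat) \<Rightarrow> bool" where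
  "appears_in_conj_rep G n \<rho> \<longleftrightarrow>
     (\<exists>T\<in>conj_hom G UNIV n \<rho>.
        \<forall>v\<in>carrier_vec n. (\<forall>h\<in>carrier G. T v h = 0) \<longrightarrow> v = 0\<^sub>v n)"

text \<open>The irreducible \<open>SL\<^sub>2\<close>-module \<open>S\<^sup>k(e)\<close>. The positive root subgroup for the torus
  \<open>t \<mapsto> diag(t\<inverse>, t)\<close> is the group of lower triangular unipotent matrices.\<close>

definition highest_weight_module ::
    "nat \<Rightarrow> nat \<Rightarrow> (complex mat \<Rightarrow> complex mat) \<Rightarrow> complex vec \<Rightarrow> bool" where
  "highest_weight_module k d \<sigma> e \<longleftrightarrow>
     irreducible_rep SL2 d \<sigma> \<and>
     (\<forall>i<d. \<forall>j<d. \<exists>p\<in>regular_SL2. \<forall>g\<in>carrier SL2. \<sigma> g $$ (i, j) = p g) \<and>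
     e \<in> carrier_vec d \<and> e \<noteq> 0\<^sub>v d \<and>
     (\<forall>t. t \<noteq> 0 \<longrightarrow> \<sigma> (mat2 (inverse t) 0 0 t) *\<^sub>v e = t ^ k \<cdot>\<^sub>v e) \<and>
     (\<forall>s. \<sigma> (mat2 1 0 s 1) *\<^sub>v e = e)"

section \<open>Vector valued modular forms and their periods\<close>

definition upper_half_plane :: "complex set" where
  "upper_half_plane = {\<tau>. Im \<tau> > 0}"

definition automorphy :: "int mat \<Rightarrow> complex \<Rightarrow> complex" where
  "automorphy \<gamma> \<tau> = of_int (\<gamma> $$ (1, 0)) * \<tau> + of_int (\<gamma> $$ (1, 1))"

definition moebius_action :: "int mat \<Rightarrow> complex \<Rightarrow> complex" where
  "moebius_action \<gamma> \<tau> =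
     (of_int (\<gamma> $$ (0, 0)) * \<tau> + of_int (\<gamma> $$ (0, 1))) / automorphy \<gamma> \<tau>"

text \<open>Holomorphy at the cusp \<open>\<gamma> \<infinity>\<close>: the function \<open>(c \<tau> + d)\<^sup>-\<^sup>m f (\<gamma> \<tau>)\<close>, which is invariant under
  \<open>\<tau> \<mapsto> \<tau> + N\<close>, is holomorphic in \<open>q = exp (2 \<pi> i \<tau> / N)\<close> including at \<open>q = 0\<close>.\<close>

definition vv_modular_form ::
    "nat \<Rightarrow> nat \<Rightarrow> (int mat \<Rightarrow> complex mat) \<Rightarrow> nat \<Rightarrow> (complex \<Rightarrow> complex vec) \<Rightarrow> bool" where
  "vv_modular_form N n \<rho> m f \<longleftrightarrow>
     (\<forall>\<tau>\<in>upper_half_plane. f \<tau> \<in> carrier_vec n) \<and>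
     (\<forall>i<n. (\<lambda>\<tau>. f \<tau> $ i) holomorphic_on upper_half_plane) \<and>
     (\<forall>\<gamma>\<in>carrier SL2_Z. \<forall>\<tau>\<in>upper_half_plane.
        f (moebius_action \<gamma> \<tau>) = automorphy \<gamma> \<tau> ^ m \<cdot>\<^sub>v (\<rho> (reduce N \<gamma>) *\<^sub>v f \<tau>)) \<and>
     (\<forall>\<gamma>\<in>carrier SL2_Z. \<forall>i<n. \<exists>g. g holomorphic_on ball 0 1 \<and>
        (\<forall>\<tau>\<in>upper_half_plane.
           f (moebius_action \<gamma> \<tau>) $ i / automorphy \<gamma> \<tau> ^ m
             = g (exp (2 * of_real pi * \<i> * \<tau> / of_nat N))))"

text \<open>The coefficient of \<open>d\<tau>\<close> in \<open>\<omega>\<^sub>f(e) = 2 \<pi> i f(\<tau>) e\<^sup>\<tau>\<^sup>L(e) d\<tau>\<close>. As \<open>L\<^sup>2 = 0\<close>, the operator \<open>e\<^sup>\<tau>\<^sup>L\<close> on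
  \<open>S\<^sup>m\<^sup>-\<^sup>2(e)\<close> is the action of the upper triangular unipotent matrix with entry \<open>\<tau>\<close>.\<close>

definition omega ::
    "(complex \<Rightarrow> complex vec) \<Rightarrow> (complex mat \<Rightarrow> complex mat) \<Rightarrow> complex vec \<Rightarrow> complex \<Rightarrow> complex vec"
  where
  "omega f \<sigma> e \<tau> = (2 * of_real pi * \<i>) \<cdot>\<^sub>v kron_vec (\<sigma> (mat2 1 \<tau> 0 1) *\<^sub>v e) (f \<tau>)"

definition omega_integral ::
    "(complex \<Rightarrow> complex vec) \<Rightarrow> (complex mat \<Rightarrow> complex mat) \<Rightarrow> complex vec \<Rightarrow>
     (complex vec \<Rightarrow> complex mat \<times> int mat \<Rightarrow> complex) \<Rightarrow> (real \<Rightarrow> complex) \<Rightarrow>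
     complex mat \<times> int mat \<Rightarrow> complex" where
  "omega_integral f \<sigma> e \<phi> p = (\<lambda>x. contour_integral p (\<lambda>\<tau>. \<phi> (omega f \<sigma> e \<tau>) x))"

text \<open>Here \<open>p \<alpha>\<close> is the path chosen from the base point to its translate by \<open>\<alpha>\<close>.\<close>

definition period_function ::
    "nat \<Rightarrow> (complex \<Rightarrow> complex vec) \<Rightarrow> (complex mat \<Rightarrow> complex mat) \<Rightarrow> complex vec \<Rightarrow>
     (complex vec \<Rightarrow> complex mat \<times> int mat \<Rightarrow> complex) \<Rightarrow> (int mat \<Rightarrow> real \<Rightarrow> complex) \<Rightarrow>
     int mat \<Rightarrow> complex" where
  "period_function N f \<sigma> e \<phi> p \<alpha> = omega_integral f \<sigma> e \<phi> (p \<alpha>) (map_mat of_int \<alpha>, reduce N \<alpha>)"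

section \<open>The relative completion of the modular group\<close>

text \<open>Rational representations of \<open>SL\<^sub>2 \<times> SL\<^sub>2(\<int>hat)\<close>. The second factor is a profinite group scheme,
  whose regular functions are those that factor through some \<open>SL\<^sub>2(\<int>/M)\<close>.\<close>

definition rational_rep :: "nat \<Rightarrow> (rat mat \<times> (nat \<Rightarrow> int mat) \<Rightarrow> rat mat) \<Rightarrow> bool" where
  "rational_rep d R \<longleftrightarrow>
     R \<in> hom (SL2 \<times>\<times> SL2_Zhat) (GL d) \<and>
     (\<exists>M\<ge>1. \<forall>i<d. \<forall>j<d. \<exists>F\<in>regular_SL2_prod M.
        \<forall>g\<in>carrier SL2. \<forall>k\<in>carrier SL2_Zhat. R (g, k) $$ (i, j) = F (g, k M))"

text \<open>The category defining \<open>\<G>\<close>, with objects the representations on the spaces \<open>\<rat>\<^sup>n\<close>. The matrix \<open>P\<close>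
  induces an isomorphism from the graded quotient \<open>W (j+1) / W j\<close> to the restriction of \<open>R\<close> along the
  diagonal.\<close>

definition rel_unipotent_reps :: "(nat \<times> (int mat \<Rightarrow> rat mat)) set" where
  "rel_unipotent_reps =
     {(n, \<rho>). \<rho> \<in> hom SL2_Z (GL n) \<and>
       (\<exists>r W. W 0 = {0\<^sub>v n} \<and> W r = carrier_vec n \<and>
          (\<forall>j\<le>r. invariant_subspace SL2_Z n \<rho> (W j)) \<and>
          (\<forall>j<r. W j \<subseteq> W (Suc j) \<and>
             (\<exists>d R P. rational_rep d R \<and> P \<in> carrier_mat d n \<and>
                (\<lambda>v. P *\<^sub>v v) ` W (Suc j) = carrier_vec d \<and>
                {v \<in> W (Suc j). P *\<^sub>v v = 0\<^sub>v d} = W j \<and>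
                (\<forall>\<gamma>\<in>carrier SL2_Z. \<forall>v\<in>W (Suc j).
                   P *\<^sub>v (\<rho> \<gamma> *\<^sub>v v) = R (diagonal \<gamma>) *\<^sub>v (P *\<^sub>v v)))))}"

type_synonym fiber_aut = "nat \<times> (int mat \<Rightarrow> rat mat) \<Rightarrow> complex mat"

text \<open>The group \<open>\<G>(\<complex>)\<close> of tensor automorphisms of the fiber functor \<open>(n, \<rho>) \<mapsto> \<rat>\<^sup>n\<close>, extended to \<open>\<complex>\<close>.
  The category is closed under tensor products, so the membership premise of the tensor condition
  always holds; it is stated because \<open>\<eta>\<close> carries information only on objects of the category.
  Since \<open>\<G>\<close> is an affine group scheme over a field of characteristic zero, it is reduced, and regular
  functions on it are determined by their values on \<open>\<G>(\<complex>)\<close>.\<close>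

definition tannaka_group :: "fiber_aut monoid" where
  "tannaka_group = (product_group rel_unipotent_reps (\<lambda>(n, \<rho>). GL n))
     \<lparr>carrier := {\<eta> \<in> carrier (product_group rel_unipotent_reps (\<lambda>(n, \<rho>). GL n)).
        (\<forall>(n, \<rho>)\<in>rel_unipotent_reps. \<forall>(n', \<rho>')\<in>rel_unipotent_reps. \<forall>T\<in>carrier_mat n' n.
           (\<forall>\<gamma>\<in>carrier SL2_Z. T * \<rho> \<gamma> = \<rho>' \<gamma> * T) \<longrightarrow>
           map_mat of_rat T * \<eta> (n, \<rho>) = \<eta> (n', \<rho>') * map_mat of_rat T) \<and>
        (\<forall>(n, \<rho>)\<in>rel_unipotent_reps. \<forall>(n', \<rho>')\<in>rel_unipotent_reps.
           (n * n', \<lambda>\<gamma>. kron_mat (\<rho> \<gamma>) (\<rho>' \<gamma>)) \<in> rel_unipotent_reps \<longrightarrow>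
           \<eta> (n * n', \<lambda>\<gamma>. kron_mat (\<rho> \<gamma>) (\<rho>' \<gamma>)) = kron_mat (\<eta> (n, \<rho>)) (\<eta> (n', \<rho>'))) \<and>
        \<eta> (1, \<lambda>_. 1\<^sub>m 1) = 1\<^sub>m 1}\<rparr>"

definition canonical_hom :: "int mat \<Rightarrow> fiber_aut" where
  "canonical_hom \<gamma> = (\<lambda>(n, \<rho>)\<in>rel_unipotent_reps. map_mat of_rat (\<rho> \<gamma>))"

text \<open>\<open>\<O>(\<G>)\<close>, a ring over \<open>\<rat>\<close>, realised by functions on \<open>\<G>(\<complex>)\<close>: as \<open>\<G>\<close> is closed in the product of the
  groups \<open>GL(V)\<close>, the ring is generated by the matrix entries and the inverse determinants.\<close>

inductive_set tannaka_ring :: "(fiber_aut \<Rightarrow> complex) set" where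
  const: "(\<lambda>_. of_rat c) \<in> tannaka_ring"
| entry: "(n, \<rho>) \<in> rel_unipotent_reps \<Longrightarrow> i < n \<Longrightarrow> j < n \<Longrightarrow>
    (\<lambda>\<eta>. \<eta> (n, \<rho>) $$ (i, j)) \<in> tannaka_ring"
| inv_det: "(n, \<rho>) \<in> rel_unipotent_reps \<Longrightarrow> (\<lambda>\<eta>. inverse (det (\<eta> (n, \<rho>)))) \<in> tannaka_ring"
| add: "\<Phi> \<in> tannaka_ring \<Longrightarrow> \<Psi> \<in> tannaka_ring \<Longrightarrow> (\<lambda>\<eta>. \<Phi> \<eta> + \<Psi> \<eta>) \<in> tannaka_ring"
| mult: "\<Phi> \<in> tannaka_ring \<Longrightarrow> \<Psi> \<in> tannaka_ring \<Longrightarrow> (\<lambda>\<eta>. \<Phi> \<eta> * \<Psi> \<eta>) \<in> tannaka_ring"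

definition class_function :: "'g monoid \<Rightarrow> ('g \<Rightarrow> 'a) \<Rightarrow> bool" where
  "class_function G F \<longleftrightarrow>
     (\<forall>g\<in>carrier G. \<forall>h\<in>carrier G. F (h \<otimes>\<^bsub>G\<^esub> g \<otimes>\<^bsub>G\<^esub> inv\<^bsub>G\<^esub> h) = F g)"

definition Cl :: "(fiber_aut \<Rightarrow> complex) set" where
  "Cl = {\<Phi> \<in> tannaka_ring. class_function tannaka_group \<Phi>}"

definition Cl_C :: "(fiber_aut \<Rightarrow> complex) set" where
  "Cl_C = {\<Phi>. \<exists>(r::nat) c \<Psi>. (\<forall>i<r. \<Psi> i \<in> Cl) \<and> \<Phi> = (\<lambda>\<eta>. \<Sum>i<r. c i * \<Psi> i \<eta>)}"

end

theory Submission
  imports Defs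
begin

no_notation fps_nth (infixl "$" 75)

text \<open>
  The vector \<open>\<sigma> g e\<close> depends only on the second column \<open>(b, d)\<close> of \<open>g\<close>, and as a homogeneous
  polynomial of degree \<open>m - 2\<close> in it. Hence \<open>\<omega>\<^sub>f(e)\<close> lifts to an invariant form with values in
  finitely many copies of \<open>W \<otimes> \<complex>\<close>, where \<open>W = Sym\<^sup>m\<^sup>-\<^sup>2 \<otimes> \<rat>[SL\<^sub>2(\<int>/N)]\<close> is a rational
  representation of \<open>SL\<^sub>2 \<times> SL\<^sub>2(\<int>/N)\<close>. Its periods form a cocycle \<open>c\<close> with values in \<open>W \<otimes> \<complex>\<close>, and
  the period function is \<open>\<alpha> \<mapsto> P(c(\<alpha>))(\<alpha>)\<close> for an equivariant map \<open>P\<close> from \<open>W \<otimes> \<complex>\<close> to the regular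
  functions. A computation valid in every group shows that such a function is a class function.

  As the modular group is finitely generated, \<open>c\<close> is a finite complex combination of rational
  cocycles, and \<open>P\<close> is one of equivariant maps with rational coefficients, where equivariance passes
  from rational to complex points by Zariski density. A rational cocycle \<open>c\<close> is an
  extension of the trivial representation by \<open>W\<close>, an object of the tannakian category. The
  tensor automorphisms act on the standard representation through \<open>SL\<^sub>2(\<complex>)\<close>, on the regular one
  through \<open>SL\<^sub>2(\<int>/N)\<close>, and on the extension through \<open>W\<close> and a cocycle of \<open>\<G>(\<complex>)\<close> that extends \<open>c\<close>.
  The same formula therefore defines a class function on \<open>\<G>(\<complex>)\<close>.
\<close>

section \<open>Groups of matrices\<close>

text \<open>The module \<open>V_\<chi>\<close> need not have a rational model, whereas the objects
  of the category are rational. This is why \<open>\<rho>\<close> is traded for the regular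
  representation: vectors embed into it by matrix coefficients, and its matrices are permutation
  matrices over every field. Full tannakian reconstruction is avoided. A tensor automorphism has to
  be known on a few explicit objects only, and there it is pinned down by invariant maps: the
  alternating form on the plane, the embeddings of symmetric powers, the product of functions on the
  finite group, and right translations. The other obstacle is that elements of \<open>Cl\<close>
  have rational coefficients and each must itself be a class function. Splitting the finished period
  function into rational parts would give no control over this, so the cocycle and the equivariant
  map are split separately along a basis of the complex numbers over the rationals. The coordinates
  in such a basis are only rationally linear and hence compatible with the group action at rational
  points only, which is what makes a density argument necessary.\<close>

lemma group_GL: "group (GL n :: 'k::field mat monoid)"
proof -
  interpret ring "ring_mat TYPE('k) n ()" by (rule ring_mat)
  show ?thesis unfolding GL_def by (rule units_group)
qed

lemma GL_mult [simp]: "mult (GL n) = (*)"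
  and GL_one [simp]: "one (GL n) = 1\<^sub>m n"
  by (simp_all add: GL_def units_of_def ring_mat_def)

lemma GL_carrier: "A \<in> carrier (GL n) \<longleftrightarrow> A \<in> carrier_mat n n \<and> (\<exists>B\<in>carrier_mat n n. A * B = 1\<^sub>m n \<and> B * A = 1\<^sub>m n)"
  by (auto simp: GL_def units_of_def ring_mat_def Units_def)

lemma GL_carrierI:
  "A \<in> carrier_mat n n \<Longrightarrow> B \<in> carrier_mat n n \<Longrightarrow> A * B = 1\<^sub>m n \<Longrightarrow> B * A = 1\<^sub>m n \<Longrightarrow> A \<in> carrier (GL n)"
  unfolding GL_carrier by blast

lemma GL_carrierD [dest]: "A \<in> carrier (GL n) \<Longrightarrow> A \<in> carrier_mat n n"
  unfolding GL_carrier by blast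

lemma mat2_carrier [simp]: "mat2 a b c d \<in> carrier_mat 2 2"
  by (auto simp: mat2_def mat_of_rows_list_def)

lemma mat2_index [simp]:
  "mat2 a b c d $$ (0, 0) = a" "mat2 a b c d $$ (0, Suc 0) = b"
  "mat2 a b c d $$ (Suc 0, 0) = c" "mat2 a b c d $$ (Suc 0, Suc 0) = d"
  by (simp_all add: mat2_def mat_of_rows_list_def)

lemma mat2_dim [simp]: "dim_row (mat2 a b c d) = 2" "dim_col (mat2 a b c d) = 2"
  by (simp_all add: mat2_def mat_of_rows_list_def)

lemma mat2_eqI:
  assumes "A \<in> carrier_mat 2 2" "B \<in> carrier_mat 2 2"
    "A $$ (0, 0) = B $$ (0, 0)" "A $$ (0, 1) = B $$ (0, 1)"
    "A $$ (1, 0) = B $$ (1, 0)" "A $$ (1, 1) = B $$ (1, 1)"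
  shows "A = B"
proof (rule eq_matI)
  fix i j assume "i < dim_row B" "j < dim_col B"
  then have "i < 2" "j < 2" using assms by auto
  then have "i = 0 \<or> i = 1" "j = 0 \<or> j = 1" by auto
  then show "A $$ (i, j) = B $$ (i, j)" using assms by auto
qed (use assms in auto)

lemma mat2_collapse:
  "A \<in> carrier_mat 2 2 \<Longrightarrow> mat2 (A $$ (0, 0)) (A $$ (0, 1)) (A $$ (1, 0)) (A $$ (1, 1)) = A"
  by (rule mat2_eqI) auto

lemma mat2_mult [simp]:
  "mat2 a b c d * mat2 a' b' c' d' =
   mat2 (a * a' + b * c') (a * b' + b * d') (c * a' + d * c') (c * b' + d * d' :: 'a::comm_ring_1)"
  by (rule mat2_eqI) (auto simp: scalar_prod_def row_def col_def numeral_2_eq_2)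

lemma mat2_one: "1\<^sub>m 2 = mat2 1 0 0 (1 :: 'a::comm_ring_1)"
  by (rule mat2_eqI) auto

lemma det_mat2 [simp]: "det (mat2 a b c d) = a * d - b * (c :: 'a::comm_ring_1)"
proof -
  have "det (mat2 a b c d) = (\<Sum>j<2. mat2 a b c d $$ (0, j) * cofactor (mat2 a b c d) 0 j)"
    by (rule laplace_expansion_row) auto
  also have "\<dots> = a * d - b * c"
    by (simp add: cofactor_def numeral_2_eq_2 det_single mat_delete_def)
  finally show ?thesis .
qed

lemma mat2_inject [simp]:
  "mat2 a b c d = mat2 a' b' c' d' \<longleftrightarrow> a = a' \<and> b = b' \<and> c = c' \<and> d = d'"
  by (metis mat2_index)

lemma map_mat2 [simp]: "map_mat h (mat2 a b c d) = mat2 (h a) (h b) (h c) (h d)"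
  by (rule mat2_eqI) auto

lemma carrier_mat2_cases:
  assumes "A \<in> carrier_mat 2 2"
  obtains a b c d where "A = mat2 a b c d"
  using mat2_collapse[OF assms] by metis

section \<open>The group SL2 over a commutative ring\<close>

lemma SL2_simps [simp]:
  "mult SL2 = (*)" "one SL2 = 1\<^sub>m 2"
  by (simp_all add: SL2_def)

lemma SL2_carrier: "A \<in> carrier SL2 \<longleftrightarrow> A \<in> carrier_mat 2 2 \<and> det A = 1"
  by (simp add: SL2_def)

lemma mat2_SL2 [simp]: "mat2 a b c d \<in> carrier SL2 \<longleftrightarrow> a * d - b * c = 1"
  by (simp add: SL2_carrier)

lemma SL2_cases:
  assumes "A \<in> carrier SL2"
  obtains a b c d where "A = mat2 a b c d" "a * d - b * c = 1"
proof -
  obtain a b c d where "A = mat2 a b c d"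
    using assms carrier_mat2_cases by (metis SL2_carrier)
  with assms that show thesis by simp
qed

lemma SL2_group [simp]: "group (SL2 :: 'a::comm_ring_1 mat monoid)"
proof (rule groupI)
  fix A :: "'a mat" assume "A \<in> carrier SL2"
  then obtain a b c d where A: "A = mat2 a b c d" "a * d - b * c = 1" by (rule SL2_cases)
  show "\<exists>B\<in>carrier SL2. B \<otimes>\<^bsub>SL2\<^esub> A = \<one>\<^bsub>SL2\<^esub>"
    by (rule bexI[of _ "mat2 d (-b) (-c) a"]) (use A in \<open>auto simp: mat2_one algebra_simps\<close>)
next
  fix A B :: "'a mat" assume "A \<in> carrier SL2" "B \<in> carrier SL2"
  then show "A \<otimes>\<^bsub>SL2\<^esub> B \<in> carrier SL2"
    by (auto simp: SL2_carrier det_mult)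
next
  fix A B C :: "'a mat" assume "A \<in> carrier SL2" "B \<in> carrier SL2" "C \<in> carrier SL2"
  then show "A \<otimes>\<^bsub>SL2\<^esub> B \<otimes>\<^bsub>SL2\<^esub> C = A \<otimes>\<^bsub>SL2\<^esub> (B \<otimes>\<^bsub>SL2\<^esub> C)"
    by (auto simp: SL2_carrier)
qed (auto simp: SL2_carrier)

lemma SL2_inv: 
  assumes "a * d - b * c = (1 :: 'a::comm_ring_1)"
  shows "inv\<^bsub>SL2\<^esub> (mat2 a b c d) = mat2 d (-b) (-c) a"
  by (rule group.inv_equality[OF SL2_group]) (use assms in \<open>auto simp: mat2_one algebra_simps\<close>)

lemma map_mat_mult2:
  fixes A B :: "'a::comm_ring_1 mat"
  assumes "A \<in> carrier_mat 2 2" "B \<in> carrier_mat 2 2"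
    and "\<And>x y. h (x + y) = h x + h y" "\<And>x y. h (x * y) = h x * (h y :: 'b::comm_ring_1)"
  shows "map_mat h (A * B) = map_mat h A * map_mat h B"
proof -
  obtain a b c d where A: "A = mat2 a b c d" using assms(1) by (rule carrier_mat2_cases)
  obtain a' b' c' d' where B: "B = mat2 a' b' c' d'" using assms(2) by (rule carrier_mat2_cases)
  show ?thesis unfolding A B by (simp add: assms(3,4))
qed

lemma map_mat_of_int_SL2 [simp]:
  "\<gamma> \<in> carrier SL2_Z \<Longrightarrow> map_mat of_int \<gamma> \<in> carrier (SL2 :: 'a::comm_ring_1 mat monoid)"
  by (erule SL2_cases) (auto simp flip: of_int_mult of_int_diff)

lemma map_mat_of_int_mult [simp]:
  "\<alpha> \<in> carrier SL2_Z \<Longrightarrow> \<beta> \<in> carrier SL2_Z \<Longrightarrow>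
   map_mat of_int (\<alpha> * \<beta>) = (map_mat of_int \<alpha> * map_mat of_int \<beta> :: 'a::comm_ring_1 mat)"
  by (rule map_mat_mult2) (auto simp: SL2_carrier)

lemma map_mat_of_rat_SL2 [simp]:
  "\<gamma> \<in> carrier SL2 \<Longrightarrow> map_mat of_rat \<gamma> \<in> carrier (SL2 :: complex mat monoid)"
  by (erule SL2_cases) (auto simp flip: of_rat_mult of_rat_diff)

lemma map_mat_of_rat_mult2 [simp]:
  "\<alpha> \<in> carrier SL2 \<Longrightarrow> \<beta> \<in> carrier SL2 \<Longrightarrow>
   map_mat of_rat (\<alpha> * \<beta>) = (map_mat of_rat \<alpha> * map_mat of_rat \<beta> :: complex mat)"
  by (rule map_mat_mult2) (auto simp: SL2_carrier of_rat_add of_rat_mult)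

lemma map_mat_of_rat_of_int:
  "map_mat of_rat (map_mat of_int A) = (map_mat of_int A :: complex mat)"
  by (rule eq_matI) auto

section \<open>Reduction modulo N and the finite quotients of the modular group\<close>

lemma reduce_mat2 [simp]:
  "reduce N (mat2 a b c d) = mat2 (a mod int N) (b mod int N) (c mod int N) (d mod int N)"
  by (simp add: reduce_def)

lemma reduce_carrier [simp]: "reduce N A \<in> carrier_mat r s \<longleftrightarrow> A \<in> carrier_mat r s"
  by (auto simp: reduce_def)

lemma reduce_reduce [simp]: "reduce N (reduce N A) = reduce N A"
  by (rule eq_matI) (auto simp: reduce_def)

lemma reduce_mult:
  assumes "A \<in> carrier_mat 2 2" "B \<in> carrier_mat 2 2"
  shows "reduce N (reduce N A * reduce N B) = reduce N (A * B)"
    and "reduce N (reduce N A * B) = reduce N (A * B)"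
    and "reduce N (A * reduce N B) = reduce N (A * B)"
proof -
  obtain a b c d where A: "A = mat2 a b c d" using assms(1) by (rule carrier_mat2_cases)
  obtain a' b' c' d' where B: "B = mat2 a' b' c' d'" using assms(2) by (rule carrier_mat2_cases)
  show "reduce N (reduce N A * reduce N B) = reduce N (A * B)"
    "reduce N (reduce N A * B) = reduce N (A * B)" "reduce N (A * reduce N B) = reduce N (A * B)"
    unfolding A B by (simp_all, (intro conjI mod_add_cong mod_mult_cong; simp)+)
qed

lemma det_reduce:
  assumes "A \<in> carrier_mat 2 2"
  shows "det (reduce N A) mod int N = det A mod int N"
  using assms by (rule carrier_mat2_cases) (simp, intro mod_diff_cong mod_mult_cong; simp)

lemma SL2_mod_simps [simp]:
  "mult (SL2_mod N) = (\<lambda>A B. reduce N (A * B))" "one (SL2_mod N) = reduce N (1\<^sub>m 2)"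
  by (simp_all add: SL2_mod_def)

lemma SL2_mod_carrier:
  "A \<in> carrier (SL2_mod N) \<longleftrightarrow> A \<in> carrier_mat 2 2 \<and> reduce N A = A \<and> det A mod int N = 1 mod int N"
  by (simp add: SL2_mod_def)

lemma reduce_SL2_mod:
  "A \<in> carrier_mat 2 2 \<Longrightarrow> det A mod int N = 1 mod int N \<Longrightarrow> reduce N A \<in> carrier (SL2_mod N)"
  by (auto simp: SL2_mod_carrier det_reduce)

lemma reduce_SL2_Z [simp]: "\<gamma> \<in> carrier SL2_Z \<Longrightarrow> reduce N \<gamma> \<in> carrier (SL2_mod N)"
  by (rule reduce_SL2_mod) (auto simp: SL2_carrier)

lemma SL2_mod_group [simp]: "group (SL2_mod N)"
proof (rule groupI)
  fix A assume "A \<in> carrier (SL2_mod N)"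
  moreover from this obtain a b c d where A: "A = mat2 a b c d"
    using carrier_mat2_cases by (metis SL2_mod_carrier)
  ultimately have d: "(a * d - b * c) mod int N = 1 mod int N" by (simp add: SL2_mod_carrier)
  let ?B = "mat2 d (-b) (-c) a"
  have B: "reduce N ?B \<in> carrier (SL2_mod N)"
    by (rule reduce_SL2_mod) (use d in \<open>auto simp: algebra_simps\<close>)
  have "reduce N (reduce N ?B * A) = reduce N (?B * A)" by (rule reduce_mult) (auto simp: A)
  also have "\<dots> = reduce N (1\<^sub>m 2)" using d by (simp add: A mat2_one algebra_simps)
  finally show "\<exists>B\<in>carrier (SL2_mod N). B \<otimes>\<^bsub>SL2_mod N\<^esub> A = \<one>\<^bsub>SL2_mod N\<^esub>"
    using B by auto
next
  fix A B assume *: "A \<in> carrier (SL2_mod N)" "B \<in> carrier (SL2_mod N)"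
  show "A \<otimes>\<^bsub>SL2_mod N\<^esub> B \<in> carrier (SL2_mod N)"
    unfolding SL2_mod_simps
  proof (rule reduce_SL2_mod)
    have "(det A * det B) mod int N = (1 * 1) mod int N"
      by (rule mod_mult_cong) (use * in \<open>auto simp: SL2_mod_carrier\<close>)
    then show "det (A * B) mod int N = 1 mod int N"
      using * det_mult[of A 2 B] by (simp add: SL2_mod_carrier)
  qed (use * in \<open>auto simp: SL2_mod_carrier\<close>)
next
  fix A B C assume "A \<in> carrier (SL2_mod N)" "B \<in> carrier (SL2_mod N)" "C \<in> carrier (SL2_mod N)"
  then show "A \<otimes>\<^bsub>SL2_mod N\<^esub> B \<otimes>\<^bsub>SL2_mod N\<^esub> C = A \<otimes>\<^bsub>SL2_mod N\<^esub> (B \<otimes>\<^bsub>SL2_mod N\<^esub> C)"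
    using reduce_mult(2)[of "A * B" C N] reduce_mult(3)[of A "B * C" N]
      mult_carrier_mat[of A 2 2 B 2] mult_carrier_mat[of B 2 2 C 2] assoc_mult_mat[of A 2 2 B 2 C 2]
    by (simp add: SL2_mod_carrier)
next
  show "\<one>\<^bsub>SL2_mod N\<^esub> \<in> carrier (SL2_mod N)"
    unfolding SL2_mod_simps by (rule reduce_SL2_mod) auto
next
  fix A assume "A \<in> carrier (SL2_mod N)"
  then show "\<one>\<^bsub>SL2_mod N\<^esub> \<otimes>\<^bsub>SL2_mod N\<^esub> A = A"
    using left_mult_one_mat[of A 2 2] by (simp add: SL2_mod_carrier reduce_mult)
qed

lemma SL2_mod_finite:
  assumes "N \<ge> 1" shows "finite (carrier (SL2_mod N))"
proof (rule finite_subset)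
  let ?I = "{0..<int N}"
  show "carrier (SL2_mod N) \<subseteq> (\<lambda>(a, b, c, d). mat2 a b c d) ` (?I \<times> ?I \<times> ?I \<times> ?I)"
  proof
    fix A assume A: "A \<in> carrier (SL2_mod N)"
    then obtain a b c d where "A = mat2 a b c d"
      using carrier_mat2_cases by (metis SL2_mod_carrier)
    moreover from this A have "a mod int N = a" "b mod int N = b" "c mod int N = c" "d mod int N = d"
      by (simp_all add: SL2_mod_carrier)
    then have "a \<in> ?I" "b \<in> ?I" "c \<in> ?I" "d \<in> ?I"
      using assms pos_mod_bound[of "int N" a] pos_mod_sign[of "int N" a]
        pos_mod_bound[of "int N" b] pos_mod_sign[of "int N" b]
        pos_mod_bound[of "int N" c] pos_mod_sign[of "int N" c]
        pos_mod_bound[of "int N" d] pos_mod_sign[of "int N" d] by simp_all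
    ultimately show "A \<in> (\<lambda>(a, b, c, d). mat2 a b c d) ` (?I \<times> ?I \<times> ?I \<times> ?I)"
      by (intro image_eqI[of _ _ "(a, b, c, d)"]) simp_all
  qed
qed auto

lemma reduce_SL2_mult:
  "\<alpha> \<in> carrier SL2_Z \<Longrightarrow> \<beta> \<in> carrier SL2_Z \<Longrightarrow>
   reduce N (\<alpha> * \<beta>) = reduce N (reduce N \<alpha> * reduce N \<beta>)"
  by (simp add: SL2_carrier reduce_mult)

lemma SL2_Zhat_mult: "k \<otimes>\<^bsub>SL2_Zhat\<^esub> l = (\<lambda>i\<in>{1..}. reduce i (k i * l i))"
  by (simp add: SL2_Zhat_def)

lemma SL2_Zhat_component: "k \<in> carrier SL2_Zhat \<Longrightarrow> M \<ge> 1 \<Longrightarrow> k M \<in> carrier (SL2_mod M)"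
  by (auto simp: SL2_Zhat_def PiE_def Pi_def)

section \<open>Class functions from cocycles\<close>

text \<open>Equivariance moves \<open>A g\<close> from the cocycle to the evaluation point, where it
  becomes conjugation by g (\<open>move\<close>). Expanding c(h g h^-1) at the point x = h g h^-1
  gives c(h) at x, then c(g) and c(h^-1), both at g, since h^-1 x h = g and g is fixed under
  conjugation by itself. Expanding c(h h^-1) at x shows that the first and the last of these terms
  cancel.\<close>

lemma class_function_cocycle:
  fixes c :: "'g \<Rightarrow> nat \<Rightarrow> 'k::field"
  assumes "group H"
    and cocycle: "\<And>g h i. g \<in> carrier H \<Longrightarrow> h \<in> carrier H \<Longrightarrow> i < D \<Longrightarrow>
      c (g \<otimes>\<^bsub>H\<^esub> h) i = c g i + (\<Sum>j<D. A g i j * c h j)"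
    and equivariant: "\<And>g h i. g \<in> carrier H \<Longrightarrow> h \<in> carrier H \<Longrightarrow> i < D \<Longrightarrow>
      (\<Sum>j<D. A g j i * P j h) = P i (inv\<^bsub>H\<^esub> g \<otimes>\<^bsub>H\<^esub> h \<otimes>\<^bsub>H\<^esub> g)"
  shows "class_function H (\<lambda>h. \<Sum>i<D. c h i * P i h)"
  unfolding class_function_def
proof (intro ballI)
  interpret group H by fact
  have move: "(\<Sum>i<D. c (a \<otimes>\<^bsub>H\<^esub> b) i * P i x) =
      (\<Sum>i<D. c a i * P i x) + (\<Sum>i<D. c b i * P i (inv\<^bsub>H\<^esub> a \<otimes>\<^bsub>H\<^esub> x \<otimes>\<^bsub>H\<^esub> a))"
    if "a \<in> carrier H" "b \<in> carrier H" "x \<in> carrier H" for a b x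
  proof -
    have "(\<Sum>i<D. c (a \<otimes>\<^bsub>H\<^esub> b) i * P i x) =
        (\<Sum>i<D. c a i * P i x) + (\<Sum>i<D. \<Sum>j<D. A a i j * c b j * P i x)"
      using that by (simp add: cocycle distrib_right sum.distrib sum_distrib_right)
    also have "(\<Sum>i<D. \<Sum>j<D. A a i j * c b j * P i x) = (\<Sum>j<D. c b j * (\<Sum>i<D. A a i j * P i x))"
      by (subst sum.swap) (simp add: sum_distrib_left mult_ac)
    finally show ?thesis using that by (simp add: equivariant)
  qed
  fix g h assume g: "g \<in> carrier H" and h: "h \<in> carrier H"
  let ?x = "h \<otimes>\<^bsub>H\<^esub> g \<otimes>\<^bsub>H\<^esub> inv\<^bsub>H\<^esub> h"
  have conj: "inv\<^bsub>H\<^esub> h \<otimes>\<^bsub>H\<^esub> ?x \<otimes>\<^bsub>H\<^esub> h = g" "inv\<^bsub>H\<^esub> g \<otimes>\<^bsub>H\<^esub> g \<otimes>\<^bsub>H\<^esub> g = g"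
    using g h by (simp_all add: m_assoc inv_solve_left')
  \<comment> \<open>The vanishing at the identity is obtained for the pairing with \<open>P\<close>
    rather than for c: \<open>move\<close> at the identity reads s = s + s.\<close>
  have "(\<Sum>i<D. c \<one>\<^bsub>H\<^esub> i * P i ?x) = 0"
  proof -
    have x: "?x \<in> carrier H" using g h by simp
    have eq: "inv\<^bsub>H\<^esub> \<one>\<^bsub>H\<^esub> \<otimes>\<^bsub>H\<^esub> ?x \<otimes>\<^bsub>H\<^esub> \<one>\<^bsub>H\<^esub> = ?x" "\<one>\<^bsub>H\<^esub> \<otimes>\<^bsub>H\<^esub> \<one>\<^bsub>H\<^esub> = \<one>\<^bsub>H\<^esub>"
      using x by simp_all
    show ?thesis
      using move[OF one_closed one_closed x] unfolding eq add_cancel_right_right .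
  qed
  moreover have "(\<Sum>i<D. c \<one>\<^bsub>H\<^esub> i * P i ?x) = (\<Sum>i<D. c h i * P i ?x) + (\<Sum>i<D. c (inv\<^bsub>H\<^esub> h) i * P i g)"
    using move[of h "inv\<^bsub>H\<^esub> h" ?x] g h conj by simp
  moreover have "(\<Sum>i<D. c ?x i * P i ?x) =
      (\<Sum>i<D. c h i * P i ?x) + ((\<Sum>i<D. c g i * P i g) + (\<Sum>i<D. c (inv\<^bsub>H\<^esub> h) i * P i g))"
    using move[of h "g \<otimes>\<^bsub>H\<^esub> inv\<^bsub>H\<^esub> h" ?x] move[of g "inv\<^bsub>H\<^esub> h" g] g h conj by (simp add: m_assoc)
  ultimately show "(\<Sum>i<D. c ?x i * P i ?x) = (\<Sum>i<D. c g i * P i g)"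
    by (simp add: add.left_commute)
qed

section \<open>Kronecker products\<close>

lemma pair_index_less:
  assumes "i < a" "j < b" shows "i * b + j < a * (b :: nat)"
proof -
  have "i * b + j < Suc i * b" using assms by simp
  also have "\<dots> \<le> a * b" using assms by (intro mult_le_mono) auto
  finally show ?thesis .
qed

text \<open>The double-sum form of the index encoding of \<open>kron_mat\<close>; the computations
  with tensor products below pass through it.\<close>

lemma sum_div_mod:
  fixes f :: "nat \<Rightarrow> nat \<Rightarrow> 'a::comm_monoid_add"
  shows "(\<Sum>i<a * b. f (i div b) (i mod b)) = (\<Sum>i<a. \<Sum>j<b. f i j)"
  by (subst sum.cartesian_product,
      intro sum.reindex_bij_witness[of _ "\<lambda>(i, j). i * b + j" "\<lambda>i. (i div b, i mod b)"])
     (auto simp: less_mult_imp_div_less pair_index_less intro!: mod_less_divisor gr0I)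

lemma div_mod_less:
  assumes "i < a * (b :: nat)" shows "i div b < a" "i mod b < b"
  using assms by (auto simp: less_mult_imp_div_less intro!: mod_less_divisor gr0I)

lemma kron_mat_carrier [simp]:
  "A \<in> carrier_mat a b \<Longrightarrow> B \<in> carrier_mat c d \<Longrightarrow> kron_mat A B \<in> carrier_mat (a * c) (b * d)"
  by (auto simp: kron_mat_def)

lemma kron_mat_index:
  "A \<in> carrier_mat a b \<Longrightarrow> B \<in> carrier_mat c d \<Longrightarrow> i < a * c \<Longrightarrow> j < b * d \<Longrightarrow>
   kron_mat A B $$ (i, j) = A $$ (i div c, j div d) * B $$ (i mod c, j mod d)"
  by (auto simp: kron_mat_def)

lemma mult_mat_index:
  "A \<in> carrier_mat a b \<Longrightarrow> B \<in> carrier_mat b c \<Longrightarrow> i < a \<Longrightarrow> j < c \<Longrightarrow>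
   (A * B) $$ (i, j) = (\<Sum>k<b. A $$ (i, k) * B $$ (k, j))"
  by (auto simp: scalar_prod_def lessThan_atLeast0 intro!: sum.cong)

lemma mult_mat_vec_index:
  "A \<in> carrier_mat a b \<Longrightarrow> v \<in> carrier_vec b \<Longrightarrow> i < a \<Longrightarrow> (A *\<^sub>v v) $ i = (\<Sum>k<b. A $$ (i, k) * v $ k)"
  by (auto simp: scalar_prod_def lessThan_atLeast0 intro!: sum.cong)

lemma kron_mat_mult:
  fixes A B C D :: "'k::field mat"
  assumes "A \<in> carrier_mat a b" "B \<in> carrier_mat b c" "C \<in> carrier_mat a' b'" "D \<in> carrier_mat b' c'"
  shows "kron_mat (A * B) (C * D) = kron_mat A C * kron_mat B D"
proof (rule eq_matI)
  note carr = assms kron_mat_carrier[OF assms(1,3)] kron_mat_carrier[OF assms(2,4)]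
    mult_carrier_mat[OF assms(1,2)] mult_carrier_mat[OF assms(3,4)]
  fix i j assume "i < dim_row (kron_mat A C * kron_mat B D)" "j < dim_col (kron_mat A C * kron_mat B D)"
  then have ij: "i < a * a'" "j < c * c'" using carr by auto
  have "(kron_mat A C * kron_mat B D) $$ (i, j) = (\<Sum>k<b * b'.
      A $$ (i div a', k div b') * C $$ (i mod a', k mod b') * (B $$ (k div b', j div c') * D $$ (k mod b', j mod c')))"
    using carr ij by (subst mult_mat_index[of _ "a * a'" "b * b'" _ "c * c'"])
      (auto simp: kron_mat_index[OF assms(1,3)] kron_mat_index[OF assms(2,4)] intro!: sum.cong)
  also have "\<dots> = (\<Sum>k<b. \<Sum>l<b'. A $$ (i div a', k) * C $$ (i mod a', l) * (B $$ (k, j div c') * D $$ (l, j mod c')))"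
    by (rule sum_div_mod)
  also have "\<dots> = (A * B) $$ (i div a', j div c') * (C * D) $$ (i mod a', j mod c')"
    using div_mod_less[OF ij(1)] div_mod_less[OF ij(2)]
    by (simp add: mult_mat_index[OF assms(1,2)] mult_mat_index[OF assms(3,4)]
        sum_product mult_ac del: index_mult_mat(1))
  also have "\<dots> = kron_mat (A * B) (C * D) $$ (i, j)"
    using ij by (simp add: kron_mat_index[OF carr(7,8)])
  finally show "kron_mat (A * B) (C * D) $$ (i, j) = (kron_mat A C * kron_mat B D) $$ (i, j)" ..
qed (use assms in \<open>auto simp: kron_mat_def\<close>)

lemma kron_mat_one: "kron_mat (1\<^sub>m a) (1\<^sub>m b) = (1\<^sub>m (a * b) :: 'k::field mat)"
proof (rule eq_matI)
  fix i j assume "i < dim_row (1\<^sub>m (a * b) :: 'k mat)" "j < dim_col (1\<^sub>m (a * b) :: 'k mat)"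
  then have ij: "i < a * b" "j < a * b" by auto
  then have "i = j \<longleftrightarrow> i div b = j div b \<and> i mod b = j mod b" by (metis div_mult_mod_eq)
  then show "kron_mat (1\<^sub>m a) (1\<^sub>m b) $$ (i, j) = (1\<^sub>m (a * b) :: 'k mat) $$ (i, j)"
    using ij by (auto simp: kron_mat_index[of _ a a _ b b] div_mod_less[of _ a b])
qed (auto simp: kron_mat_def)

section \<open>Symmetric powers of the standard representation\<close>

text \<open>The action on binary forms: applied to the column of monomials u^(k-l) v^l at w = (u,
  v), the matrix yields the column at g w. Row j is therefore the expansion of a product of powers
  of the two linear forms of \<open>g\<close>, written in one variable by setting u = 1. No binomial
  factors enter, so the entries are integral polynomials in those of \<open>g\<close>.\<close>

definition sym_mat :: "nat \<Rightarrow> 'a::field_char_0 mat \<Rightarrow> 'a mat" where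
  "sym_mat k g = mat (Suc k) (Suc k) (\<lambda>(j, l).
     coeff ([:g $$ (0, 0), g $$ (0, 1):] ^ (k - j) * [:g $$ (1, 0), g $$ (1, 1):] ^ j) l)"

lemma sym_mat_carrier [simp]: "sym_mat k g \<in> carrier_mat (Suc k) (Suc k)"
  by (simp add: sym_mat_def)

lemma sym_mat_dim [simp]: "dim_row (sym_mat k g) = Suc k" "dim_col (sym_mat k g) = Suc k"
  by (simp_all add: sym_mat_def)

lemma coeff_linear_mult:
  "coeff ([:a, b:] * P) l = a * coeff P l + (if l = 0 then 0 else b * coeff P (l - 1))"
  by (auto simp: coeff_pCons split: nat.split)

text \<open>The homogenisation of \<open>P\<close> to degree k, evaluated at (u, v); k is explicit
  because it may exceed the degree of \<open>P\<close>.\<close>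

definition form_value :: "nat \<Rightarrow> 'a::comm_ring_1 poly \<Rightarrow> 'a \<Rightarrow> 'a \<Rightarrow> 'a" where
  "form_value k P u v = (\<Sum>l\<le>k. coeff P l * (u ^ (k - l) * v ^ l))"

lemma form_value_linear_mult:
  assumes "degree P \<le> k"
  shows "form_value (Suc k) ([:a, b:] * P) u v = (a * u + b * v) * form_value k P u v"
proof -
  have "coeff P (Suc k) = 0" using assms by (simp add: coeff_eq_0)
  then have "(\<Sum>l\<le>Suc k. a * coeff P l * (u ^ (Suc k - l) * v ^ l)) = a * u * form_value k P u v"
    by (simp add: form_value_def sum_distrib_left Suc_diff_le mult_ac)
  moreover have "(\<Sum>l\<le>Suc k. (if l = 0 then 0 else b * coeff P (l - 1)) * (u ^ (Suc k - l) * v ^ l))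
      = b * v * form_value k P u v"
    by (subst sum.atMost_Suc_shift) (simp add: form_value_def sum_distrib_left mult_ac)
  ultimately show ?thesis
    unfolding form_value_def coeff_linear_mult distrib_right sum.distrib by simp
qed

lemma degree_linear_power_mult: "degree ([:a, b:] ^ p * [:c, d:] ^ q) \<le> p + q"
proof -
  have "degree ([:a, b:] ^ n) \<le> n" for a b :: 'a and n
    using degree_power_le[of "[:a, b:]" n] by (simp split: if_splits)
  then show ?thesis
    by (meson add_mono degree_mult_le order_trans)
qed

lemma form_value_power:
  "form_value (p + q) ([:a, b:] ^ p * [:c, d:] ^ q) u v = (a * u + b * v) ^ p * (c * u + d * v) ^ q"
proof (induction p)
  case 0
  show ?case
  proof (induction q)
    case (Suc q)
    then show ?case
      using form_value_linear_mult[of "[:c, d:] ^ q" q] degree_linear_power_mult[of c d 0 c d q]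
      by (simp del: mult_pCons_left)
  qed (simp add: form_value_def)
next
  case (Suc p)
  then show ?case
    using form_value_linear_mult[OF degree_linear_power_mult[of a b p c d q], of a b u v]
    by (simp del: mult_pCons_left add: mult.assoc)
qed

lemma sym_mat_monomials:
  assumes "j \<le> k"
  shows "(\<Sum>l<Suc k. sym_mat k g $$ (j, l) * (u ^ (k - l) * v ^ l)) =
    (g $$ (0, 0) * u + g $$ (0, 1) * v) ^ (k - j) * (g $$ (1, 0) * u + g $$ (1, 1) * v) ^ j"
  using form_value_power[of "k - j" j "g $$ (0, 0)" "g $$ (0, 1)" "g $$ (1, 0)" "g $$ (1, 1)" u v] assms
  by (simp add: form_value_def sym_mat_def lessThan_Suc_atMost)

text \<open>Agreement at infinitely many arguments, not at all of them, is assumed because one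
  identity to be compared below is known only away from a zero of c x + t.\<close>

lemma polynomial_function_unique_infinite:
  fixes c d :: "nat \<Rightarrow> 'a::field_char_0"
  assumes "infinite {x. (\<Sum>l<n. c l * x ^ l) = (\<Sum>l<n. d l * x ^ l)}" and "l < n"
  shows "c l = d l"
proof -
  let ?P = "(\<Sum>l<n. monom (c l) l) - (\<Sum>l<n. monom (d l) l)"
  have "{x. poly ?P x = 0} = {x. (\<Sum>l<n. c l * x ^ l) = (\<Sum>l<n. d l * x ^ l)}"
    by (auto simp: poly_sum poly_monom)
  then have "?P = 0" using assms(1) poly_roots_finite by metis
  then have "coeff (\<Sum>l<n. monom (c l) l) l = coeff (\<Sum>l<n. monom (d l) l) l" by simp
  then show ?thesis using assms(2) by (simp add: coeff_sum)
qed

lemma polynomial_function_unique: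
  fixes c d :: "nat \<Rightarrow> 'a::field_char_0"
  assumes "\<And>x. (\<Sum>l<n. c l * x ^ l) = (\<Sum>l<n. d l * x ^ l)" and "l < n"
  shows "c l = d l"
  by (rule polynomial_function_unique_infinite[OF _ assms(2)])
     (use assms(1) infinite_UNIV_char_0[where 'a = 'a] in simp)

text \<open>On columns of monomials both sides act as the substitution of \<open>g * h\<close>, and
  the columns with u = 1 already separate the coefficients of a row.\<close>

lemma sym_mat_mult:
  assumes "g \<in> carrier_mat 2 2" "h \<in> carrier_mat 2 2"
  shows "sym_mat k (g * h) = sym_mat k g * sym_mat k h"
proof (rule eq_matI)
  fix j l assume "j < dim_row (sym_mat k g * sym_mat k h)" "l < dim_col (sym_mat k g * sym_mat k h)"
  then have j: "j \<le> k" and l: "l < Suc k" by auto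
  show "sym_mat k (g * h) $$ (j, l) = (sym_mat k g * sym_mat k h) $$ (j, l)"
  proof (rule polynomial_function_unique[OF _ l])
    fix x
    let ?u = "h $$ (0, 0) + h $$ (0, 1) * x" and ?v = "h $$ (1, 0) + h $$ (1, 1) * x"
    have "(\<Sum>l<Suc k. sym_mat k (g * h) $$ (j, l) * x ^ l) =
        (g $$ (0, 0) * ?u + g $$ (0, 1) * ?v) ^ (k - j) * (g $$ (1, 0) * ?u + g $$ (1, 1) * ?v) ^ j"
    proof -
      have "(g * h) $$ (i, i') = g $$ (i, 0) * h $$ (0, i') + g $$ (i, 1) * h $$ (1, i')"
        if "i < 2" "i' < 2" for i i'
        using that by (simp add: mult_mat_index[OF assms] numeral_2_eq_2)
      then show ?thesis
        using sym_mat_monomials[OF j, of "g * h" 1 x] by (simp add: algebra_simps)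
    qed
    also have "\<dots> = (\<Sum>m<Suc k. sym_mat k g $$ (j, m) * (?u ^ (k - m) * ?v ^ m))"
      by (rule sym_mat_monomials[OF j, symmetric])
    also have "\<dots> = (\<Sum>m<Suc k. sym_mat k g $$ (j, m) * (\<Sum>l<Suc k. sym_mat k h $$ (m, l) * x ^ l))"
    proof (rule sum.cong)
      fix m assume "m \<in> {..<Suc k}"
      then show "sym_mat k g $$ (j, m) * (?u ^ (k - m) * ?v ^ m) =
          sym_mat k g $$ (j, m) * (\<Sum>l<Suc k. sym_mat k h $$ (m, l) * x ^ l)"
        using sym_mat_monomials[of m k h 1 x] by simp
    qed simp
    also have "\<dots> = (\<Sum>l<Suc k. (sym_mat k g * sym_mat k h) $$ (j, l) * x ^ l)"
      unfolding sum_distrib_left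
      by (subst sum.swap)
         (use j in \<open>simp add: mult_mat_index[of _ "Suc k" "Suc k" _ "Suc k"] sum_distrib_left sum_distrib_right mult_ac
            del: sum.lessThan_Suc index_mult_mat(1)\<close>)
    finally show "(\<Sum>l<Suc k. sym_mat k (g * h) $$ (j, l) * x ^ l) =
        (\<Sum>l<Suc k. (sym_mat k g * sym_mat k h) $$ (j, l) * x ^ l)" .
  qed
qed auto

lemma sym_mat_one: "sym_mat k (1\<^sub>m 2) = 1\<^sub>m (Suc k)"
proof -
  have "coeff ([:0, 1:] ^ j) l = (if j = l then 1 else (0::'a))" for j l
    by (simp flip: monom_altdef[of 1, simplified])
  then show ?thesis by (intro eq_matI) (auto simp: sym_mat_def simp flip: one_pCons)
qed

lemma map_mat_of_rat_sym_mat: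
  assumes "g \<in> carrier_mat 2 2"
  shows "map_mat of_rat (sym_mat k g) = sym_mat k (map_mat of_rat g)"
proof -
  have "of_rat (coeff ([:a, b:] ^ p * [:c, d:] ^ q) l) =
      coeff ([:of_rat a, of_rat b:] ^ p * [:of_rat c, of_rat d:] ^ q) l" for a b c d p q l
  proof (induction p arbitrary: l)
    case 0
    show ?case
    proof (induction q arbitrary: l)
      case (Suc q)
      then show ?case
        by (simp only: power_0 power_Suc mult_1 coeff_linear_mult of_rat_add of_rat_mult if_distrib[of of_rat] of_rat_0)
    qed (auto simp: coeff_1)
  next
    case (Suc p)
    then show ?case
      by (simp only: power_Suc mult.assoc coeff_linear_mult of_rat_add of_rat_mult if_distrib[of of_rat] of_rat_0)
  qed
  then show ?thesis using assms by (intro eq_matI) (auto simp: sym_mat_def)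
qed

text \<open>Sends the column of monomials of degree k + 1 at w to the tensor product of w with the
  column of degree k, because coordinate i0 of w times monomial i1 is monomial i0 + i1. It realises
  Sym^(k+1) inside the product of the standard representation with Sym^k.\<close>

definition sym_embed :: "nat \<Rightarrow> 'a::field mat" where
  "sym_embed k = mat (2 * Suc k) (Suc (Suc k)) (\<lambda>(i, j). if i div Suc k + i mod Suc k = j then 1 else 0)"

lemma sym_embed_carrier [simp]: "sym_embed k \<in> carrier_mat (2 * Suc k) (Suc (Suc k))"
  by (simp add: sym_embed_def)

lemma sym_embed_mult_index:
  assumes "M \<in> carrier_mat (Suc (Suc k)) c" "i0 < 2" "i1 < Suc k" "j < c"
  shows "(sym_embed k * M) $$ (i0 * Suc k + i1, j) = M $$ (i0 + i1, j)"
proof -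
  have i: "i0 * Suc k + i1 < 2 * Suc k" using assms by (intro pair_index_less) auto
  have "(i0 * Suc k + i1) div Suc k = i0" "(i0 * Suc k + i1) mod Suc k = i1"
    using assms by (simp_all del: mult_Suc_right)
  then show ?thesis
    using assms i
    by (subst mult_mat_index[OF sym_embed_carrier assms(1)])
       (auto simp: sym_embed_def if_distrib[of "\<lambda>x. x * _"] simp del: mult_Suc_right sum.lessThan_Suc cong: if_cong)
qed

text \<open>The embedding is injective since each index up to k + 1 is the sum of 0 or 1 and an
  index up to k.\<close>

lemma sym_embed_cancel:
  assumes "M \<in> carrier_mat (Suc (Suc k)) c" "M' \<in> carrier_mat (Suc (Suc k)) c"
    and "sym_embed k * M = sym_embed k * M'"
  shows "M = M'"
proof (rule eq_matI)
  fix i j assume "i < dim_row M'" "j < dim_col M'"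
  then have i: "i < Suc (Suc k)" and j: "j < c" using assms by auto
  obtain i0 i1 where "i0 < 2" "i1 < Suc k" "i = i0 + i1"
    using i that[of 0 i] that[of 1 k] by (cases "i < Suc k") auto
  then show "M $$ (i, j) = M' $$ (i, j)"
    using sym_embed_mult_index[OF assms(1) _ _ j] sym_embed_mult_index[OF assms(2) _ _ j] assms(3)
    by metis
qed (use assms in auto)

text \<open>Multiplying the row polynomial of index i1 by the linear form of index i0 produces the
  row polynomial of index i0 + i1 one degree higher.\<close>

lemma sym_embed_equivariant:
  fixes g :: "'a::field_char_0 mat"
  assumes "g \<in> carrier_mat 2 2"
  shows "sym_embed k * sym_mat (Suc k) g = kron_mat g (sym_mat k g) * sym_embed k"
proof (rule eq_matI)
  fix i l assume "i < dim_row (kron_mat g (sym_mat k g) * sym_embed k :: 'a mat)"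
    "l < dim_col (kron_mat g (sym_mat k g) * sym_embed k :: 'a mat)"
  then have i: "i < 2 * Suc k" and l: "l < Suc (Suc k)"
    using assms by (auto simp: kron_mat_def sym_embed_def)
  define i0 i1 where "i0 = i div Suc k" and "i1 = i mod Suc k"
  have i01: "i0 < 2" "i1 < Suc k" "i = i0 * Suc k + i1"
    using div_mod_less[OF i] by (auto simp: i0_def i1_def simp del: mult_Suc_right)
  let ?P = "[:g $$ (0, 0), g $$ (0, 1):]" and ?Q = "[:g $$ (1, 0), g $$ (1, 1):]"
  \<comment> \<open>The index l may be k + 1, one more than the columns of \<open>sym_mat k\<close>
    allow; the coefficient there vanishes for reasons of degree.\<close>
  have S: "(if l < Suc k then sym_mat k g $$ (i1, l) else 0) = coeff (?P ^ (k - i1) * ?Q ^ i1) l" for l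
    using i01 degree_linear_power_mult[of "g $$ (0, 0)" "g $$ (0, 1)" "k - i1" "g $$ (1, 0)" "g $$ (1, 1)" i1]
    by (auto simp: sym_mat_def intro!: coeff_eq_0)
  have "(kron_mat g (sym_mat k g) * sym_embed k) $$ (i, l) =
     (\<Sum>m<2 * Suc k. g $$ (i0, m div Suc k) * sym_mat k g $$ (i1, m mod Suc k) *
        (if m div Suc k + m mod Suc k = l then 1 else 0))"
    using i l assms
    by (subst mult_mat_index[of _ "2 * Suc k" "2 * Suc k" _ "Suc (Suc k)"])
       (auto simp: sym_embed_def kron_mat_index[OF assms sym_mat_carrier] i0_def i1_def
          simp del: mult_Suc_right intro!: sum.cong kron_mat_carrier)
  also have "\<dots> = (\<Sum>a<2. \<Sum>b<Suc k. g $$ (i0, a) * sym_mat k g $$ (i1, b) * (if a + b = l then 1 else 0))"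
    by (rule sum_div_mod)
  also have "\<dots> = g $$ (i0, 0) * (\<Sum>b<Suc k. if b = l then sym_mat k g $$ (i1, b) else 0) +
      g $$ (i0, 1) * (\<Sum>b<Suc k. if b = l - 1 \<and> l \<noteq> 0 then sym_mat k g $$ (i1, b) else 0)"
  proof -
    have two: "(\<Sum>a<2. F a) = F 0 + F 1" for F :: "nat \<Rightarrow> 'a" by (simp add: numeral_2_eq_2)
    show ?thesis
      unfolding sum_distrib_left two by (intro arg_cong2[of _ _ _ _ "(+)"] sum.cong) auto
  qed
  also have "\<dots> = g $$ (i0, 0) * coeff (?P ^ (k - i1) * ?Q ^ i1) l +
      (if l = 0 then 0 else g $$ (i0, 1) * coeff (?P ^ (k - i1) * ?Q ^ i1) (l - 1))"
    unfolding S[symmetric] by (simp del: sum.lessThan_Suc)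
  also have "\<dots> = coeff ([:g $$ (i0, 0), g $$ (i0, 1):] * (?P ^ (k - i1) * ?Q ^ i1)) l"
    by (rule coeff_linear_mult[symmetric])
  also have "\<dots> = sym_mat (Suc k) g $$ (i0 + i1, l)"
  proof -
    have "i0 = 0 \<or> i0 = 1" using i01 by auto
    then show ?thesis using i01 l 
      by (auto simp: sym_mat_def Suc_diff_le mult.assoc mult.left_commute simp del: mult_pCons_left mult_pCons_right)
  qed
  also have "\<dots> = (sym_embed k * sym_mat (Suc k) g) $$ (i, l)"
    unfolding i01(3) using i01 l by (subst sym_embed_mult_index[OF sym_mat_carrier]) auto
  finally show "(sym_embed k * sym_mat (Suc k) g) $$ (i, l) = (kron_mat g (sym_mat k g) * sym_embed k) $$ (i, l)" ..
qed (use assms in \<open>auto simp: kron_mat_def sym_embed_def\<close>)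

section \<open>Regular functions\<close>

lemma regular_SL2_sum:
  assumes "\<And>i. i \<in> I \<Longrightarrow> p i \<in> regular_SL2"
  shows "(\<lambda>A. \<Sum>i\<in>I. p i A) \<in> regular_SL2"
  using assms by (induction I rule: infinite_finite_induct)
    (auto intro: regular_SL2.const[of 0] regular_SL2.add)

lemma regular_SL2_cmult: "p \<in> regular_SL2 \<Longrightarrow> (\<lambda>A. c * p A) \<in> regular_SL2"
  by (intro regular_SL2.mult regular_SL2.const)

lemma regular_SL2_diff:
  assumes "p \<in> regular_SL2" "q \<in> regular_SL2" shows "(\<lambda>A. p A - q A) \<in> regular_SL2"
  using regular_SL2.add[OF assms(1) regular_SL2_cmult[OF assms(2), of "- 1"]] by simp

lemma regular_SL2_compose:
  assumes "p \<in> regular_SL2" "\<And>i j. i < 2 \<Longrightarrow> j < 2 \<Longrightarrow> (\<lambda>A. F A $$ (i, j)) \<in> regular_SL2"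
  shows "(\<lambda>A. p (F A)) \<in> regular_SL2"
  using assms(1) by induction (auto intro: regular_SL2.intros assms(2))

lemma regular_SL2_mat2:
  assumes "p \<in> regular_SL2" "a \<in> regular_SL2" "b \<in> regular_SL2" "c \<in> regular_SL2" "d \<in> regular_SL2"
  shows "(\<lambda>A. p (mat2 (a A) (b A) (c A) (d A))) \<in> regular_SL2"
proof (rule regular_SL2_compose[OF assms(1)])
  fix i j :: nat assume "i < 2" "j < 2"
  then have "i = 0 \<or> i = Suc 0" "j = 0 \<or> j = Suc 0" by auto
  then show "(\<lambda>A. mat2 (a A) (b A) (c A) (d A) $$ (i, j)) \<in> regular_SL2"
    using assms by auto
qed

lemma regular_SL2_sym_mat:
  assumes "i < Suc k" "j < Suc k"
  shows "(\<lambda>g. sym_mat k g $$ (i, j)) \<in> regular_SL2"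
proof -
  have "(\<lambda>g. coeff ([:g $$ (0, 0), g $$ (0, 1):] ^ p * [:g $$ (1, 0), g $$ (1, 1):] ^ q) l :: 'a) \<in> regular_SL2"
    for p q l
  proof (induction p arbitrary: l)
    case 0
    show ?case
    proof (induction q arbitrary: l)
      case (Suc q)
      then show ?case
        by (cases l) (auto simp: coeff_pCons mult.assoc simp del: mult_pCons_left
          simp add: coeff_linear_mult intro!: regular_SL2.intros)
    qed (auto intro: regular_SL2.const)
  next
    case (Suc p)
    then show ?case
      by (cases l) (auto simp: mult.assoc coeff_linear_mult simp del: mult_pCons_left
          intro!: regular_SL2.intros)
  qed
  then show ?thesis using assms by (simp add: sym_mat_def)
qed

text \<open>Regular functions are polynomials in the entries, so they restrict to polynomials along
  a curve with polynomial entries. This serves both the density of rational points and the two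
  charts for the orbit of a highest weight vector.\<close>

lemma regular_SL2_line:
  assumes "p \<in> regular_SL2"
    and "\<And>i j. i < 2 \<Longrightarrow> j < 2 \<Longrightarrow> \<exists>P. \<forall>x. F x $$ (i, j) = poly P x"
  shows "\<exists>P. \<forall>x. p (F x) = poly P (x :: 'k::field)"
  using assms(1)
proof induction
  case (const c)
  show ?case by (rule exI[of _ "[:c:]"]) simp
next
  case (entry i j)
  then show ?case using assms(2) by blast
next
  case (add p q)
  then show ?case by (metis poly_add)
next
  case (mult p q)
  then show ?case by (metis poly_mult)
qed

lemma poly_zero_of_rat:
  assumes "\<And>x. poly P (of_rat x) = (0 :: complex)"
  shows "poly P y = 0"
proof -
  have "infinite (range (of_rat :: rat \<Rightarrow> complex))"
    by (simp add: finite_image_iff inj_on_def infinite_UNIV_char_0)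
  moreover have "range of_rat \<subseteq> {x. poly P x = 0}" using assms by auto
  ultimately have "P = 0" using poly_roots_finite finite_subset by blast
  then show ?thesis by simp
qed

text \<open>The number and the order of the factors do not depend on g, so a single polynomial
  parametrisation covers the whole group.\<close>

lemma SL2_elementary_factorization:
  fixes g :: "'k::field mat"
  assumes "g \<in> carrier SL2"
  shows "\<exists>x1 x2 x3 x4. g = mat2 1 x1 0 1 * mat2 1 0 x2 1 * mat2 1 x3 0 1 * mat2 1 0 x4 1"
proof -
  obtain a b c d where g: "g = mat2 a b c d" and det: "a * d - b * c = 1"
    using assms by (rule SL2_cases)
  show ?thesis
  proof (cases "c = 0")
    case False
    \<comment> \<open>With c nonzero three factors suffice and the fourth is the identity.\<close>
    have "g = mat2 1 ((a - 1) / c) 0 1 * mat2 1 0 c 1 * mat2 1 ((d - 1) / c) 0 1 * mat2 1 0 0 1"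
      using False det by (simp add: g field_simps)
    then show ?thesis by blast
  next
    case True
    then have d0: "d \<noteq> 0" using det by auto
    then have d: "d \<noteq> 0" "a = 1 / d" using det True by (auto simp: eq_divide_eq)
    \<comment> \<open>Multiplying g on the right by the lower unipotent matrix with entry 1 brings d
      into the lower left corner and reduces to the other case; the inverse of that matrix is the
      last factor.\<close>
    have "g = mat2 1 ((a + b - 1) / d) 0 1 * mat2 1 0 d 1 * mat2 1 ((d - 1) / d) 0 1 * mat2 1 0 (-1) 1"
      using True d by (simp add: g field_simps)
    then show ?thesis by blast
  qed
qed

text \<open>Density of the rational points: \<open>SL\<^sub>2\<close> is covered by the same products of four elementary
  matrices over \<open>\<rat>\<close> and over \<open>\<complex>\<close>, and the four parameters are specialised one at a time.\<close>

lemma regular_SL2_zero_of_rat: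
  fixes p :: "complex mat \<Rightarrow> complex"
  assumes p: "p \<in> regular_SL2" and zero: "\<And>h. h \<in> carrier SL2 \<Longrightarrow> p (map_mat of_rat h) = 0"
    and g: "g \<in> carrier SL2"
  shows "p g = 0"
proof -
  define E :: "complex \<Rightarrow> complex \<Rightarrow> complex \<Rightarrow> complex \<Rightarrow> complex mat" where
    "E = (\<lambda>x1 x2 x3 x4. mat2 1 x1 0 1 * mat2 1 0 x2 1 * mat2 1 x3 0 1 * mat2 1 0 x4 1)"
  have linear: "\<exists>P. \<forall>x. a + b * x = poly P x" for a b :: complex
    by (rule exI[of _ "[:a, b:]"]) simp
  have affine: "\<exists>P. \<forall>x. p (mat2 (a0 + a1 * x) (b0 + b1 * x) (c0 + c1 * x) (d0 + d1 * x)) = poly P x"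
    for a0 a1 b0 b1 c0 c1 d0 d1
  proof (rule regular_SL2_line[OF p])
    fix i j :: nat assume "i < 2" "j < 2"
    then have "i = 0 \<or> i = Suc 0" "j = 0 \<or> j = Suc 0" by auto
    then show "\<exists>P. \<forall>x. mat2 (a0 + a1 * x) (b0 + b1 * x) (c0 + c1 * x) (d0 + d1 * x) $$ (i, j) = poly P x"
      using linear by (elim disjE) simp_all
  qed
  have step: "p (mat2 (a0 + a1 * y) (b0 + b1 * y) (c0 + c1 * y) (d0 + d1 * y)) = 0"
    if "\<And>x. p (mat2 (a0 + a1 * of_rat x) (b0 + b1 * of_rat x) (c0 + c1 * of_rat x) (d0 + d1 * of_rat x)) = 0"
    for a0 a1 b0 b1 c0 c1 d0 d1 y
    using affine[of a0 a1 b0 b1 c0 c1 d0 d1] that poly_zero_of_rat by metis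
  have E: "E x1 x2 x3 x4 = mat2 ((1 + x1 * x2) + (x3 + x1 * x2 * x3 + x1) * x4) (x3 + x1 * x2 * x3 + x1)
      (x2 + (x2 * x3 + 1) * x4) (x2 * x3 + 1)" for x1 x2 x3 x4
    by (simp add: E_def algebra_simps)
  have "p (E (of_rat x1) (of_rat x2) (of_rat x3) (of_rat x4)) = 0" for x1 x2 x3 x4
  proof -
    have "E (of_rat x1) (of_rat x2) (of_rat x3) (of_rat x4) =
        map_mat of_rat (mat2 1 x1 0 1 * mat2 1 0 x2 1 * mat2 1 x3 0 1 * mat2 1 0 x4 1)"
      by (simp add: E of_rat_add of_rat_mult algebra_simps)
    moreover have "mat2 1 x1 0 1 * mat2 1 0 x2 1 * mat2 1 x3 0 1 * mat2 1 0 x4 1 \<in> carrier SL2"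
      by (simp add: algebra_simps)
    ultimately show ?thesis using zero by metis
  qed
  \<comment> \<open>Each entry of \<open>E\<close> is affine in each parameter separately. The
    arguments of \<open>step\<close> are the constant and linear coefficients of the four entries
    with respect to the parameter that is being freed from the rationals.\<close>
  then have "p (E y1 (of_rat x2) (of_rat x3) (of_rat x4)) = 0" for y1 x2 x3 x4
    using step[of "1 + of_rat x3 * of_rat x4" "of_rat x2 + of_rat x2 * of_rat x3 * of_rat x4 + of_rat x4"
        "of_rat x3" "1 + of_rat x2 * of_rat x3" "of_rat x2 + (of_rat x2 * of_rat x3 + 1) * of_rat x4" 0
        "of_rat x2 * of_rat x3 + 1" 0 y1]
    by (simp add: E algebra_simps)
  then have "p (E y1 y2 (of_rat x3) (of_rat x4)) = 0" for y1 y2 x3 x4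
    using step[of "1 + (of_rat x3 + y1) * of_rat x4" "y1 + y1 * of_rat x3 * of_rat x4"
        "of_rat x3 + y1" "y1 * of_rat x3" "of_rat x4" "1 + of_rat x3 * of_rat x4" 1 "of_rat x3" y2]
    by (simp add: E algebra_simps)
  then have "p (E y1 y2 y3 (of_rat x4)) = 0" for y1 y2 y3 x4
    using step[of "1 + y1 * y2 + y1 * of_rat x4" "of_rat x4 + y1 * y2 * of_rat x4"
        "y1" "1 + y1 * y2" "y2 + of_rat x4" "y2 * of_rat x4" 1 "y2" y3]
    by (simp add: E algebra_simps)
  then have "p (E y1 y2 y3 y4) = 0" for y1 y2 y3 y4
    using step[of "1 + y1 * y2" "y3 + y1 * y2 * y3 + y1"
        "y3 + y1 * y2 * y3 + y1" 0 "y2" "y2 * y3 + 1" "y2 * y3 + 1" 0 y4]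
    by (simp add: E algebra_simps)
  then show ?thesis using SL2_elementary_factorization[OF g] unfolding E_def by metis
qed

section \<open>Rational structure\<close>

text \<open>Coordinates in a basis of the complex numbers over the rationals, with
  \<open>r b x\<close> equal to 0 if b is not a basis element. As \<open>r b\<close> is rationally
  linear, it commutes with rational matrices, so a coordinate of a cocycle is again a
  cocycle.\<close>

lemma complex_rat_coordinates:
  obtains r :: "complex \<Rightarrow> complex \<Rightarrow> rat" where
    "\<And>b x y. r b (x + y) = r b x + r b y" "\<And>b s x. r b (of_rat s * x) = s * r b x"
    "\<And>x. finite {b. r b x \<noteq> 0}" "\<And>x. (\<Sum>b | r b x \<noteq> 0. b * of_rat (r b x)) = x"
proof -
  interpret vector_space "\<lambda>(s :: rat) (x :: complex). of_rat s * x"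
    by unfold_locales (auto simp: algebra_simps of_rat_add of_rat_mult)
  define B where "B = extend_basis {}"
  have ind: "independent B" and span: "span B = UNIV"
    by (simp_all add: B_def independent_extend_basis independent_empty)
  show ?thesis
  proof (rule that[of "\<lambda>b x. representation B x b"])
    fix x
    show "(\<Sum>b | representation B x b \<noteq> 0. b * of_rat (representation B x b)) = x"
      using sum_nonzero_representation_eq[OF ind, of x] span by (simp add: mult.commute)
  qed (use ind span in \<open>simp_all add: representation_add representation_scale finite_representation\<close>)
qed

text \<open>The rational form of the coordinate ring, kept as functions of complex matrices:
  evaluated at the standard matrix of a tensor automorphism, such a function stays in
  \<open>tannaka_ring\<close>, whose constants are rational.\<close>

inductive_set rat_regular_SL2 :: "(complex mat \<Rightarrow> complex) set" where
  rat_const: "(\<lambda>_. of_rat c) \<in> rat_regular_SL2"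
| rat_entry: "i < 2 \<Longrightarrow> j < 2 \<Longrightarrow> (\<lambda>A. A $$ (i, j)) \<in> rat_regular_SL2"
| rat_add: "p \<in> rat_regular_SL2 \<Longrightarrow> q \<in> rat_regular_SL2 \<Longrightarrow> (\<lambda>A. p A + q A) \<in> rat_regular_SL2"
| rat_mult: "p \<in> rat_regular_SL2 \<Longrightarrow> q \<in> rat_regular_SL2 \<Longrightarrow> (\<lambda>A. p A * q A) \<in> rat_regular_SL2"

lemma rat_regular_SL2_regular: "p \<in> rat_regular_SL2 \<Longrightarrow> p \<in> regular_SL2"
  by (induction rule: rat_regular_SL2.induct) (auto intro: regular_SL2.intros)

lemma rat_regular_SL2_sum:
  assumes "\<And>i. i \<in> I \<Longrightarrow> p i \<in> rat_regular_SL2"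
  shows "(\<lambda>A. \<Sum>i\<in>I. p i A) \<in> rat_regular_SL2"
  using assms by (induction I rule: infinite_finite_induct)
    (use rat_const[of 0] in \<open>auto intro: rat_add\<close>)

lemma rat_regular_SL2_value:
  assumes "p \<in> rat_regular_SL2"
  shows "\<exists>f. \<forall>h\<in>carrier_mat 2 2. p (map_mat of_rat h) = of_rat (f h)"
  using assms
proof (induction rule: rat_regular_SL2.induct)
  case (rat_const c)
  show ?case by (rule exI[of _ "\<lambda>_. c"]) simp
next
  case (rat_entry i j)
  then show ?case by (intro exI[of _ "\<lambda>h. h $$ (i, j)"]) auto
next
  case (rat_add p q)
  then obtain f f' where "\<forall>h\<in>carrier_mat 2 2. p (map_mat of_rat h) = of_rat (f h)"
    "\<forall>h\<in>carrier_mat 2 2. q (map_mat of_rat h) = of_rat (f' h)" by blast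
  then show ?case by (intro exI[of _ "\<lambda>h. f h + f' h"]) (auto simp: of_rat_add)
next
  case (rat_mult p q)
  then obtain f f' where "\<forall>h\<in>carrier_mat 2 2. p (map_mat of_rat h) = of_rat (f h)"
    "\<forall>h\<in>carrier_mat 2 2. q (map_mat of_rat h) = of_rat (f' h)" by blast
  then show ?case by (intro exI[of _ "\<lambda>h. f h * f' h"]) (auto simp: of_rat_mult)
qed

lemma regular_SL2_rat_decomposition:
  assumes "p \<in> regular_SL2"
  shows "\<exists>(n::nat) c q. (\<forall>i<n. q i \<in> rat_regular_SL2) \<and> p = (\<lambda>A. \<Sum>i<n. c i * q i A)"
  using assms
proof induction
  case (const c)
  show ?case
    by (intro exI[of _ 1] exI[of _ "\<lambda>_. c"] exI[of _ "\<lambda>_ _. 1"])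
       (use rat_const[of 1] in auto)
next
  case (entry i j)
  then show ?case
    by (intro exI[of _ 1] exI[of _ "\<lambda>_. 1"] exI[of _ "\<lambda>_ A. A $$ (i, j)"]) (auto intro: rat_entry)
next
  case (add p p')
  from add.IH obtain n n' :: nat and c q c' q' where *: "\<forall>i<n. q i \<in> rat_regular_SL2" "p = (\<lambda>A. \<Sum>i<n. c i * q i A)"
    "\<forall>i<n'. q' i \<in> rat_regular_SL2" "p' = (\<lambda>A. \<Sum>i<n'. c' i * q' i A)" by (elim exE conjE)
  have split: "(\<Sum>i<n + n'. f i) = (\<Sum>i<n. f i) + (\<Sum>i<n'. f (n + i))" for f :: "nat \<Rightarrow> complex"
    by (induction n') (auto simp: add.assoc)
  show ?case
    by (intro exI[of _ "n + n'"] exI[of _ "\<lambda>i. if i < n then c i else c' (i - n)"]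
          exI[of _ "\<lambda>i. if i < n then q i else q' (i - n)"])
       (use * in \<open>auto simp: split\<close>)
next
  case (mult p p')
  from mult.IH obtain n n' :: nat and c q c' q' where *: "\<forall>i<n. q i \<in> rat_regular_SL2" "p = (\<lambda>A. \<Sum>i<n. c i * q i A)"
    "\<forall>i<n'. q' i \<in> rat_regular_SL2" "p' = (\<lambda>A. \<Sum>i<n'. c' i * q' i A)" by (elim exE conjE)
  have "p A * p' A = (\<Sum>i<n * n'. (c (i div n') * c' (i mod n')) * (q (i div n') A * q' (i mod n') A))" for A
    unfolding sum_div_mod[where f = "\<lambda>i j. (c i * c' j) * (q i A * q' j A)"]
    unfolding *(2,4) sum_product by (intro sum.cong) (auto simp: mult_ac)
  then show ?case
    by (intro exI[of _ "n * n'"] exI[of _ "\<lambda>i. c (i div n') * c' (i mod n')"]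
          exI[of _ "\<lambda>i A. q (i div n') A * q' (i mod n') A"])
       (use *(1,3) in \<open>auto intro!: rat_mult dest: div_mod_less\<close>)
qed

section \<open>Generators of the modular group\<close>

text \<open>Euclid's algorithm on the first column: division of a by c with remainder, followed by
  the inversion, leaves a matrix with lower left entry a mod c. The case for inverses supplies the
  negative powers of the translation.\<close>

lemma SL2_Z_induct [consumes 1, case_names T S mult inv]:
  assumes "\<gamma> \<in> carrier SL2_Z"
    and T: "Q (mat2 1 1 0 1)" and S: "Q (mat2 0 (-1) 1 0)"
    and mult: "\<And>\<alpha> \<beta>. \<alpha> \<in> carrier SL2_Z \<Longrightarrow> \<beta> \<in> carrier SL2_Z \<Longrightarrow> Q \<alpha> \<Longrightarrow> Q \<beta> \<Longrightarrow> Q (\<alpha> * \<beta>)"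
    and inv: "\<And>\<alpha>. \<alpha> \<in> carrier SL2_Z \<Longrightarrow> Q \<alpha> \<Longrightarrow> Q (inv\<^bsub>SL2\<^esub> \<alpha>)"
  shows "Q \<gamma>"
proof -
  have S_inv: "Q (mat2 0 1 (-1) 0)"
    using inv[of "mat2 0 (-1) 1 0"] S SL2_inv[of "0::int" 0 "-1" 1] by simp
  have one: "Q (mat2 1 0 0 1)"
    using mult[of "mat2 0 (-1) 1 0" "mat2 0 1 (-1) 0"] S S_inv by simp
  have minus: "Q (mat2 (-1) 0 0 (-1))"
    using mult[of "mat2 0 (-1) 1 0" "mat2 0 (-1) 1 0"] S by simp
  have T_pow: "Q (mat2 1 (int n) 0 1)" for n
  proof (induction n)
    case (Suc n)
    then show ?case using mult[of "mat2 1 (int n) 0 1" "mat2 1 1 0 1"] T by (simp add: add.commute)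
  qed (use one in simp)
  have U: "Q (mat2 1 x 0 1)" for x
  proof (cases "x \<ge> 0")
    case True
    then show ?thesis using T_pow[of "nat x"] by simp
  next
    case False
    then show ?thesis
      using T_pow[of "nat (- x)"] inv[of "mat2 1 (- x) 0 1"] SL2_inv[of "1::int" 1 "- x" 0] by simp
  qed
  have "Q (mat2 a b c d)" if "a * d - b * c = 1" for a b c d :: int
    using that
  proof (induction "nat \<bar>c\<bar>" arbitrary: a b c d rule: less_induct)
    case less
    show ?case
    proof (cases "c = 0")
      case True
      then have ad: "a * d = 1" using less.prems by simp
      then have "a = 1 \<and> d = 1 \<or> a = -1 \<and> d = -1" by (rule zmult_eq_1_iff[THEN iffD1])
      then show ?thesis
      proof
        assume "a = 1 \<and> d = 1" then show ?thesis using U True by simp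
      next
        assume "a = -1 \<and> d = -1"
        then show ?thesis
          using mult[of "mat2 (-1) 0 0 (-1)" "mat2 1 (-b) 0 1"] minus U[of "-b"] True by simp
      qed
    next
      case False
      define q where "q = a div c"
      have "nat \<bar>a mod c\<bar> < nat \<bar>c\<bar>" using False by (simp add: abs_mod_less)
      moreover have "(- c) * (b - q * d) - (- d) * (a mod c) = 1"
        using less.prems unfolding q_def minus_div_mult_eq_mod[symmetric] by (simp add: algebra_simps)
      \<comment> \<open>This matrix arises from the given one by translating by -q and then applying
        \<open>mat2 0 (-1) 1 0\<close>.\<close>
      ultimately have IH: "Q (mat2 (- c) (- d) (a mod c) (b - q * d))" by (rule less.hyps)
      have det: "mat2 (- c) (- d) (a mod c) (b - q * d) \<in> carrier SL2"
        using \<open>(- c) * (b - q * d) - (- d) * (a mod c) = 1\<close> by simp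
      have "Q (mat2 0 1 (-1) 0 * mat2 (- c) (- d) (a mod c) (b - q * d))"
        by (rule mult[OF _ det S_inv IH]) simp
      then have "Q (mat2 1 q 0 1 * (mat2 0 1 (-1) 0 * mat2 (- c) (- d) (a mod c) (b - q * d)))"
        using det less.prems unfolding q_def minus_div_mult_eq_mod[symmetric]
        by (intro mult[OF _ _ U]) (simp_all add: algebra_simps)
      then show ?thesis
        unfolding q_def minus_div_mult_eq_mod[symmetric] by (simp add: algebra_simps)
    qed
  qed
  then show ?thesis using assms(1) SL2_cases by metis
qed

section \<open>Algebraic representations and their extensions\<close>

lemma hom_GL_I:
  assumes "group G" "\<And>x. x \<in> carrier G \<Longrightarrow> F x \<in> carrier_mat d d"
    "\<And>x y. x \<in> carrier G \<Longrightarrow> y \<in> carrier G \<Longrightarrow> F (x \<otimes>\<^bsub>G\<^esub> y) = F x * F y"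
    "F \<one>\<^bsub>G\<^esub> = 1\<^sub>m d"
  shows "F \<in> hom G (GL d)"
proof (rule homI)
  interpret group G by fact
  fix x assume x: "x \<in> carrier G"
  have "F x * F (inv\<^bsub>G\<^esub> x) = 1\<^sub>m d" "F (inv\<^bsub>G\<^esub> x) * F x = 1\<^sub>m d"
    using assms(3)[of x "inv\<^bsub>G\<^esub> x"] assms(3)[of "inv\<^bsub>G\<^esub> x" x] assms(4) x by auto
  then show "F x \<in> carrier (GL d)"
    using assms(2) x by (intro GL_carrierI[of _ _ "F (inv\<^bsub>G\<^esub> x)"]) auto
qed (use assms in auto)

lemma SL2_prod_group: "group (SL2 \<times>\<times> SL2_mod N)"
  by (simp add: DirProd_group)

text \<open>Representations of the algebraic group at finite level N. The field is left open: over
  the rationals they give objects of the category, over the complex numbers the matrices by which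
  tensor automorphisms act on these objects.\<close>

definition alg_rep :: "nat \<Rightarrow> nat \<Rightarrow> ('k::field mat \<times> int mat \<Rightarrow> 'k mat) \<Rightarrow> bool" where
  "alg_rep N d F \<longleftrightarrow> F \<in> hom (SL2 \<times>\<times> SL2_mod N) (GL d) \<and>
     (\<forall>i<d. \<forall>j<d. (\<lambda>x. F x $$ (i, j)) \<in> regular_SL2_prod N)"

lemma alg_rep_carrier:
  "alg_rep N d F \<Longrightarrow> g \<in> carrier SL2 \<Longrightarrow> l \<in> carrier (SL2_mod N) \<Longrightarrow> F (g, l) \<in> carrier_mat d d"
  unfolding alg_rep_def hom_def by auto

lemma alg_rep_mult:
  "alg_rep N d F \<Longrightarrow> g \<in> carrier SL2 \<Longrightarrow> l \<in> carrier (SL2_mod N) \<Longrightarrow> g' \<in> carrier SL2 \<Longrightarrow>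
   l' \<in> carrier (SL2_mod N) \<Longrightarrow> F (g * g', reduce N (l * l')) = F (g, l) * F (g', l')"
  unfolding alg_rep_def hom_def by auto

lemma hom_GL_one:
  assumes "F \<in> hom G (GL d)" "group G" shows "F \<one>\<^bsub>G\<^esub> = 1\<^sub>m d"
  using hom_one[OF assms(1,2) group_GL] by simp

lemma alg_repI:
  assumes "\<And>g l. g \<in> carrier SL2 \<Longrightarrow> l \<in> carrier (SL2_mod N) \<Longrightarrow> F (g, l) \<in> carrier_mat d d"
    "\<And>g l g' l'. g \<in> carrier SL2 \<Longrightarrow> l \<in> carrier (SL2_mod N) \<Longrightarrow> g' \<in> carrier SL2 \<Longrightarrow>
      l' \<in> carrier (SL2_mod N) \<Longrightarrow> F (g * g', reduce N (l * l')) = F (g, l) * F (g', l')"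
    "F (1\<^sub>m 2, reduce N (1\<^sub>m 2)) = 1\<^sub>m d"
    "\<And>i j l. i < d \<Longrightarrow> j < d \<Longrightarrow> l \<in> carrier (SL2_mod N) \<Longrightarrow> (\<lambda>g. F (g, l) $$ (i, j)) \<in> regular_SL2"
  shows "alg_rep N d F"
  unfolding alg_rep_def
proof
  show "F \<in> hom (SL2 \<times>\<times> SL2_mod N) (GL d)"
  proof (rule hom_GL_I[OF SL2_prod_group])
    fix x y :: "'a mat \<times> int mat"
    assume "x \<in> carrier (SL2 \<times>\<times> SL2_mod N)" "y \<in> carrier (SL2 \<times>\<times> SL2_mod N)"
    then show "F (x \<otimes>\<^bsub>SL2 \<times>\<times> SL2_mod N\<^esub> y) = F x * F y"
      using assms(2)[of "fst x" "snd x" "fst y" "snd y"] by (cases x; cases y) simp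
  qed (use assms(1,3) in auto)
  show "\<forall>i<d. \<forall>j<d. (\<lambda>x. F x $$ (i, j)) \<in> regular_SL2_prod N"
    unfolding regular_SL2_prod_def
  proof (intro allI impI CollectI ballI)
    fix i j l assume "i < d" "j < d" "l \<in> carrier (SL2_mod N)"
    then show "\<exists>p\<in>regular_SL2. \<forall>h\<in>carrier SL2. F (h, l) $$ (i, j) = p h"
      using assms(4)[of i j l] by (intro bexI[of _ "\<lambda>h. F (h, l) $$ (i, j)"]) simp_all
  qed
qed

lemma alg_rep_trivial: "alg_rep N 1 (\<lambda>_. 1\<^sub>m 1)"
  by (rule alg_repI) (auto intro: regular_SL2.const)

lemma alg_rep_std: "alg_rep N 2 fst"
  by (rule alg_repI) (auto simp: SL2_carrier intro: regular_SL2.entry)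

lemma alg_rep_sym: "alg_rep N (Suc k) (\<lambda>(g, l). sym_mat k (g :: 'k::field_char_0 mat))"
  by (rule alg_repI) (auto simp: SL2_carrier sym_mat_mult sym_mat_one intro: regular_SL2_sym_mat)

lemma alg_rep_kron:
  assumes "alg_rep N d F" "alg_rep N d' F'"
  shows "alg_rep N (d * d') (\<lambda>x. kron_mat (F x) (F' x))"
  unfolding alg_rep_def
proof (intro conjI allI impI)
  note carr = alg_rep_carrier[OF assms(1)] alg_rep_carrier[OF assms(2)]
  have hom: "F \<in> hom (SL2 \<times>\<times> SL2_mod N) (GL d)" "F' \<in> hom (SL2 \<times>\<times> SL2_mod N) (GL d')"
    using assms by (simp_all add: alg_rep_def)
  show "(\<lambda>x. kron_mat (F x) (F' x)) \<in> hom (SL2 \<times>\<times> SL2_mod N) (GL (d * d'))"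
  proof (rule hom_GL_I[OF SL2_prod_group])
    fix x y assume "x \<in> carrier (SL2 \<times>\<times> SL2_mod N :: ('a mat \<times> int mat) monoid)"
      "y \<in> carrier (SL2 \<times>\<times> SL2_mod N :: ('a mat \<times> int mat) monoid)"
    then show "kron_mat (F (x \<otimes>\<^bsub>SL2 \<times>\<times> SL2_mod N\<^esub> y)) (F' (x \<otimes>\<^bsub>SL2 \<times>\<times> SL2_mod N\<^esub> y)) =
        kron_mat (F x) (F' x) * kron_mat (F y) (F' y)"
      using carr hom_mult[OF hom(1), of x y] hom_mult[OF hom(2), of x y]
      by (cases x; cases y) (auto intro!: kron_mat_mult[of _ d d _ d _ d' d' _ d'])
  next
    show "kron_mat (F \<one>\<^bsub>SL2 \<times>\<times> SL2_mod N\<^esub>) (F' \<one>\<^bsub>SL2 \<times>\<times> SL2_mod N\<^esub>) = 1\<^sub>m (d * d')"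
      using hom_GL_one[OF hom(1) SL2_prod_group] hom_GL_one[OF hom(2) SL2_prod_group]
      by (simp add: kron_mat_one)
  qed (use carr in auto)
  fix i j assume ij: "i < d * d'" "j < d * d'"
  show "(\<lambda>x. kron_mat (F x) (F' x) $$ (i, j)) \<in> regular_SL2_prod N"
    unfolding regular_SL2_prod_def
  proof (intro CollectI ballI)
    fix l assume l: "l \<in> carrier (SL2_mod N)"
    from ij have ij': "i div d' < d" "j div d' < d" "i mod d' < d'" "j mod d' < d'"
      by (simp_all add: div_mod_less)
    obtain p p' where p: "p \<in> regular_SL2" "\<forall>h\<in>carrier SL2. F (h, l) $$ (i div d', j div d') = p h"
      "p' \<in> regular_SL2" "\<forall>h\<in>carrier SL2. F' (h, l) $$ (i mod d', j mod d') = p' h"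
      using assms ij' l unfolding alg_rep_def regular_SL2_prod_def by blast
    then show "\<exists>p\<in>regular_SL2. \<forall>h\<in>carrier SL2. kron_mat (F (h, l)) (F' (h, l)) $$ (i, j) = p h"
      using ij carr l
      by (intro bexI[of _ "\<lambda>h. p h * p' h"])
         (auto simp: kron_mat_index[of _ d d _ d' d'] intro: regular_SL2.mult)
  qed
qed

definition restrict_rep :: "nat \<Rightarrow> ('k::field mat \<times> int mat \<Rightarrow> 'k mat) \<Rightarrow> int mat \<Rightarrow> 'k mat" where
  "restrict_rep N F \<gamma> = F (map_mat of_int \<gamma>, reduce N \<gamma>)"

lemma restrict_rep_hom:
  assumes "alg_rep N d F" shows "restrict_rep N F \<in> hom SL2_Z (GL d)"
proof (rule hom_GL_I[OF SL2_group])
  fix x y assume "x \<in> carrier SL2_Z" "y \<in> carrier SL2_Z"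
  then show "restrict_rep N F (x \<otimes>\<^bsub>SL2\<^esub> y) = restrict_rep N F x * restrict_rep N F y"
    by (simp add: restrict_rep_def reduce_SL2_mult alg_rep_mult[OF assms])
next
  have "map_mat of_int (1\<^sub>m 2) = (1\<^sub>m 2 :: 'a mat)" by (simp add: mat2_one)
  then show "restrict_rep N F \<one>\<^bsub>SL2\<^esub> = 1\<^sub>m d"
    using hom_GL_one[of F _ d, OF _ SL2_prod_group] assms
    by (auto simp: restrict_rep_def alg_rep_def)
qed (auto simp: restrict_rep_def intro: alg_rep_carrier[OF assms])

text \<open>Inflation along the projection of the profinite group to its component at N.\<close>

lemma rational_rep_alg_rep:
  assumes "alg_rep N d F" "N \<ge> 1"
  shows "rational_rep d (\<lambda>(g, k). F (g, k N))"
  unfolding rational_rep_def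
proof
  show "(\<lambda>(g, k). F (g, k N)) \<in> hom (SL2 \<times>\<times> SL2_Zhat) (GL d)"
  proof (rule homI)
    fix x :: "rat mat \<times> (nat \<Rightarrow> int mat)" assume "x \<in> carrier (SL2 \<times>\<times> SL2_Zhat)"
    then show "(case x of (g, k) \<Rightarrow> F (g, k N)) \<in> carrier (GL d)"
      using assms SL2_Zhat_component[OF _ assms(2)] unfolding alg_rep_def hom_def by auto
  next
    fix x y :: "rat mat \<times> (nat \<Rightarrow> int mat)"
    assume "x \<in> carrier (SL2 \<times>\<times> SL2_Zhat)" "y \<in> carrier (SL2 \<times>\<times> SL2_Zhat)"
    then show "(case x \<otimes>\<^bsub>SL2 \<times>\<times> SL2_Zhat\<^esub> y of (g, k) \<Rightarrow> F (g, k N)) =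
        (case x of (g, k) \<Rightarrow> F (g, k N)) \<otimes>\<^bsub>GL d\<^esub> (case y of (g, k) \<Rightarrow> F (g, k N))"
      using assms(2) by (auto simp: SL2_Zhat_mult alg_rep_mult[OF assms(1)] SL2_Zhat_component)
  qed
  show "\<exists>M\<ge>1. \<forall>i<d. \<forall>j<d. \<exists>G\<in>regular_SL2_prod M.
      \<forall>g\<in>carrier SL2. \<forall>k\<in>carrier SL2_Zhat. (case (g, k) of (g, k) \<Rightarrow> F (g, k N)) $$ (i, j) = G (g, k M)"
  proof (intro exI[of _ N] conjI allI impI)
    fix i j assume "i < d" "j < d"
    then have "(\<lambda>x. F x $$ (i, j)) \<in> regular_SL2_prod N" using assms by (simp add: alg_rep_def)
    then show "\<exists>G\<in>regular_SL2_prod N. \<forall>g\<in>carrier SL2. \<forall>k\<in>carrier SL2_Zhat.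
        (case (g, k) of (g, k) \<Rightarrow> F (g, k N)) $$ (i, j) = G (g, k N)"
      by (rule rev_bexI) simp
  qed fact
qed

lemma diagonal_component: "N \<ge> 1 \<Longrightarrow> (case diagonal \<gamma> of (g, k) \<Rightarrow> F (g, k N)) = restrict_rep N F \<gamma>"
  by (simp add: diagonal_def restrict_rep_def)

section \<open>Filtered representations and extensions by cocycles\<close>

lemma subspacesI:
  assumes "W \<subseteq> carrier_vec n" "0\<^sub>v n \<in> W" "\<And>v w. v \<in> W \<Longrightarrow> w \<in> W \<Longrightarrow> v + w \<in> W"
    "\<And>c v. v \<in> W \<Longrightarrow> c \<cdot>\<^sub>v v \<in> W"
  shows "W \<in> subspaces n"
  unfolding subspaces_def
  using assms by (auto simp: subspace_def submodule_def module_vec_simps vec_vs vec_module)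

lemma invariant_zero:
  fixes \<rho> :: "'g \<Rightarrow> 'k::field mat"
  assumes "\<rho> \<in> hom G (GL n)" shows "invariant_subspace G n \<rho> {0\<^sub>v n}"
proof -
  have "\<rho> g *\<^sub>v 0\<^sub>v n = 0\<^sub>v n" if "g \<in> carrier G" for g
  proof -
    have "\<rho> g \<in> carrier_mat n n" using hom_in_carrier[OF assms that] by auto
    then show ?thesis by (intro eq_vecI) auto
  qed
  then show ?thesis
    unfolding invariant_subspace_def by (auto intro!: subspacesI)
qed

lemma invariant_carrier:
  fixes \<rho> :: "'g \<Rightarrow> 'k::field mat"
  assumes "\<rho> \<in> hom G (GL n)" shows "invariant_subspace G n \<rho> (carrier_vec n)"
  unfolding invariant_subspace_def
proof (intro conjI subspacesI ballI)
  fix g and v :: "'k vec" assume "g \<in> carrier G" "v \<in> carrier_vec n"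
  then show "\<rho> g *\<^sub>v v \<in> carrier_vec n"
    using hom_in_carrier[OF assms] by (intro mult_mat_vec_carrier) auto
qed auto

definition graded_piece ::
    "nat \<Rightarrow> (int mat \<Rightarrow> rat mat) \<Rightarrow> rat vec set \<Rightarrow> rat vec set \<Rightarrow> bool" where
  "graded_piece n \<rho> V V' \<longleftrightarrow> V \<subseteq> V' \<and>
     (\<exists>d R P. rational_rep d R \<and> P \<in> carrier_mat d n \<and>
        (\<lambda>v. P *\<^sub>v v) ` V' = carrier_vec d \<and> {v \<in> V'. P *\<^sub>v v = 0\<^sub>v d} = V \<and>
        (\<forall>\<gamma>\<in>carrier SL2_Z. \<forall>v\<in>V'. P *\<^sub>v (\<rho> \<gamma> *\<^sub>v v) = R (diagonal \<gamma>) *\<^sub>v (P *\<^sub>v v)))"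

lemma rel_unipotentI:
  assumes "\<rho> \<in> hom SL2_Z (GL n)" "W 0 = {0\<^sub>v n}" "W r = carrier_vec n"
    "\<And>j. j \<le> r \<Longrightarrow> invariant_subspace SL2_Z n \<rho> (W j)"
    "\<And>j. j < r \<Longrightarrow> graded_piece n \<rho> (W j) (W (Suc j))"
  shows "(n, \<rho>) \<in> rel_unipotent_reps"
  unfolding rel_unipotent_reps_def
  by (intro CollectI case_prodI conjI exI[of _ W] exI[of _ r])
     (use assms in \<open>auto simp: graded_piece_def\<close>)

lemma alg_rep_rel_unipotent:
  assumes "alg_rep N d F" "N \<ge> 1"
  shows "(d, restrict_rep N F) \<in> rel_unipotent_reps"
proof -
  note hom = restrict_rep_hom[OF assms(1)]
  have carr: "restrict_rep N F \<gamma> *\<^sub>v v \<in> carrier_vec d"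
    if "\<gamma> \<in> carrier SL2_Z" "v \<in> carrier_vec d" for \<gamma> v
    using hom_in_carrier[OF hom that(1)] that(2) by (intro mult_mat_vec_carrier) auto
  have "(\<lambda>v. 1\<^sub>m d *\<^sub>v v) ` carrier_vec d = (\<lambda>v. v) ` (carrier_vec d :: rat vec set)"
    by (rule image_cong) auto
  then have "graded_piece d (restrict_rep N F) {0\<^sub>v d} (carrier_vec d)"
    unfolding graded_piece_def using carr diagonal_component[OF assms(2)]
    by (intro exI[of _ d] exI[of _ "\<lambda>(g, k). F (g, k N)"] exI[of _ "1\<^sub>m d"] conjI
        rational_rep_alg_rep assms) auto
  then show ?thesis
    using invariant_zero[OF hom] invariant_carrier[OF hom]
    by (intro rel_unipotentI[OF hom, of "\<lambda>j. if j = 0 then {0\<^sub>v d} else carrier_vec d" 1]) auto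
qed

text \<open>The block matrix with diagonal blocks \<open>A\<close> and 1 and with \<open>c\<close>
  in the last column; the product of two such matrices reproduces the cocycle relation.\<close>

definition ext_mat :: "nat \<Rightarrow> 'a::field mat \<Rightarrow> (nat \<Rightarrow> 'a) \<Rightarrow> 'a mat" where
  "ext_mat D A c = mat (Suc D) (Suc D) (\<lambda>(i, j).
     if i < D then if j < D then A $$ (i, j) else c i else if j < D then 0 else 1)"

lemma ext_mat_carrier [simp]: "ext_mat D A c \<in> carrier_mat (Suc D) (Suc D)"
  by (simp add: ext_mat_def)

lemma ext_mat_mult:
  assumes "A \<in> carrier_mat D D" "B \<in> carrier_mat D D"
  shows "ext_mat D A a * ext_mat D B b = ext_mat D (A * B) (\<lambda>i. a i + (\<Sum>j<D. A $$ (i, j) * b j))"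
proof (rule eq_matI)
  fix i j assume "i < dim_row (ext_mat D (A * B) (\<lambda>i. a i + (\<Sum>j<D. A $$ (i, j) * b j)))"
    "j < dim_col (ext_mat D (A * B) (\<lambda>i. a i + (\<Sum>j<D. A $$ (i, j) * b j)))"
  then have "i < Suc D" "j < Suc D" by (auto simp: ext_mat_def)
  then show "(ext_mat D A a * ext_mat D B b) $$ (i, j) =
      ext_mat D (A * B) (\<lambda>i. a i + (\<Sum>j<D. A $$ (i, j) * b j)) $$ (i, j)"
    by (auto simp: mult_mat_index[of _ "Suc D" "Suc D" _ "Suc D"] mult_mat_index[OF assms] ext_mat_def
        simp del: index_mult_mat(1))
qed (auto simp: ext_mat_def)

lemma ext_mat_mult_vec:
  assumes "A \<in> carrier_mat D D" "v \<in> carrier_vec (Suc D)"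
  shows "i < D \<Longrightarrow> (ext_mat D A c *\<^sub>v v) $ i = (\<Sum>j<D. A $$ (i, j) * v $ j) + c i * v $ D"
    and "(ext_mat D A c *\<^sub>v v) $ D = v $ D"
  using assms by (auto simp: mult_mat_vec_index[of _ "Suc D" "Suc D"] ext_mat_def
      simp del: index_mult_mat_vec)

text \<open>The cocycle relation makes the block matrices multiplicative. The vectors with last
  coordinate 0 form a copy of the given representation and the quotient by them is trivial, so a
  filtration with two steps has rational graded quotients.\<close>

lemma extension_rel_unipotent:
  assumes F: "alg_rep N D F" and N: "N \<ge> 1"
    and cocycle: "\<And>\<alpha> \<beta> i. \<alpha> \<in> carrier SL2_Z \<Longrightarrow> \<beta> \<in> carrier SL2_Z \<Longrightarrow> i < D \<Longrightarrow>
      c (\<alpha> * \<beta>) i = c \<alpha> i + (\<Sum>j<D. restrict_rep N F \<alpha> $$ (i, j) * c \<beta> j)"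
  shows "(Suc D, \<lambda>\<gamma>. ext_mat D (restrict_rep N F \<gamma>) (c \<gamma>)) \<in> rel_unipotent_reps"
proof -
  define A where "A = restrict_rep N F"
  have homA: "A \<in> hom SL2_Z (GL D)" unfolding A_def by (rule restrict_rep_hom[OF F])
  have A: "A \<gamma> \<in> carrier_mat D D" if "\<gamma> \<in> carrier SL2_Z" for \<gamma>
    using hom_in_carrier[OF homA that] by auto
  have A1: "A (1\<^sub>m 2) = 1\<^sub>m D" using hom_GL_one[OF homA] by simp
  define E where "E = (\<lambda>\<gamma>. ext_mat D (A \<gamma>) (c \<gamma>))"
  have E [simp]: "E \<gamma> \<in> carrier_mat (Suc D) (Suc D)" for \<gamma> by (simp add: E_def)
  have cong: "ext_mat D M a = ext_mat D M b" if "\<And>i. i < D \<Longrightarrow> a i = b i" for M and a b :: "nat \<Rightarrow> rat"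
    using that by (intro eq_matI) (auto simp: ext_mat_def)
  \<comment> \<open>The relation at 1 * 1 = 1, with A(1) the identity, forces c(1) = 0; this makes
    \<open>E\<close> send the identity to the identity matrix.\<close>
  have c1: "c (1\<^sub>m 2) i = 0" if "i < D" for i
  proof -
    have "(\<Sum>j<D. A (1\<^sub>m 2) $$ (i, j) * c (1\<^sub>m 2) j) = (\<Sum>j<D. if j = i then c (1\<^sub>m 2) j else 0)"
      using that unfolding A1 by (intro sum.cong) auto
    then show ?thesis
      using cocycle[of "1\<^sub>m 2" "1\<^sub>m 2" i] that by (simp add: SL2_carrier A_def)
  qed
  have hom: "E \<in> hom SL2_Z (GL (Suc D))"
  proof (rule hom_GL_I[OF SL2_group])
    fix x y assume xy: "x \<in> carrier SL2_Z" "y \<in> carrier SL2_Z"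
    have "ext_mat D (A x * A y) (c (x * y)) =
        ext_mat D (A x * A y) (\<lambda>i. c x i + (\<Sum>j<D. A x $$ (i, j) * c y j))"
      using cocycle[OF xy] by (intro cong) (auto simp: A_def)
    then show "E (x \<otimes>\<^bsub>SL2\<^esub> y) = E x * E y"
      using xy hom_mult[OF homA xy] by (simp add: E_def ext_mat_mult A)
  next
    have "ext_mat D (1\<^sub>m D) (c (1\<^sub>m 2)) = 1\<^sub>m (Suc D)"
      by (rule eq_matI) (auto simp: ext_mat_def c1)
    then show "E \<one>\<^bsub>SL2\<^esub> = 1\<^sub>m (Suc D)" by (simp add: E_def A1)
  qed auto
  define V where "V = {v \<in> carrier_vec (Suc D). v $ D = (0 :: rat)}"
  have V: "invariant_subspace SL2_Z (Suc D) E V"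
    unfolding invariant_subspace_def
  proof (intro conjI subspacesI ballI)
    fix g v assume "g \<in> carrier SL2_Z" "v \<in> V"
    then show "E g *\<^sub>v v \<in> V"
      using ext_mat_mult_vec(2)[OF A] unfolding V_def E_def
      by (auto intro: mult_mat_vec_carrier[OF ext_mat_carrier] simp del: index_mult_mat_vec)
  qed (auto simp: V_def)
  define W where "W = (\<lambda>j::nat. if j = 0 then {0\<^sub>v (Suc D)} else if j = 1 then V else carrier_vec (Suc D))"
  \<comment> \<open>\<open>P\<close> reads off the first D coordinates and \<open>L\<close> the last
    one. They induce the isomorphisms of the lower and the upper graded quotient.\<close>
  define P where "P = mat D (Suc D) (\<lambda>(i, j). if i = j then 1 else (0 :: rat))"
  define L where "L = mat 1 (Suc D) (\<lambda>(i, j). if j = D then 1 else (0 :: rat))"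
  have P: "P *\<^sub>v v = vec D (\<lambda>i. v $ i)" if "v \<in> carrier_vec (Suc D)" for v
    using that by (intro eq_vecI)
      (auto simp: P_def mult_mat_vec_index[of _ D "Suc D"] if_distrib[of "\<lambda>x. x * _"]
        simp del: index_mult_mat_vec cong: if_cong)
  have L: "L *\<^sub>v v = vec 1 (\<lambda>_. v $ D)" if "v \<in> carrier_vec (Suc D)" for v
    using that by (intro eq_vecI)
      (auto simp: L_def mult_mat_vec_index[of _ 1 "Suc D"] if_distrib[of "\<lambda>x. x * _"]
        simp del: index_mult_mat_vec cong: if_cong)
  have Ev: "E \<gamma> *\<^sub>v v \<in> carrier_vec (Suc D)" if "v \<in> carrier_vec (Suc D)" for \<gamma> v
    using that by (rule mult_mat_vec_carrier[OF E])
  have "rational_rep D (\<lambda>(g, k). F (g, k N)) \<and> P \<in> carrier_mat D (Suc D) \<and>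
      (\<lambda>v. P *\<^sub>v v) ` V = carrier_vec D \<and> {v \<in> V. P *\<^sub>v v = 0\<^sub>v D} = {0\<^sub>v (Suc D)} \<and>
      (\<forall>\<gamma>\<in>carrier SL2_Z. \<forall>v\<in>V.
         P *\<^sub>v (E \<gamma> *\<^sub>v v) = (case diagonal \<gamma> of (g, k) \<Rightarrow> F (g, k N)) *\<^sub>v (P *\<^sub>v v))"
  proof (intro conjI ballI)
    show "(\<lambda>v. P *\<^sub>v v) ` V = carrier_vec D"
    proof (intro equalityI subsetI)
      fix w :: "rat vec" assume w: "w \<in> carrier_vec D"
      let ?v = "vec (Suc D) (\<lambda>i. if i < D then w $ i else 0)"
      have "P *\<^sub>v ?v = w" "?v \<in> V" using w by (auto simp: P V_def)
      then show "w \<in> (\<lambda>v. P *\<^sub>v v) ` V" by (intro image_eqI[of _ _ ?v]) auto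
    qed (auto simp: P V_def)
    have "v = 0\<^sub>v (Suc D)" if "v \<in> V" "P *\<^sub>v v = 0\<^sub>v D" for v
    proof (rule eq_vecI)
      fix i assume "i < dim_vec (0\<^sub>v (Suc D) :: rat vec)"
      moreover have "vec D (\<lambda>i. v $ i) $ i = 0\<^sub>v D $ i" if "i < D" for i
        using P[of v] \<open>v \<in> V\<close> \<open>P *\<^sub>v v = 0\<^sub>v D\<close> by (simp add: V_def)
      ultimately show "v $ i = 0\<^sub>v (Suc D) $ i" using that by (cases "i = D") (auto simp: V_def)
    qed (use that in \<open>auto simp: V_def\<close>)
    then show "{v \<in> V. P *\<^sub>v v = 0\<^sub>v D} = {0\<^sub>v (Suc D)}" by (auto simp: V_def P)
    fix \<gamma> v assume \<gamma>: "\<gamma> \<in> carrier SL2_Z" and v: "v \<in> V"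
    then have v': "v \<in> carrier_vec (Suc D)" "v $ D = 0" by (simp_all add: V_def)
    show "P *\<^sub>v (E \<gamma> *\<^sub>v v) = (case diagonal \<gamma> of (g, k) \<Rightarrow> F (g, k N)) *\<^sub>v (P *\<^sub>v v)"
      unfolding diagonal_component[OF N] A_def[symmetric] P[OF v'(1)] P[OF Ev[OF v'(1)]]
    proof (rule eq_vecI)
      fix i assume "i < dim_vec (A \<gamma> *\<^sub>v vec D (($) v))"
      then have i: "i < D" using A[OF \<gamma>] by simp
      show "vec D (($) (E \<gamma> *\<^sub>v v)) $ i = (A \<gamma> *\<^sub>v vec D (($) v)) $ i"
        using i v' ext_mat_mult_vec(1)[OF A[OF \<gamma>] v'(1) i]
        by (simp add: E_def mult_mat_vec_index[OF A[OF \<gamma>]] del: index_mult_mat_vec)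
    qed (use A[OF \<gamma>] in auto)
  qed (use rational_rep_alg_rep[OF F N] in \<open>auto simp: P_def\<close>)
  then have sub: "graded_piece (Suc D) E {0\<^sub>v (Suc D)} V"
    unfolding graded_piece_def by (intro conjI exI[of _ D] exI[of _ "\<lambda>(g, k). F (g, k N)"] exI[of _ P])
      (auto simp: V_def)
  have "rational_rep 1 (\<lambda>(g, k). 1\<^sub>m 1) \<and> L \<in> carrier_mat 1 (Suc D) \<and>
      (\<lambda>v. L *\<^sub>v v) ` carrier_vec (Suc D) = carrier_vec 1 \<and>
      {v \<in> carrier_vec (Suc D). L *\<^sub>v v = 0\<^sub>v 1} = V \<and>
      (\<forall>\<gamma>\<in>carrier SL2_Z. \<forall>v\<in>carrier_vec (Suc D).
         L *\<^sub>v (E \<gamma> *\<^sub>v v) = (case diagonal \<gamma> of (g, k) \<Rightarrow> 1\<^sub>m 1) *\<^sub>v (L *\<^sub>v v))"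
  proof (intro conjI ballI)
    show "(\<lambda>v. L *\<^sub>v v) ` carrier_vec (Suc D) = carrier_vec 1"
    proof (intro equalityI subsetI)
      fix w :: "rat vec" assume w: "w \<in> carrier_vec 1"
      let ?v = "vec (Suc D) (\<lambda>i. w $ 0)"
      have "L *\<^sub>v ?v = w" using w by (auto simp: L)
      then show "w \<in> (\<lambda>v. L *\<^sub>v v) ` carrier_vec (Suc D)" by (intro image_eqI[of _ _ ?v]) auto
    qed (auto simp: L)
    have "vec 1 (\<lambda>_. x) = 0\<^sub>v 1 \<longleftrightarrow> x = 0" for x :: rat
    proof
      assume "vec 1 (\<lambda>_. x) = 0\<^sub>v 1"
      then have "vec 1 (\<lambda>_. x) $ 0 = 0\<^sub>v 1 $ 0" by simp
      then show "x = 0" by simp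
    qed (auto intro!: eq_vecI)
    then show "{v \<in> carrier_vec (Suc D). L *\<^sub>v v = 0\<^sub>v 1} = V"
      unfolding V_def by (intro Collect_cong conj_cong refl) (simp only: L)
    fix \<gamma> and v :: "rat vec" assume "\<gamma> \<in> carrier SL2_Z" "v \<in> carrier_vec (Suc D)"
    then show "L *\<^sub>v (E \<gamma> *\<^sub>v v) = (case diagonal \<gamma> of (g, k) \<Rightarrow> 1\<^sub>m 1) *\<^sub>v (L *\<^sub>v v)"
      using L[OF Ev] ext_mat_mult_vec(2)[OF A]
      by (simp add: L E_def split: prod.split del: index_mult_mat_vec)
  qed (use rational_rep_alg_rep[OF alg_rep_trivial N] in \<open>auto simp: L_def\<close>)
  then have quot: "graded_piece (Suc D) E V (carrier_vec (Suc D))"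
    unfolding graded_piece_def by (intro conjI exI[of _ 1] exI[of _ "\<lambda>(g, k). 1\<^sub>m 1"] exI[of _ L])
      (auto simp: V_def)
  have "(Suc D, E) \<in> rel_unipotent_reps"
  proof (rule rel_unipotentI[OF hom, of W 2])
    fix j :: nat assume "j < 2"
    then have "j = 0 \<or> j = 1" by auto
    then show "graded_piece (Suc D) E (W j) (W (Suc j))" using sub quot by (auto simp: W_def)
  qed (use V invariant_zero[OF hom] invariant_carrier[OF hom] in \<open>auto simp: W_def\<close>)
  then show ?thesis unfolding E_def A_def .
qed

section \<open>The regular representation of a finite group\<close>

locale enumerated_group = group G for G (structure) +
  fixes e :: "nat \<Rightarrow> 'a" and q :: nat
  assumes enum: "bij_betw e {..<q} (carrier G)"
begin

lemma enum_closed [simp]: "i < q \<Longrightarrow> e i \<in> carrier G"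
  using enum by (auto simp: bij_betw_def)

lemma enum_eq_iff: "i < q \<Longrightarrow> j < q \<Longrightarrow> e i = e j \<longleftrightarrow> i = j"
  using enum by (auto simp: bij_betw_def inj_on_def)

definition idx :: "'a \<Rightarrow> nat" where "idx x = the_inv_into {..<q} e x"

lemma idx [simp]:
  assumes "x \<in> carrier G" shows "idx x < q" "e (idx x) = x"
proof -
  have "x \<in> e ` {..<q}" "inj_on e {..<q}" using assms enum by (auto simp: bij_betw_def)
  then show "idx x < q" "e (idx x) = x"
    unfolding idx_def using the_inv_into_into[of e "{..<q}" x "{..<q}"] f_the_inv_into_f[of e "{..<q}" x]
    by auto
qed

lemma enum_eq_idx: "x \<in> carrier G \<Longrightarrow> i < q \<Longrightarrow> e i = x \<longleftrightarrow> i = idx x"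
  by (metis enum_eq_iff idx)

lemma idx_enum [simp]: "i < q \<Longrightarrow> idx (e i) = i"
  by (metis enum_closed enum_eq_iff idx)

text \<open>Left translation on the group algebra: basis vector j goes to the one of
  \<open>k \<otimes> e j\<close>. Column i therefore evaluates functions at the translate of
  \<open>e i\<close> by \<open>k\<close>, and row i at the translate by its inverse.\<close>

definition perm_mat :: "'a \<Rightarrow> 'k::field mat" where
  "perm_mat k = mat q q (\<lambda>(i, j). if e i = k \<otimes> e j then 1 else 0)"

lemma perm_mat_carrier [simp]: "perm_mat k \<in> carrier_mat q q"
  by (simp add: perm_mat_def)

lemma perm_mat_sum:
  assumes "k \<in> carrier G" "i < q"
  shows "(\<Sum>j<q. perm_mat k $$ (j, i) * f (e j)) = f (k \<otimes> e i)"
proof -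
  have "(\<Sum>j<q. perm_mat k $$ (j, i) * f (e j)) = (\<Sum>j<q. if j = idx (k \<otimes> e i) then f (e j) else 0)"
    using assms by (intro sum.cong) (auto simp: perm_mat_def enum_eq_idx)
  then show ?thesis using assms by simp
qed

lemma perm_mat_sum_row:
  assumes "k \<in> carrier G" "i < q"
  shows "(\<Sum>j<q. perm_mat k $$ (i, j) * f (e j)) = f (inv k \<otimes> e i)"
proof -
  have "e i = k \<otimes> e j \<longleftrightarrow> e j = inv k \<otimes> e i" if "j < q" for j
    using assms that by (metis enum_closed inv_solve_left)
  then have "(\<Sum>j<q. perm_mat k $$ (i, j) * f (e j)) = (\<Sum>j<q. if j = idx (inv k \<otimes> e i) then f (e j) else 0)"
    using assms by (intro sum.cong) (auto simp: perm_mat_def enum_eq_idx)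
  then show ?thesis using assms by simp
qed

lemma perm_mat_mult:
  assumes "k \<in> carrier G" "l \<in> carrier G"
  shows "perm_mat (k \<otimes> l) = (perm_mat k * perm_mat l :: 'k::field mat)"
proof (rule eq_matI)
  fix i j assume "i < dim_row (perm_mat k * perm_mat l :: 'k mat)" "j < dim_col (perm_mat k * perm_mat l :: 'k mat)"
  then have ij: "i < q" "j < q" by (auto simp: perm_mat_def)
  have "(perm_mat k * perm_mat l :: 'k mat) $$ (i, j) = (\<Sum>m<q. perm_mat l $$ (m, j) * perm_mat k $$ (i, m))"
    using ij by (subst mult_mat_index[of _ q q _ q]) (auto simp: mult.commute)
  also have "\<dots> = (\<Sum>m<q. perm_mat l $$ (m, j) * (if e i = k \<otimes> e m then 1 else 0))"
    using ij by (intro sum.cong) (auto simp: perm_mat_def)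
  also have "\<dots> = perm_mat (k \<otimes> l) $$ (i, j)"
    using ij assms by (subst perm_mat_sum) (auto simp: perm_mat_def m_assoc)
  finally show "perm_mat (k \<otimes> l) $$ (i, j) = (perm_mat k * perm_mat l :: 'k mat) $$ (i, j)" ..
qed (auto simp: perm_mat_def)

lemma perm_mat_one: "perm_mat \<one> = 1\<^sub>m q"
  by (rule eq_matI) (auto simp: perm_mat_def enum_eq_iff)

lemma perm_mat_inject:
  assumes "k \<in> carrier G" "l \<in> carrier G" "perm_mat k = (perm_mat l :: 'k::field mat)"
  shows "k = l"
proof -
  have "perm_mat k $$ (idx k, idx \<one>) = (perm_mat l $$ (idx k, idx \<one>) :: 'k)" using assms(3) by simp
  then show ?thesis using assms by (simp add: perm_mat_def split: if_splits)
qed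

text \<open>Right translations commute with left ones and so are endomorphisms of the regular
  representation; a tensor automorphism has to commute with them.\<close>

definition right_mat :: "'a \<Rightarrow> 'k::field mat" where
  "right_mat x = mat q q (\<lambda>(i, j). if e i = e j \<otimes> x then 1 else 0)"

text \<open>Pointwise multiplication of functions on the group, as a linear map on the tensor
  square. It is equivariant because left translations act by ring automorphisms.\<close>

definition diag_mult :: "'k::field mat" where
  "diag_mult = mat q (q * q) (\<lambda>(i, m). if m div q = i \<and> m mod q = i then 1 else 0)"

lemma right_mat_carrier [simp]: "right_mat x \<in> carrier_mat q q"
  by (simp add: right_mat_def)

lemma diag_mult_carrier [simp]: "diag_mult \<in> carrier_mat q (q * q)"
  by (simp add: diag_mult_def)

lemma right_mat_index_left:
  assumes "x \<in> carrier G" "M \<in> carrier_mat q q" "i < q" "j < q"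
  shows "(right_mat x * M) $$ (i, j) = M $$ (idx (e i \<otimes> inv x), j)"
proof -
  have "e i = e m \<otimes> x \<longleftrightarrow> m = idx (e i \<otimes> inv x)" if "m < q" for m
    using assms that by (metis enum_closed enum_eq_idx inv_closed inv_solve_right m_closed)
  then have "(right_mat x * M) $$ (i, j) = (\<Sum>m<q. if m = idx (e i \<otimes> inv x) then M $$ (m, j) else 0)"
    unfolding mult_mat_index[OF right_mat_carrier assms(2-4)]
    using assms by (intro sum.cong) (auto simp: right_mat_def)
  then show ?thesis using assms by simp
qed

lemma right_mat_index_right:
  assumes "x \<in> carrier G" "M \<in> carrier_mat q q" "i < q" "j < q"
  shows "(M * right_mat x) $$ (i, j) = M $$ (i, idx (e j \<otimes> x))"
proof -
  have "(M * right_mat x) $$ (i, j) = (\<Sum>m<q. if m = idx (e j \<otimes> x) then M $$ (i, m) else 0)"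
    unfolding mult_mat_index[OF assms(2) right_mat_carrier assms(3,4)]
    using assms by (intro sum.cong) (auto simp: right_mat_def enum_eq_idx)
  then show ?thesis using assms by simp
qed

lemma right_mat_perm_mat:
  assumes "x \<in> carrier G" "k \<in> carrier G"
  shows "right_mat x * perm_mat k = (perm_mat k * right_mat x :: 'k::field mat)"
proof (rule eq_matI)
  fix i j assume "i < dim_row (perm_mat k * right_mat x :: 'k mat)" "j < dim_col (perm_mat k * right_mat x :: 'k mat)"
  then have ij: "i < q" "j < q" by (auto simp: perm_mat_def right_mat_def)
  have "e i \<otimes> inv x = k \<otimes> e j \<longleftrightarrow> e i = k \<otimes> (e j \<otimes> x)"
    using ij assms by (metis enum_closed inv_solve_right m_assoc m_closed)
  then show "(right_mat x * perm_mat k) $$ (i, j) = (perm_mat k * right_mat x :: 'k mat) $$ (i, j)"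
    using ij assms unfolding right_mat_index_left[OF assms(1) perm_mat_carrier ij]
      right_mat_index_right[OF assms(1) perm_mat_carrier ij]
    by (simp add: perm_mat_def)
qed (auto simp: perm_mat_def right_mat_def)

lemma diag_mult_left:
  assumes "M \<in> carrier_mat (q * q) c" "i < q" "j < c"
  shows "(diag_mult * M) $$ (i, j) = M $$ (i * q + i, j)"
proof -
  have m: "m div q = i \<and> m mod q = i \<longleftrightarrow> m = i * q + i" for m
    using assms(2) by (metis div_mult_mod_eq div_mult_self3 add.commute div_less mod_less
        mod_mult_self3 less_nat_zero_code add_0 div_mult_self4 mod_mult_self4 not_gr_zero)
  have "(diag_mult * M) $$ (i, j) = (\<Sum>m<q * q. if m = i * q + i then M $$ (m, j) else 0)"
    unfolding mult_mat_index[OF diag_mult_carrier assms]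
    using assms by (intro sum.cong) (auto simp: diag_mult_def m)
  then show ?thesis using pair_index_less[OF assms(2,2)] by simp
qed

lemma diag_mult_right:
  assumes "M \<in> carrier_mat q q" "i < q" "j < q * q"
  shows "(M * diag_mult) $$ (i, j) = (if j div q = j mod q then M $$ (i, j div q) else 0)"
proof -
  have "(M * diag_mult) $$ (i, j) = (\<Sum>m<q. if m = j div q then if j div q = j mod q then M $$ (i, j div q) else 0 else 0)"
    unfolding mult_mat_index[OF assms(1) diag_mult_carrier assms(2,3)]
    using assms by (intro sum.cong) (auto simp: diag_mult_def)
  then show ?thesis using div_mod_less(1)[OF assms(3)] by simp
qed

text \<open>Multiplicativity for the pointwise product, read off on basis vectors: the entries of
  each row are idempotents with pairwise product 0, so at most one of them is 1.\<close>

lemma diag_mult_equivariant_iff: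
  fixes M :: "'k::field mat"
  assumes "M \<in> carrier_mat q q"
  shows "diag_mult * kron_mat M M = M * diag_mult \<longleftrightarrow>
    (\<forall>i<q. \<forall>j<q. \<forall>l<q. M $$ (i, j) * M $$ (i, l) = (if j = l then M $$ (i, j) else 0))"
proof -
  have left: "(diag_mult * kron_mat M M) $$ (i, m) = M $$ (i, m div q) * M $$ (i, m mod q)"
    if "i < q" "m < q * q" for i m
    using that pair_index_less[OF that(1,1)] diag_mult_left[OF kron_mat_carrier[OF assms assms] that]
    by (simp add: kron_mat_index[OF assms assms])
  have "diag_mult * kron_mat M M = M * diag_mult \<longleftrightarrow> (\<forall>i<q. \<forall>m<q * q.
      M $$ (i, m div q) * M $$ (i, m mod q) = (if m div q = m mod q then M $$ (i, m div q) else 0))"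
  proof
    assume "diag_mult * kron_mat M M = M * diag_mult"
    then show "\<forall>i<q. \<forall>m<q * q.
      M $$ (i, m div q) * M $$ (i, m mod q) = (if m div q = m mod q then M $$ (i, m div q) else 0)"
      using left diag_mult_right[OF assms] by metis
  next
    assume *: "\<forall>i<q. \<forall>m<q * q.
      M $$ (i, m div q) * M $$ (i, m mod q) = (if m div q = m mod q then M $$ (i, m div q) else 0)"
    show "diag_mult * kron_mat M M = M * diag_mult"
    proof (rule eq_matI)
      fix i m assume "i < dim_row (M * diag_mult)" "m < dim_col (M * diag_mult)"
      then have "i < q" "m < q * q" using assms by (auto simp: diag_mult_def)
      then show "(diag_mult * kron_mat M M) $$ (i, m) = (M * diag_mult) $$ (i, m)"
        using left diag_mult_right[OF assms] * by simp
    qed (use assms in \<open>auto simp: diag_mult_def kron_mat_def\<close>)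
  qed
  also have "\<dots> \<longleftrightarrow> (\<forall>i<q. \<forall>j<q. \<forall>l<q. M $$ (i, j) * M $$ (i, l) = (if j = l then M $$ (i, j) else 0))"
  proof (intro iffI allI impI)
    fix i j l assume *: "\<forall>i<q. \<forall>m<q * q.
      M $$ (i, m div q) * M $$ (i, m mod q) = (if m div q = m mod q then M $$ (i, m div q) else 0)"
      and "i < q" "j < q" "l < q"
    then show "M $$ (i, j) * M $$ (i, l) = (if j = l then M $$ (i, j) else 0)"
      using *[rule_format, of i "j * q + l"] pair_index_less[of j q l q] by simp
  next
    fix i m assume "\<forall>i<q. \<forall>j<q. \<forall>l<q. M $$ (i, j) * M $$ (i, l) = (if j = l then M $$ (i, j) else 0)"
      and "i < q" "m < q * q"
    then show "M $$ (i, m div q) * M $$ (i, m mod q) = (if m div q = m mod q then M $$ (i, m div q) else 0)"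
      using div_mod_less[of m q q] by simp
  qed
  finally show ?thesis .
qed

lemma diag_mult_perm_mat:
  assumes "k \<in> carrier G"
  shows "diag_mult * kron_mat (perm_mat k) (perm_mat k) = (perm_mat k * diag_mult :: 'k::field mat)"
  unfolding diag_mult_equivariant_iff[OF perm_mat_carrier]
  using assms by (auto simp: perm_mat_def enum_eq_iff)

text \<open>The first condition says that the matrix acts on the functions on the group by a ring
  homomorphism, that is, by a self-map of the group; the second one makes this map a left
  translation.\<close>

lemma perm_matI:
  fixes M :: "'k::field mat"
  assumes M: "M \<in> carrier (GL q)"
    and mult: "diag_mult * kron_mat M M = M * diag_mult"
    and right: "\<And>x. x \<in> carrier G \<Longrightarrow> right_mat x * M = M * right_mat x"
  shows "\<exists>k\<in>carrier G. M = perm_mat k"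
proof -
  have Mc: "M \<in> carrier_mat q q" using M by auto
  have M2: "M $$ (i, j) * M $$ (i, l) = (if j = l then M $$ (i, j) else 0)" if "i < q" "j < q" "l < q" for i j l
    using mult that unfolding diag_mult_equivariant_iff[OF Mc] by blast
  obtain B where B: "B \<in> carrier_mat q q" "M * B = 1\<^sub>m q" using M GL_carrier by blast
  define i0 where "i0 = idx \<one>"
  have i0: "i0 < q" by (simp add: i0_def)
  \<comment> \<open>Invertibility excludes a zero row, so by \<open>M2\<close> the row of the
    identity has exactly one nonzero entry, and that entry is 1.\<close>
  have "\<exists>j<q. M $$ (i0, j) \<noteq> 0"
  proof (rule ccontr)
    assume "\<not> (\<exists>j<q. M $$ (i0, j) \<noteq> 0)"
    then have "(M * B) $$ (i0, i0) = 0"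
      using mult_mat_index[OF Mc B(1) i0 i0] by simp
    then show False using B(2) i0 by simp
  qed
  then obtain j0 where j0: "j0 < q" "M $$ (i0, j0) \<noteq> 0" by blast
  have "M $$ (i0, j0) * M $$ (i0, j0) = M $$ (i0, j0)" using M2[OF i0 j0(1) j0(1)] by simp
  then have "M $$ (i0, j0) = 1" using j0(2) by simp
  then have row: "M $$ (i0, j) = (if j = j0 then 1 else 0)" if "j < q" for j
    using M2[OF i0 j0(1) that] by auto
  \<comment> \<open>In the matrix of left translation by k, the row of the identity has its entry 1
    at the inverse of k.\<close>
  define k where "k = inv (e j0)"
  have k: "k \<in> carrier G" using j0 by (simp add: k_def)
  have "M = perm_mat k"
  proof (rule eq_matI)
    fix i j assume "i < dim_row (perm_mat k :: 'k mat)" "j < dim_col (perm_mat k :: 'k mat)"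
    then have ij: "i < q" "j < q" by (auto simp: perm_mat_def)
    \<comment> \<open>Right translation by \<open>e i\<close> carries the row of the identity to row
      i, and column \<open>?b\<close> of the former corresponds to column j of the latter.\<close>
    let ?b = "idx (e j \<otimes> inv (e i))"
    have b: "?b < q" "e ?b = e j \<otimes> inv (e i)" using ij by simp_all
    have "M $$ (idx (e i \<otimes> inv (e i)), ?b) = M $$ (i, idx (e ?b \<otimes> e i))"
      using right[of "e i"] right_mat_index_left[OF _ Mc ij(1) b(1), of "e i"]
        right_mat_index_right[OF _ Mc ij(1) b(1), of "e i"] ij by simp
    then have "M $$ (i, j) = (if ?b = j0 then 1 else 0)"
      using ij row[OF b(1)] by (simp add: b(2) m_assoc i0_def)
    moreover have "?b = j0 \<longleftrightarrow> e j \<otimes> inv (e i) = e j0"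
      using b j0 enum_eq_iff by metis
    moreover have "e j \<otimes> inv (e i) = e j0 \<longleftrightarrow> e i = k \<otimes> e j"
      unfolding k_def using ij j0(1)
      by (metis enum_closed inv_closed inv_solve_left inv_solve_right m_closed)
    ultimately show "M $$ (i, j) = perm_mat k $$ (i, j)" using ij by (simp add: perm_mat_def)
  qed (use Mc in \<open>auto simp: perm_mat_def\<close>)
  with k show ?thesis by blast
qed

end

lemma alg_rep_perm:
  assumes "enumerated_group (SL2_mod N) e q"
  shows "alg_rep N q (\<lambda>(g, l). enumerated_group.perm_mat (SL2_mod N) e q l)"
proof -
  interpret K: enumerated_group "SL2_mod N" e q by fact
  show ?thesis
    by (rule alg_repI) (use K.perm_mat_mult K.perm_mat_one in \<open>auto intro: regular_SL2.const\<close>)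
qed

section \<open>Tensor automorphisms\<close>

lemma tannaka_carrier:
  "\<eta> \<in> carrier tannaka_group \<longleftrightarrow> \<eta> \<in> carrier (product_group rel_unipotent_reps (\<lambda>(n, \<rho>). GL n)) \<and>
    (\<forall>n \<rho> n' \<rho>' T. (n, \<rho>) \<in> rel_unipotent_reps \<longrightarrow> (n', \<rho>') \<in> rel_unipotent_reps \<longrightarrow>
       T \<in> carrier_mat n' n \<longrightarrow> (\<forall>\<gamma>\<in>carrier SL2_Z. T * \<rho> \<gamma> = \<rho>' \<gamma> * T) \<longrightarrow>
       map_mat of_rat T * \<eta> (n, \<rho>) = \<eta> (n', \<rho>') * map_mat of_rat T) \<and>
    (\<forall>n \<rho> n' \<rho>'. (n, \<rho>) \<in> rel_unipotent_reps \<longrightarrow> (n', \<rho>') \<in> rel_unipotent_reps \<longrightarrow>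
       (n * n', \<lambda>\<gamma>. kron_mat (\<rho> \<gamma>) (\<rho>' \<gamma>)) \<in> rel_unipotent_reps \<longrightarrow>
       \<eta> (n * n', \<lambda>\<gamma>. kron_mat (\<rho> \<gamma>) (\<rho>' \<gamma>)) = kron_mat (\<eta> (n, \<rho>)) (\<eta> (n', \<rho>'))) \<and>
    \<eta> (1, \<lambda>_. 1\<^sub>m 1) = 1\<^sub>m 1"
  unfolding tannaka_group_def by (simp add: Ball_def)

lemma tannaka_group_mult:
  "\<eta> \<otimes>\<^bsub>tannaka_group\<^esub> \<theta> = (\<lambda>X\<in>rel_unipotent_reps. \<eta> X * \<theta> X)"
  by (auto simp: tannaka_group_def fun_eq_iff split: prod.splits)

lemma tannaka_GL:
  "\<eta> \<in> carrier tannaka_group \<Longrightarrow> (n, \<rho>) \<in> rel_unipotent_reps \<Longrightarrow> \<eta> (n, \<rho>) \<in> carrier (GL n)"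
  unfolding tannaka_carrier by (auto simp: PiE_iff)

lemma tannaka_carrier_mat:
  "\<eta> \<in> carrier tannaka_group \<Longrightarrow> (n, \<rho>) \<in> rel_unipotent_reps \<Longrightarrow> \<eta> (n, \<rho>) \<in> carrier_mat n n"
  using tannaka_GL by auto

lemma tannaka_natural:
  "\<eta> \<in> carrier tannaka_group \<Longrightarrow> (n, \<rho>) \<in> rel_unipotent_reps \<Longrightarrow> (n', \<rho>') \<in> rel_unipotent_reps \<Longrightarrow>
   T \<in> carrier_mat n' n \<Longrightarrow> (\<And>\<gamma>. \<gamma> \<in> carrier SL2_Z \<Longrightarrow> T * \<rho> \<gamma> = \<rho>' \<gamma> * T) \<Longrightarrow>
   map_mat of_rat T * \<eta> (n, \<rho>) = \<eta> (n', \<rho>') * map_mat of_rat T"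
  unfolding tannaka_carrier by blast

lemma tannaka_tensor:
  "\<eta> \<in> carrier tannaka_group \<Longrightarrow> (n, \<rho>) \<in> rel_unipotent_reps \<Longrightarrow> (n', \<rho>') \<in> rel_unipotent_reps \<Longrightarrow>
   (n * n', \<lambda>\<gamma>. kron_mat (\<rho> \<gamma>) (\<rho>' \<gamma>)) \<in> rel_unipotent_reps \<Longrightarrow>
   \<eta> (n * n', \<lambda>\<gamma>. kron_mat (\<rho> \<gamma>) (\<rho>' \<gamma>)) = kron_mat (\<eta> (n, \<rho>)) (\<eta> (n', \<rho>'))"
  unfolding tannaka_carrier by blast

lemma tannaka_unit: "\<eta> \<in> carrier tannaka_group \<Longrightarrow> \<eta> (1, \<lambda>_. 1\<^sub>m 1) = 1\<^sub>m 1"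
  unfolding tannaka_carrier by blast

lemma trivial_rel_unipotent: "(1, \<lambda>_. 1\<^sub>m 1) \<in> rel_unipotent_reps"
  using alg_rep_rel_unipotent[OF alg_rep_trivial[of 1]] by (simp add: restrict_rep_def[abs_def])

section \<open>The group structure on tensor automorphisms\<close>

lemma GL_inverse:
  assumes "A \<in> carrier (GL n)"
  shows "inv\<^bsub>GL n\<^esub> A \<in> carrier_mat n n" "A * inv\<^bsub>GL n\<^esub> A = 1\<^sub>m n" "inv\<^bsub>GL n\<^esub> A * A = 1\<^sub>m n"
  using group.inv_closed[OF group_GL assms] group.r_inv[OF group_GL assms] group.l_inv[OF group_GL assms]
  by auto

lemma kron_inverse:
  fixes A B :: "'k::field mat"
  assumes "A \<in> carrier (GL a)" "B \<in> carrier (GL b)"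
  shows "kron_mat A B \<in> carrier (GL (a * b))"
    and "inv\<^bsub>GL (a * b)\<^esub> (kron_mat A B) = kron_mat (inv\<^bsub>GL a\<^esub> A) (inv\<^bsub>GL b\<^esub> B)"
proof -
  note c = GL_carrierD[OF assms(1)] GL_carrierD[OF assms(2)] GL_inverse[OF assms(1)] GL_inverse[OF assms(2)]
  have *: "kron_mat A B * kron_mat (inv\<^bsub>GL a\<^esub> A) (inv\<^bsub>GL b\<^esub> B) = 1\<^sub>m (a * b)"
    "kron_mat (inv\<^bsub>GL a\<^esub> A) (inv\<^bsub>GL b\<^esub> B) * kron_mat A B = 1\<^sub>m (a * b)"
    using kron_mat_mult[OF c(1,3,2,6)] kron_mat_mult[OF c(3,1,6,2)] c by (simp_all add: kron_mat_one)
  have carr: "kron_mat A B \<in> carrier_mat (a * b) (a * b)"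
    "kron_mat (inv\<^bsub>GL a\<^esub> A) (inv\<^bsub>GL b\<^esub> B) \<in> carrier_mat (a * b) (a * b)"
    using c by simp_all
  show "kron_mat A B \<in> carrier (GL (a * b))"
    by (rule GL_carrierI[OF carr *])
  moreover have "kron_mat (inv\<^bsub>GL a\<^esub> A) (inv\<^bsub>GL b\<^esub> B) \<in> carrier (GL (a * b))"
    by (rule GL_carrierI[OF carr(2,1) *(2,1)])
  ultimately show "inv\<^bsub>GL (a * b)\<^esub> (kron_mat A B) = kron_mat (inv\<^bsub>GL a\<^esub> A) (inv\<^bsub>GL b\<^esub> B)"
    using * by (intro group.inv_equality[OF group_GL]) simp_all
qed

lemma GL_intertwine_inverse:
  fixes A B T :: "'k::field mat"
  assumes "A \<in> carrier (GL a)" "B \<in> carrier (GL b)" "T \<in> carrier_mat b a" "T * A = B * T"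
  shows "T * inv\<^bsub>GL a\<^esub> A = inv\<^bsub>GL b\<^esub> B * T"
proof -
  note c = GL_carrierD[OF assms(1)] GL_carrierD[OF assms(2)] GL_inverse[OF assms(1)] GL_inverse[OF assms(2)]
  have "T * inv\<^bsub>GL a\<^esub> A = (inv\<^bsub>GL b\<^esub> B * B) * (T * inv\<^bsub>GL a\<^esub> A)"
    using c assms(3) by simp
  also have "\<dots> = inv\<^bsub>GL b\<^esub> B * (B * T) * inv\<^bsub>GL a\<^esub> A"
    using c(1-4,6) assms(3) by (simp add: assoc_mult_mat[of _ b b _ b _ a] assoc_mult_mat[of _ b b _ a _ a])
  also have "\<dots> = inv\<^bsub>GL b\<^esub> B * (T * A) * inv\<^bsub>GL a\<^esub> A"
    by (simp add: assms(4))
  also have "\<dots> = inv\<^bsub>GL b\<^esub> B * T * (A * inv\<^bsub>GL a\<^esub> A)"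
    using c(1-3,6) assms(3) by (simp add: assoc_mult_mat[of _ b b _ a _ a] assoc_mult_mat[of _ b a _ a _ a])
  also have "\<dots> = inv\<^bsub>GL b\<^esub> B * T" using c assms(3) by simp
  finally show ?thesis .
qed

text \<open>Naturality, tensor compatibility and the unit condition are stable under componentwise
  products and inverses, so they cut out a subgroup of the product of the GL(n). Conjugation in this
  group is what \<open>class_function_cocycle\<close> needs.\<close>

lemma tannaka_group_group: "group tannaka_group"
proof -
  let ?P = "product_group rel_unipotent_reps (\<lambda>(n, \<rho>). GL n) :: fiber_aut monoid"
  have groups: "\<And>X. group ((\<lambda>(n, \<rho> :: int mat \<Rightarrow> rat mat). GL n :: complex mat monoid) X)"
    by (auto simp: group_GL)
  interpret P: group ?P by (rule product_group) (use groups in auto)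
  have "subgroup (carrier tannaka_group) ?P"
  proof (rule P.subgroupI)
    show "carrier tannaka_group \<subseteq> carrier ?P" using tannaka_carrier by blast
    have "\<one>\<^bsub>?P\<^esub> \<in> carrier tannaka_group"
      unfolding tannaka_carrier
      using P.one_closed trivial_rel_unipotent by (auto simp: kron_mat_one)
    then show "carrier tannaka_group \<noteq> {}" by blast
  next
    fix \<eta> assume \<eta>: "\<eta> \<in> carrier tannaka_group"
    then have P: "\<eta> \<in> carrier ?P" unfolding tannaka_carrier by blast
    then have inv: "inv\<^bsub>?P\<^esub> \<eta> = (\<lambda>(n, \<rho>)\<in>rel_unipotent_reps. inv\<^bsub>GL n\<^esub> (\<eta> (n, \<rho>)))"
      using groups by (subst inv_product_group) (auto simp: fun_eq_iff)
    show "inv\<^bsub>?P\<^esub> \<eta> \<in> carrier tannaka_group"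
      unfolding tannaka_carrier
    proof (intro conjI allI impI)
      show "inv\<^bsub>?P\<^esub> \<eta> \<in> carrier ?P" using P by (rule P.inv_closed)
    next
      fix n \<rho> n' \<rho>' T assume *: "(n, \<rho>) \<in> rel_unipotent_reps" "(n', \<rho>') \<in> rel_unipotent_reps"
        "T \<in> carrier_mat n' n" "\<forall>\<gamma>\<in>carrier SL2_Z. T * \<rho> \<gamma> = \<rho>' \<gamma> * T"
      show "map_mat of_rat T * (inv\<^bsub>?P\<^esub> \<eta>) (n, \<rho>) = (inv\<^bsub>?P\<^esub> \<eta>) (n', \<rho>') * map_mat of_rat T"
        using GL_intertwine_inverse[OF tannaka_GL[OF \<eta> *(1)] tannaka_GL[OF \<eta> *(2)] _
            tannaka_natural[OF \<eta> *(1-3)]] * by (simp add: inv)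
    next
      fix n \<rho> n' \<rho>' assume *: "(n, \<rho>) \<in> rel_unipotent_reps" "(n', \<rho>') \<in> rel_unipotent_reps"
        "(n * n', \<lambda>\<gamma>. kron_mat (\<rho> \<gamma>) (\<rho>' \<gamma>)) \<in> rel_unipotent_reps"
      show "(inv\<^bsub>?P\<^esub> \<eta>) (n * n', \<lambda>\<gamma>. kron_mat (\<rho> \<gamma>) (\<rho>' \<gamma>)) =
          kron_mat ((inv\<^bsub>?P\<^esub> \<eta>) (n, \<rho>)) ((inv\<^bsub>?P\<^esub> \<eta>) (n', \<rho>'))"
        using kron_inverse(2)[OF tannaka_GL[OF \<eta> *(1)] tannaka_GL[OF \<eta> *(2)]]
          tannaka_tensor[OF \<eta> *] * by (simp add: inv)
    next
      show "(inv\<^bsub>?P\<^esub> \<eta>) (1, \<lambda>_. 1\<^sub>m 1) = 1\<^sub>m 1"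
        using trivial_rel_unipotent tannaka_unit[OF \<eta>] monoid.inv_one[OF group.is_monoid[OF group_GL], of 1] by (simp add: inv)
    qed
  next
    fix \<eta> \<theta> assume \<eta>: "\<eta> \<in> carrier tannaka_group" and \<theta>: "\<theta> \<in> carrier tannaka_group"
    then have P: "\<eta> \<in> carrier ?P" "\<theta> \<in> carrier ?P" unfolding tannaka_carrier by blast+
    have mult: "\<eta> \<otimes>\<^bsub>?P\<^esub> \<theta> = (\<lambda>X\<in>rel_unipotent_reps. \<eta> X * \<theta> X)"
      by (auto simp: fun_eq_iff split: prod.splits)
    show "\<eta> \<otimes>\<^bsub>?P\<^esub> \<theta> \<in> carrier tannaka_group"
      unfolding tannaka_carrier
    proof (intro conjI allI impI)
      show "\<eta> \<otimes>\<^bsub>?P\<^esub> \<theta> \<in> carrier ?P" using P by (rule P.m_closed)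
    next
      fix n \<rho> n' \<rho>' T assume *: "(n, \<rho>) \<in> rel_unipotent_reps" "(n', \<rho>') \<in> rel_unipotent_reps"
        "T \<in> carrier_mat n' n" "\<forall>\<gamma>\<in>carrier SL2_Z. T * \<rho> \<gamma> = \<rho>' \<gamma> * T"
      note c = tannaka_carrier_mat[OF \<eta> *(1)] tannaka_carrier_mat[OF \<eta> *(2)]
        tannaka_carrier_mat[OF \<theta> *(1)] tannaka_carrier_mat[OF \<theta> *(2)]
      have T: "map_mat of_rat T \<in> carrier_mat n' n" using *(3) by simp
      have nat: "map_mat of_rat T * \<eta> (n, \<rho>) = \<eta> (n', \<rho>') * map_mat of_rat T"
        "map_mat of_rat T * \<theta> (n, \<rho>) = \<theta> (n', \<rho>') * map_mat of_rat T"
        using tannaka_natural[OF \<eta> *(1-3)] tannaka_natural[OF \<theta> *(1-3)] *(4) by blast+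
      have "map_mat of_rat T * (\<eta> (n, \<rho>) * \<theta> (n, \<rho>)) = \<eta> (n', \<rho>') * \<theta> (n', \<rho>') * map_mat of_rat T"
        using nat assoc_mult_mat[OF T c(1) c(3)] assoc_mult_mat[OF c(2) T c(3)] assoc_mult_mat[OF c(2) c(4) T]
        by simp
      then show "map_mat of_rat T * (\<eta> \<otimes>\<^bsub>?P\<^esub> \<theta>) (n, \<rho>) = (\<eta> \<otimes>\<^bsub>?P\<^esub> \<theta>) (n', \<rho>') * map_mat of_rat T"
        using * unfolding mult by simp
    next
      fix n \<rho> n' \<rho>' assume *: "(n, \<rho>) \<in> rel_unipotent_reps" "(n', \<rho>') \<in> rel_unipotent_reps"
        "(n * n', \<lambda>\<gamma>. kron_mat (\<rho> \<gamma>) (\<rho>' \<gamma>)) \<in> rel_unipotent_reps"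
      show "(\<eta> \<otimes>\<^bsub>?P\<^esub> \<theta>) (n * n', \<lambda>\<gamma>. kron_mat (\<rho> \<gamma>) (\<rho>' \<gamma>)) =
          kron_mat ((\<eta> \<otimes>\<^bsub>?P\<^esub> \<theta>) (n, \<rho>)) ((\<eta> \<otimes>\<^bsub>?P\<^esub> \<theta>) (n', \<rho>'))"
        unfolding mult using * tannaka_tensor[OF \<eta> *] tannaka_tensor[OF \<theta> *]
          kron_mat_mult[OF tannaka_carrier_mat[OF \<eta> *(1)] tannaka_carrier_mat[OF \<theta> *(1)]
            tannaka_carrier_mat[OF \<eta> *(2)] tannaka_carrier_mat[OF \<theta> *(2)]] by simp
    next
      show "(\<eta> \<otimes>\<^bsub>?P\<^esub> \<theta>) (1, \<lambda>_. 1\<^sub>m 1) = 1\<^sub>m 1"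
        unfolding mult using trivial_rel_unipotent tannaka_unit[OF \<eta>] tannaka_unit[OF \<theta>] by simp
    qed
  qed
  then have "group (?P\<lparr>carrier := carrier tannaka_group\<rparr>)" by (rule P.subgroup_imp_group)
  moreover have "?P\<lparr>carrier := carrier tannaka_group\<rparr> = tannaka_group"
    by (simp add: tannaka_group_def)
  ultimately show ?thesis by simp
qed

section \<open>Regular class functions on the relative completion\<close>

lemma tannaka_ring_sum:
  assumes "\<And>i. i \<in> I \<Longrightarrow> \<Phi> i \<in> tannaka_ring"
  shows "(\<lambda>\<eta>. \<Sum>i\<in>I. \<Phi> i \<eta>) \<in> tannaka_ring"
  using assms
proof (induction I rule: infinite_finite_induct)
  case (insert i I)
  then show ?case by (simp add: tannaka_ring.add)
qed (use tannaka_ring.const[of 0] in simp_all)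

lemma tannaka_ring_rat_regular:
  assumes "(2, \<rho>) \<in> rel_unipotent_reps" "p \<in> rat_regular_SL2"
  shows "(\<lambda>\<eta>. p (\<eta> (2, \<rho>))) \<in> tannaka_ring"
  using assms(2,1) by induction (auto intro: tannaka_ring.intros)

lemma class_function_cong:
  assumes "group H" "\<And>h. h \<in> carrier H \<Longrightarrow> F h = F' h" "class_function H F'"
  shows "class_function H F"
proof -
  interpret group H by fact
  show ?thesis
    using assms(2,3) by (simp add: class_function_def)
qed

lemma Cl_C_sum:
  assumes "finite I" "\<And>i. i \<in> I \<Longrightarrow> \<Psi> i \<in> Cl"
  shows "(\<lambda>\<eta>. \<Sum>i\<in>I. c i * \<Psi> i \<eta>) \<in> Cl_C"
proof -
  obtain h where h: "bij_betw h {..<card I} I"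
    using ex_bij_betw_nat_finite[OF assms(1)] by (auto simp: atLeast0LessThan)
  have "(\<Sum>i\<in>I. c i * \<Psi> i \<eta>) = (\<Sum>i<card I. (c \<circ> h) i * (\<Psi> \<circ> h) i \<eta>)" for \<eta>
    using sum.reindex_bij_betw[OF h, of "\<lambda>i. c i * \<Psi> i \<eta>"] by simp
  moreover have "(\<Psi> \<circ> h) i \<in> Cl" if "i < card I" for i
    using h that assms(2) by (auto simp: bij_betw_def)
  ultimately show ?thesis unfolding Cl_C_def by blast
qed

lemma restrict_rep_kron:
  "(\<lambda>\<gamma>. kron_mat (restrict_rep N F \<gamma>) (restrict_rep N F' \<gamma>)) = restrict_rep N (\<lambda>x. kron_mat (F x) (F' x))"
  by (simp add: restrict_rep_def fun_eq_iff)

lemma tannaka_kron: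
  assumes "alg_rep N d F" "alg_rep N d' F'" "N \<ge> 1" "\<eta> \<in> carrier tannaka_group"
  shows "\<eta> (d * d', restrict_rep N (\<lambda>x. kron_mat (F x) (F' x))) =
    kron_mat (\<eta> (d, restrict_rep N F)) (\<eta> (d', restrict_rep N F'))"
  using tannaka_tensor[OF assms(4) alg_rep_rel_unipotent[OF assms(1,3)] alg_rep_rel_unipotent[OF assms(2,3)]]
    alg_rep_rel_unipotent[OF alg_rep_kron[OF assms(1,2)] assms(3)]
  unfolding restrict_rep_kron by simp

text \<open>Equivariance may be tested on the algebraic group, because the modular group acts on
  these objects through it.\<close>

lemma tannaka_intertwiner:
  assumes "alg_rep N d F" "alg_rep N d' F'" "N \<ge> 1" "\<eta> \<in> carrier tannaka_group" "T \<in> carrier_mat d' d"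
    and "\<And>g l. g \<in> carrier SL2 \<Longrightarrow> l \<in> carrier (SL2_mod N) \<Longrightarrow> T * F (g, l) = F' (g, l) * T"
  shows "map_mat of_rat T * \<eta> (d, restrict_rep N F) = \<eta> (d', restrict_rep N F') * map_mat of_rat T"
  by (rule tannaka_natural[OF assms(4) alg_rep_rel_unipotent[OF assms(1,3)]
        alg_rep_rel_unipotent[OF assms(2,3)] assms(5)])
     (use assms(6) in \<open>simp add: restrict_rep_def\<close>)

lemma sym_mat_0: "sym_mat 0 g = 1\<^sub>m 1"
  by (rule eq_matI) (auto simp: sym_mat_def)

text \<open>The alternating form on the plane, as a row vector on the tensor square: the indices 1
  and 2 encode the pairs (0, 1) and (1, 0). A matrix scales it by its determinant.\<close>

definition det_form :: "'k::field mat" where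
  "det_form = mat 1 (2 * 2) (\<lambda>(i, j). if j = 1 then 1 else if j = 2 then - 1 else 0)"

lemma det_form_kron:
  fixes A :: "'k::field mat"
  assumes "A \<in> carrier_mat 2 2"
  shows "det_form * kron_mat A A = det A \<cdot>\<^sub>m det_form"
proof -
  obtain a b c d where A: "A = mat2 a b c d" using assms by (rule carrier_mat2_cases)
  have D: "(det_form :: 'k mat) \<in> carrier_mat 1 (2 * 2)" by (simp add: det_form_def)
  show ?thesis
  proof (rule eq_matI)
    fix i j assume "i < dim_row (det A \<cdot>\<^sub>m det_form)" "j < dim_col (det A \<cdot>\<^sub>m det_form)"
    then have i: "i = 0" and j: "j < 2 * 2" by (auto simp: det_form_def)
    have "(det_form * kron_mat A A) $$ (i, j) = (\<Sum>k<2 * 2. det_form $$ (i, k) * kron_mat A A $$ (k, j))"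
      using i j by (intro mult_mat_index[OF D kron_mat_carrier[OF assms assms]]) auto
    also have "\<dots> = (\<Sum>k<2 * 2. det_form $$ (i, k) * (A $$ (k div 2, j div 2) * A $$ (k mod 2, j mod 2)))"
      using j by (intro sum.cong) (auto simp: kron_mat_index[OF assms assms])
    also have "\<dots> = A $$ (0, j div 2) * A $$ (1, j mod 2) - A $$ (1, j div 2) * A $$ (0, j mod 2)"
      using i by (simp add: det_form_def lessThan_nat_numeral lessThan_Suc)
    also have "\<dots> = (det A \<cdot>\<^sub>m det_form) $$ (i, j)"
    proof -
      have "j = 0 \<or> j = 1 \<or> j = 2 \<or> j = 3" using j by auto
      then show ?thesis using i by (elim disjE) (simp_all add: A det_form_def algebra_simps)
    qed
    finally show "(det_form * kron_mat A A) $$ (i, j) = (det A \<cdot>\<^sub>m det_form) $$ (i, j)" .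
  qed (use assms in \<open>auto simp: det_form_def kron_mat_def\<close>)
qed

section \<open>The action of tensor automorphisms at level N\<close>

locale level = K: enumerated_group "SL2_mod N" e q for N :: nat and e q +
  assumes N: "N \<ge> 1"
begin

abbreviation std_rep :: "nat \<times> (int mat \<Rightarrow> rat mat)" where
  "std_rep \<equiv> (2, restrict_rep N fst)"

abbreviation sym_rep :: "nat \<Rightarrow> nat \<times> (int mat \<Rightarrow> rat mat)" where
  "sym_rep k \<equiv> (Suc k, restrict_rep N (\<lambda>x. sym_mat k (fst x)))"

abbreviation reg_rep :: "nat \<times> (int mat \<Rightarrow> rat mat)" where
  "reg_rep \<equiv> (q, restrict_rep N (\<lambda>x. K.perm_mat (snd x)))"

text \<open>The representation W of the overview, given by one formula over every field of
  characteristic zero, so that its rational and complex versions can be compared entry by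
  entry.\<close>

definition sym_reg :: "nat \<Rightarrow> 'k::field_char_0 mat \<times> int mat \<Rightarrow> 'k mat" where
  "sym_reg k x = kron_mat (sym_mat k (fst x)) (K.perm_mat (snd x))"

lemma alg_sym: "alg_rep N (Suc k) (\<lambda>x. sym_mat k (fst x :: 'k::field_char_0 mat))"
  using alg_rep_sym[of N k] by (simp add: case_prod_unfold)

lemma alg_reg: "alg_rep N q (\<lambda>x. K.perm_mat (snd x))"
  using alg_rep_perm[OF K.enumerated_group_axioms] by (simp add: case_prod_unfold)

lemma alg_sym_reg: "alg_rep N (Suc k * q) (sym_reg k)"
  using alg_rep_kron[OF alg_sym alg_reg] by (simp add: sym_reg_def[abs_def])

lemmas std_rel = alg_rep_rel_unipotent[OF alg_rep_std N]
lemmas reg_rel = alg_rep_rel_unipotent[OF alg_reg N]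

context
  fixes \<eta> assumes \<eta>: "\<eta> \<in> carrier tannaka_group"
begin

text \<open>The alternating form is a map from the tensor square of the standard representation to
  the trivial one, on which \<eta> is 1; naturality gives determinant 1.\<close>

lemma tannaka_std: "\<eta> std_rep \<in> carrier SL2"
proof -
  let ?A = "\<eta> std_rep"
  have A: "?A \<in> carrier_mat 2 2" by (rule tannaka_carrier_mat[OF \<eta> std_rel])
  have "map_mat of_rat (det_form :: rat mat) * \<eta> (2 * 2, restrict_rep N (\<lambda>x. kron_mat (fst x) (fst x))) =
      \<eta> (1, restrict_rep N (\<lambda>_. 1\<^sub>m 1)) * map_mat of_rat det_form"
  proof (rule tannaka_intertwiner[OF alg_rep_kron[OF alg_rep_std alg_rep_std] alg_rep_trivial N \<eta>])
    fix g :: "rat mat" assume "g \<in> carrier SL2"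
    then show "det_form * kron_mat (fst (g, l)) (fst (g, l)) = 1\<^sub>m 1 * det_form" for l :: "int mat"
      using det_form_kron[of g] by (auto simp: SL2_carrier det_form_def)
  qed (simp add: det_form_def)
  moreover have "map_mat of_rat (det_form :: rat mat) = (det_form :: complex mat)"
    by (rule eq_matI) (auto simp: det_form_def)
  ultimately have "det ?A \<cdot>\<^sub>m det_form = 1\<^sub>m 1 * (det_form :: complex mat)"
    using tannaka_kron[OF alg_rep_std alg_rep_std N \<eta>] tannaka_unit[OF \<eta>] det_form_kron[OF A]
    by (simp add: restrict_rep_def[abs_def])
  then have "(det ?A \<cdot>\<^sub>m det_form) $$ (0, 1) = (1\<^sub>m 1 * (det_form :: complex mat)) $$ (0, 1)" by simp
  moreover have "1\<^sub>m 1 * (det_form :: complex mat) = det_form"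
    by (rule left_mult_one_mat) (auto simp: det_form_def)
  ultimately show ?thesis using A by (simp add: SL2_carrier det_form_def)
qed

text \<open>Naturality for the embedding of a symmetric power into the product of the standard
  representation with the previous power determines \<eta> there, since the embedding can be
  cancelled. The induction starts from the unit condition, the zeroth power being trivial.\<close>

lemma tannaka_sym: "\<eta> (sym_rep k) = sym_mat k (\<eta> std_rep)"
proof (induction k)
  case 0
  show ?case using tannaka_unit[OF \<eta>] by (simp add: restrict_rep_def[abs_def] sym_mat_0)
next
  case (Suc k)
  have A: "\<eta> std_rep \<in> carrier_mat 2 2" by (rule tannaka_carrier_mat[OF \<eta> std_rel])
  have embed: "map_mat of_rat (sym_embed k :: rat mat) = (sym_embed k :: complex mat)"
    by (rule eq_matI) (auto simp: sym_embed_def)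
  have "map_mat of_rat (sym_embed k :: rat mat) * \<eta> (sym_rep (Suc k)) =
      \<eta> (2 * Suc k, restrict_rep N (\<lambda>x. kron_mat (fst x) (sym_mat k (fst x)))) * map_mat of_rat (sym_embed k)"
    by (rule tannaka_intertwiner[OF alg_sym alg_rep_kron[OF alg_rep_std alg_sym] N \<eta> sym_embed_carrier])
       (auto simp: SL2_carrier sym_embed_equivariant)
  then have "sym_embed k * \<eta> (sym_rep (Suc k)) = kron_mat (\<eta> std_rep) (sym_mat k (\<eta> std_rep)) * sym_embed k"
    using tannaka_kron[OF alg_rep_std alg_sym N \<eta>] Suc.IH embed by simp
  then have "sym_embed k * \<eta> (sym_rep (Suc k)) = sym_embed k * sym_mat (Suc k) (\<eta> std_rep)"
    using sym_embed_equivariant[OF A] by simp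
  moreover have "\<eta> (sym_rep (Suc k)) \<in> carrier_mat (Suc (Suc k)) (Suc (Suc k))"
    by (rule tannaka_carrier_mat[OF \<eta> alg_rep_rel_unipotent[OF alg_sym N]])
  ultimately show ?case by (intro sym_embed_cancel[OF _ sym_mat_carrier]) auto
qed

text \<open>Pointwise multiplication and right translations are maps in the category, so naturality
  with respect to them supplies both conditions of \<open>perm_matI\<close>.\<close>

lemma tannaka_reg: "\<exists>l\<in>carrier (SL2_mod N). \<eta> reg_rep = K.perm_mat l"
proof (rule K.perm_matI)
  show "\<eta> reg_rep \<in> carrier (GL q)" by (rule tannaka_GL[OF \<eta> reg_rel])
next
  have "map_mat of_rat (K.diag_mult :: rat mat) = (K.diag_mult :: complex mat)"
    by (rule eq_matI) (auto simp: K.diag_mult_def)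
  moreover have "map_mat of_rat (K.diag_mult :: rat mat) *
      \<eta> (q * q, restrict_rep N (\<lambda>x. kron_mat (K.perm_mat (snd x)) (K.perm_mat (snd x)))) =
      \<eta> reg_rep * map_mat of_rat K.diag_mult"
    by (rule tannaka_intertwiner[OF alg_rep_kron[OF alg_reg alg_reg] alg_reg N \<eta>])
       (auto simp: K.diag_mult_perm_mat)
  ultimately show "K.diag_mult * kron_mat (\<eta> reg_rep) (\<eta> reg_rep) = \<eta> reg_rep * K.diag_mult"
    using tannaka_kron[OF alg_reg alg_reg N \<eta>] by simp
next
  fix x assume x: "x \<in> carrier (SL2_mod N)"
  have "map_mat of_rat (K.right_mat x :: rat mat) = (K.right_mat x :: complex mat)"
    by (rule eq_matI) (auto simp: K.right_mat_def)
  moreover have "map_mat of_rat (K.right_mat x :: rat mat) * \<eta> reg_rep = \<eta> reg_rep * map_mat of_rat (K.right_mat x)"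
    by (rule tannaka_intertwiner[OF alg_reg alg_reg N \<eta>]) (auto simp: K.right_mat_perm_mat x)
  ultimately show "K.right_mat x * \<eta> reg_rep = \<eta> reg_rep * K.right_mat x" by simp
qed

end

text \<open>The projection from the complex points of the relative completion to the algebraic group
  at level N. The choice is harmless, since \<open>perm_mat\<close> is injective on the finite
  group.\<close>

definition point :: "fiber_aut \<Rightarrow> complex mat \<times> int mat" where
  "point \<eta> = (\<eta> std_rep, SOME l. l \<in> carrier (SL2_mod N) \<and> \<eta> reg_rep = K.perm_mat l)"

lemma point:
  assumes "\<eta> \<in> carrier tannaka_group"
  shows "fst (point \<eta>) = \<eta> std_rep" "snd (point \<eta>) \<in> carrier (SL2_mod N)"
    "\<eta> reg_rep = K.perm_mat (snd (point \<eta>))" "point \<eta> \<in> carrier (SL2 \<times>\<times> SL2_mod N)"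
proof -
  have "\<exists>l. l \<in> carrier (SL2_mod N) \<and> \<eta> reg_rep = K.perm_mat l" using tannaka_reg[OF assms] by blast
  from someI_ex[OF this] show 1: "fst (point \<eta>) = \<eta> std_rep" "snd (point \<eta>) \<in> carrier (SL2_mod N)"
    "\<eta> reg_rep = K.perm_mat (snd (point \<eta>))" by (simp_all add: point_def)
  then show "point \<eta> \<in> carrier (SL2 \<times>\<times> SL2_mod N)"
    using tannaka_std[OF assms] by (cases "point \<eta>") simp
qed

lemma point_hom: "point \<in> hom tannaka_group (SL2 \<times>\<times> SL2_mod N)"
proof (rule homI)
  interpret T: group tannaka_group by (rule tannaka_group_group)
  fix \<eta> \<theta> assume \<eta>: "\<eta> \<in> carrier tannaka_group" and \<theta>: "\<theta> \<in> carrier tannaka_group"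
  let ?m = "\<eta> \<otimes>\<^bsub>tannaka_group\<^esub> \<theta>"
  have m: "?m \<in> carrier tannaka_group" using \<eta> \<theta> by simp
  have "?m reg_rep = K.perm_mat (snd (point \<eta>)) * K.perm_mat (snd (point \<theta>))"
    using reg_rel point(3)[OF \<eta>] point(3)[OF \<theta>] by (simp add: tannaka_group_mult)
  then have "K.perm_mat (snd (point ?m)) =
      (K.perm_mat (snd (point \<eta>) \<otimes>\<^bsub>SL2_mod N\<^esub> snd (point \<theta>)) :: complex mat)"
    unfolding K.perm_mat_mult[OF point(2)[OF \<eta>] point(2)[OF \<theta>]] using point(3)[OF m] by simp
  then have "snd (point ?m) = snd (point \<eta>) \<otimes>\<^bsub>SL2_mod N\<^esub> snd (point \<theta>)"
    using K.perm_mat_inject point(2) \<eta> \<theta> m by (metis K.m_closed)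
  moreover have "fst (point ?m) = fst (point \<eta>) \<otimes>\<^bsub>SL2\<^esub> fst (point \<theta>)"
    unfolding point(1)[OF m] point(1)[OF \<eta>] point(1)[OF \<theta>]
    using std_rel by (simp add: tannaka_group_mult)
  ultimately show "point ?m = point \<eta> \<otimes>\<^bsub>SL2 \<times>\<times> SL2_mod N\<^esub> point \<theta>"
    by (cases "point ?m"; cases "point \<eta>"; cases "point \<theta>") simp
qed (rule point(4))

lemma tannaka_sym_reg:
  assumes "\<eta> \<in> carrier tannaka_group"
  shows "\<eta> (Suc k * q, restrict_rep N (sym_reg k)) = sym_reg k (point \<eta>)"
  using tannaka_kron[OF alg_sym alg_reg N assms, of k] tannaka_sym[OF assms, of k] point(1,3)[OF assms]
  by (simp add: sym_reg_def[abs_def] sym_reg_def)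

text \<open>On the extension, \<eta> has W at \<open>point \<eta>\<close> and 1 as its diagonal
  blocks (\<open>block\<close>, \<open>corner\<close>). Multiplying two such matrices shows that the
  last column is a cocycle on the complex points; at the modular group it is c. Paired with
  \<open>P\<close> at \<open>point \<eta>\<close> it falls under
  \<open>class_function_cocycle\<close>.\<close>

lemma period_class_element:
  fixes c :: "int mat \<Rightarrow> nat \<Rightarrow> rat" and P :: "nat \<Rightarrow> complex mat \<times> int mat \<Rightarrow> complex"
  defines "D k \<equiv> Suc k * q"
  assumes cocycle: "\<And>\<alpha> \<beta> i. \<alpha> \<in> carrier SL2_Z \<Longrightarrow> \<beta> \<in> carrier SL2_Z \<Longrightarrow> i < D k \<Longrightarrow>
      c (\<alpha> * \<beta>) i = c \<alpha> i + (\<Sum>j<D k. restrict_rep N (sym_reg k) \<alpha> $$ (i, j) * c \<beta> j)"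
    and regular: "\<And>i l. i < D k \<Longrightarrow> l \<in> carrier (SL2_mod N) \<Longrightarrow> (\<lambda>h. P i (h, l)) \<in> rat_regular_SL2"
    and equivariant: "\<And>g h i. g \<in> carrier (SL2 \<times>\<times> SL2_mod N) \<Longrightarrow> h \<in> carrier (SL2 \<times>\<times> SL2_mod N) \<Longrightarrow> i < D k \<Longrightarrow>
      (\<Sum>j<D k. sym_reg k g $$ (j, i) * P j h) =
      P i (inv\<^bsub>SL2 \<times>\<times> SL2_mod N\<^esub> g \<otimes>\<^bsub>SL2 \<times>\<times> SL2_mod N\<^esub> h \<otimes>\<^bsub>SL2 \<times>\<times> SL2_mod N\<^esub> g)"
  shows "\<exists>\<Psi>\<in>Cl. \<forall>\<alpha>\<in>carrier SL2_Z.
    \<Psi> (canonical_hom \<alpha>) = (\<Sum>i<D k. of_rat (c \<alpha> i) * P i (map_mat of_int \<alpha>, reduce N \<alpha>))"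
proof -
  define n where "n = D k"
  define W where "W = (n, restrict_rep N (sym_reg k :: rat mat \<times> int mat \<Rightarrow> rat mat))"
  define E where "E = (Suc n, \<lambda>\<gamma>. ext_mat n (restrict_rep N (sym_reg k) \<gamma>) (c \<gamma>))"
  define x0 where "x0 = K.idx (reduce N (1\<^sub>m 2))"
  have alg: "alg_rep N n (sym_reg k :: rat mat \<times> int mat \<Rightarrow> rat mat)"
    unfolding n_def D_def by (rule alg_sym_reg)
  have W: "W \<in> rel_unipotent_reps" unfolding W_def by (rule alg_rep_rel_unipotent[OF alg N])
  have E: "E \<in> rel_unipotent_reps"
    unfolding E_def by (rule extension_rel_unipotent[OF alg N]) (use cocycle in \<open>simp add: n_def\<close>)
  have x0: "x0 < q" "e x0 = reduce N (1\<^sub>m 2)"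
    unfolding x0_def using K.idx[of "reduce N (1\<^sub>m 2)"] K.one_closed by simp_all
  \<comment> \<open>The dependence on the finite component has to be a polynomial in matrix entries:
    the column of the identity in \<open>perm_mat l\<close> is the indicator of l, so the sum over x
    selects the value of \<open>P i\<close> at l.\<close>
  define \<Psi> where "\<Psi> = (\<lambda>\<eta>. \<Sum>i<n. \<eta> E $$ (i, n) * (\<Sum>x<q. \<eta> reg_rep $$ (x, x0) * P i (\<eta> std_rep, e x)))"
  have ring: "\<Psi> \<in> tannaka_ring"
    unfolding \<Psi>_def
  proof (intro tannaka_ring_sum tannaka_ring.mult)
    fix i assume "i \<in> {..<n}"
    then show "(\<lambda>\<eta>. \<eta> E $$ (i, n)) \<in> tannaka_ring"
      using E unfolding E_def by (intro tannaka_ring.entry) auto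
    fix x assume "x \<in> {..<q}"
    then show "(\<lambda>\<eta>. \<eta> reg_rep $$ (x, x0)) \<in> tannaka_ring"
      using x0 by (intro tannaka_ring.entry reg_rel) auto
    show "(\<lambda>\<eta>. P i (\<eta> std_rep, e x)) \<in> tannaka_ring"
      using \<open>i \<in> {..<n}\<close> \<open>x \<in> {..<q}\<close>
      by (intro tannaka_ring_rat_regular[OF std_rel, of "\<lambda>h. P i (h, e x)"] regular) (auto simp: n_def)
  qed
  have select: "(\<Sum>x<q. K.perm_mat l $$ (x, x0) * P i (h, e x)) = P i (h, l)"
    if "l \<in> carrier (SL2_mod N)" for l h i
    using K.perm_mat_sum[OF that x0(1), of "\<lambda>y. P i (h, y)"] K.r_one[OF that] by (simp add: x0(2))
  \<comment> \<open>Naturality for the map from the extension to its trivial quotient.\<close>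
  have corner: "\<eta> E $$ (n, n) = 1" if "\<eta> \<in> carrier tannaka_group" for \<eta>
  proof -
    define L where "L = mat 1 (Suc n) (\<lambda>(i, j). if j = n then 1 else (0 :: rat))"
    have "map_mat of_rat L * \<eta> E = \<eta> (1, \<lambda>_. 1\<^sub>m 1) * map_mat of_rat L"
      unfolding E_def
    proof (rule tannaka_natural[OF that E[unfolded E_def] trivial_rel_unipotent])
      fix \<gamma>
      show "L * ext_mat n (restrict_rep N (sym_reg k) \<gamma>) (c \<gamma>) = 1\<^sub>m 1 * L"
        by (rule eq_matI)
           (auto simp: L_def ext_mat_def mult_mat_index[of _ 1 "Suc n" _ "Suc n"] mult_mat_index[of _ 1 1 _ "Suc n"]
             simp del: index_mult_mat(1))
    qed (simp add: L_def)
    then have "(map_mat of_rat L * \<eta> E) $$ (0, n) = (1\<^sub>m 1 * map_mat of_rat L) $$ (0, n)"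
      using tannaka_unit[OF that] by simp
    moreover have "\<eta> E \<in> carrier_mat (Suc n) (Suc n)"
      using tannaka_carrier_mat[OF that E[unfolded E_def]] by (simp add: E_def)
    ultimately show ?thesis
      by (simp add: L_def mult_mat_index[of _ 1 "Suc n" _ "Suc n"] mult_mat_index[of _ 1 1 _ "Suc n"]
             del: index_mult_mat(1))
  qed
  \<comment> \<open>Naturality for the inclusion of W into the extension.\<close>
  have block: "\<eta> E $$ (i, j) = sym_reg k (point \<eta>) $$ (i, j)"
    if \<eta>: "\<eta> \<in> carrier tannaka_group" and ij: "i < n" "j < n" for \<eta> i j
  proof -
    define J where "J = mat (Suc n) n (\<lambda>(i, j). if i = j then 1 else (0 :: rat))"
    have "map_mat of_rat J * \<eta> W = \<eta> E * map_mat of_rat J"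
      unfolding E_def W_def
    proof (rule tannaka_natural[OF \<eta> W[unfolded W_def] E[unfolded E_def]])
      fix \<gamma> assume "\<gamma> \<in> carrier SL2_Z"
      then have c: "(restrict_rep N (sym_reg k) \<gamma> :: rat mat) \<in> carrier_mat n n"
        by (simp add: restrict_rep_def alg_rep_carrier[OF alg])
      show "J * restrict_rep N (sym_reg k) \<gamma> = ext_mat n (restrict_rep N (sym_reg k) \<gamma>) (c \<gamma>) * J"
        using c by (intro eq_matI)
           (auto simp: J_def ext_mat_def mult_mat_index[of _ "Suc n" "Suc n" _ n] mult_mat_index[of _ "Suc n" n _ n]
             if_distrib[of "\<lambda>x. x * _"] if_distrib[of "\<lambda>x. _ * x"]
             simp del: index_mult_mat(1) cong: if_cong)
    qed (simp add: J_def)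
    then have "(map_mat of_rat J * \<eta> W) $$ (i, j) = (\<eta> E * map_mat of_rat J) $$ (i, j)" by simp
    moreover have "\<eta> E \<in> carrier_mat (Suc n) (Suc n)" "\<eta> W \<in> carrier_mat n n"
      using tannaka_carrier_mat[OF \<eta> E[unfolded E_def]] tannaka_carrier_mat[OF \<eta> W[unfolded W_def]]
      by (simp_all add: E_def W_def)
    ultimately have "\<eta> E $$ (i, j) = \<eta> W $$ (i, j)"
      using ij by (simp add: J_def mult_mat_index[of _ "Suc n" "Suc n" _ n] mult_mat_index[of _ "Suc n" n _ n]
             if_distrib[of "\<lambda>x. x * _"] if_distrib[of "\<lambda>x. _ * x"] if_distrib[of of_rat]
             del: index_mult_mat(1) cong: if_cong)
    also have "\<eta> W = sym_reg k (point \<eta>)"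
      unfolding W_def n_def D_def by (rule tannaka_sym_reg[OF \<eta>])
    finally show ?thesis .
  qed
  have "class_function tannaka_group (\<lambda>\<eta>. \<Sum>i<n. \<eta> E $$ (i, n) * P i (point \<eta>))"
  proof (rule class_function_cocycle[OF tannaka_group_group, where A = "\<lambda>\<eta> i j. sym_reg k (point \<eta>) $$ (i, j)"])
    fix \<eta> \<theta> i assume *: "\<eta> \<in> carrier tannaka_group" "\<theta> \<in> carrier tannaka_group" "i < n"
    have carr: "\<eta> E \<in> carrier_mat (Suc n) (Suc n)" "\<theta> E \<in> carrier_mat (Suc n) (Suc n)"
      using tannaka_carrier_mat[OF *(1) E[unfolded E_def]] tannaka_carrier_mat[OF *(2) E[unfolded E_def]]
      by (simp_all add: E_def)
    \<comment> \<open>The term j = n becomes the first summand of the cocycle relation, as the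
      corner entry of \<theta> is 1.\<close>
    have "(\<eta> E * \<theta> E) $$ (i, n) = (\<Sum>j<Suc n. \<eta> E $$ (i, j) * \<theta> E $$ (j, n))"
      using * by (intro mult_mat_index[OF carr]) auto
    then show "(\<eta> \<otimes>\<^bsub>tannaka_group\<^esub> \<theta>) E $$ (i, n) =
        \<eta> E $$ (i, n) + (\<Sum>j<n. sym_reg k (point \<eta>) $$ (i, j) * \<theta> E $$ (j, n))"
      using E * by (simp add: tannaka_group_mult corner block)
  next
    fix \<eta> \<theta> i assume *: "\<eta> \<in> carrier tannaka_group" "\<theta> \<in> carrier tannaka_group" "i < n"
    interpret p: group_hom tannaka_group "SL2 \<times>\<times> SL2_mod N" point
      by (intro group_hom.intro group_hom_axioms.intro tannaka_group_group SL2_prod_group point_hom)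
    show "(\<Sum>j<n. sym_reg k (point \<eta>) $$ (j, i) * P j (point \<theta>)) =
        P i (point (inv\<^bsub>tannaka_group\<^esub> \<eta> \<otimes>\<^bsub>tannaka_group\<^esub> \<theta> \<otimes>\<^bsub>tannaka_group\<^esub> \<eta>))"
      using equivariant[OF point(4)[OF *(1)] point(4)[OF *(2)]] * unfolding n_def by simp
  qed
  then have "class_function tannaka_group \<Psi>"
  proof (rule class_function_cong[OF tannaka_group_group, rotated])
    fix \<eta> assume "\<eta> \<in> carrier tannaka_group"
    from point[OF this] show "\<Psi> \<eta> = (\<Sum>i<n. \<eta> E $$ (i, n) * P i (point \<eta>))"
      unfolding \<Psi>_def by (simp add: select flip: surjective_pairing point(1)[OF \<open>\<eta> \<in> carrier tannaka_group\<close>])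
  qed
  moreover have "\<Psi> (canonical_hom \<alpha>) = (\<Sum>i<n. of_rat (c \<alpha> i) * P i (map_mat of_int \<alpha>, reduce N \<alpha>))"
    if \<alpha>: "\<alpha> \<in> carrier SL2_Z" for \<alpha>
  proof -
    have "canonical_hom \<alpha> E $$ (i, n) = of_rat (c \<alpha> i)" if "i < n" for i
      using E that by (simp add: canonical_hom_def E_def ext_mat_def)
    moreover have "canonical_hom \<alpha> reg_rep $$ (x, x0) = K.perm_mat (reduce N \<alpha>) $$ (x, x0)" if "x < q" for x
      using reg_rel that x0(1) by (simp add: canonical_hom_def restrict_rep_def K.perm_mat_def)
    moreover have "canonical_hom \<alpha> std_rep = map_mat of_int \<alpha>"
      using std_rel by (simp add: canonical_hom_def restrict_rep_def map_mat_of_rat_of_int)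
    ultimately show ?thesis
      unfolding \<Psi>_def using select[OF reduce_SL2_Z[OF \<alpha>]] by simp
  qed
  ultimately show ?thesis using ring unfolding Cl_def n_def by blast
qed

end

section \<open>Descent of the coefficients to the rational numbers\<close>

lemma regular_SL2_uminus: "p \<in> regular_SL2 \<Longrightarrow> (\<lambda>A. - p A) \<in> regular_SL2"
  using regular_SL2_cmult[of p "- 1"] by simp

text \<open>Conjugation by the adjugate is given by polynomials in the entries of both matrices, without
  any condition on their dimension or determinant.\<close>

definition conj_mat2 :: "'a::comm_ring_1 mat \<Rightarrow> 'a mat \<Rightarrow> 'a mat" where
  "conj_mat2 g h = mat2 (g $$ (1, 1)) (- g $$ (0, 1)) (- g $$ (1, 0)) (g $$ (0, 0)) *
     mat2 (h $$ (0, 0)) (h $$ (0, 1)) (h $$ (1, 0)) (h $$ (1, 1)) *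
     mat2 (g $$ (0, 0)) (g $$ (0, 1)) (g $$ (1, 0)) (g $$ (1, 1))"

lemma conj_mat2_SL2:
  assumes "g \<in> carrier SL2" "h \<in> carrier SL2"
  shows "inv\<^bsub>SL2\<^esub> g * h * g = conj_mat2 g h"
proof -
  obtain a b c d where g: "g = mat2 a b c d" "a * d - b * c = 1" using assms(1) by (rule SL2_cases)
  obtain a' b' c' d' where h: "h = mat2 a' b' c' d'" using assms(2) by (rule SL2_cases)
  show ?thesis by (simp add: g(1) h conj_mat2_def SL2_inv[OF g(2)])
qed

lemma conj_prod:
  assumes "g \<in> carrier SL2" "h \<in> carrier SL2" "\<kappa> \<in> carrier (SL2_mod N)" "l \<in> carrier (SL2_mod N)"
  shows "inv\<^bsub>SL2 \<times>\<times> SL2_mod N\<^esub> (g, \<kappa>) \<otimes>\<^bsub>SL2 \<times>\<times> SL2_mod N\<^esub> (h, l) \<otimes>\<^bsub>SL2 \<times>\<times> SL2_mod N\<^esub> (g, \<kappa>) =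
    (conj_mat2 g h, inv\<^bsub>SL2_mod N\<^esub> \<kappa> \<otimes>\<^bsub>SL2_mod N\<^esub> l \<otimes>\<^bsub>SL2_mod N\<^esub> \<kappa>)"
  using assms conj_mat2_SL2[OF assms(1,2)] by (simp add: inv_DirProd)

lemma conj_mat2_of_rat:
  "conj_mat2 (map_mat of_rat g) (map_mat of_rat h) = (map_mat of_rat (conj_mat2 g h) :: complex mat)"
  if "g \<in> carrier_mat 2 2" "h \<in> carrier_mat 2 2"
  using that by (simp add: conj_mat2_def of_rat_add of_rat_mult of_rat_minus of_rat_diff)

text \<open>Regularity in each variable separately is the form in which density can be applied first
  to one argument of the conjugation and then to the other.\<close>

lemma regular_SL2_conj_mat2:
  assumes "p \<in> regular_SL2"
  shows "(\<lambda>h. p (conj_mat2 g h)) \<in> regular_SL2" "(\<lambda>g. p (conj_mat2 g h)) \<in> regular_SL2"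
proof -
  show "(\<lambda>h. p (conj_mat2 g h)) \<in> regular_SL2" "(\<lambda>g. p (conj_mat2 g h)) \<in> regular_SL2"
    unfolding conj_mat2_def mat2_mult
    by (rule regular_SL2_mat2[OF assms]; intro regular_SL2.intros regular_SL2_uminus; simp)+
qed

text \<open>Carries linear relations with rational coefficients from complex numbers to their
  coordinates.\<close>

lemma coordinate_sum:
  fixes r :: "complex \<Rightarrow> rat"
  assumes "\<And>x y. r (x + y) = r x + r y" "\<And>s x. r (of_rat s * x) = s * r x"
  shows "r (\<Sum>j\<in>J. of_rat (s j) * x j) = (\<Sum>j\<in>J. s j * r (x j))"
proof -
  have "r 0 = 0" using assms(2)[of 0 0] by simp
  then show ?thesis
    by (induction J rule: infinite_finite_induct) (simp_all add: assms)
qed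

context level
begin

lemma sym_reg_index:
  "i < Suc k * q \<Longrightarrow> j < Suc k * q \<Longrightarrow>
   sym_reg k x $$ (i, j) = sym_mat k (fst x) $$ (i div q, j div q) * K.perm_mat (snd x) $$ (i mod q, j mod q)"
  unfolding sym_reg_def by (rule kron_mat_index[OF sym_mat_carrier K.perm_mat_carrier])

lemma sym_reg_of_rat:
  assumes "g \<in> carrier_mat 2 2" "i < Suc k * q" "j < Suc k * q"
  shows "sym_reg k (map_mat of_rat g, l) $$ (i, j) = (of_rat (sym_reg k (g, l) $$ (i, j)) :: complex)"
proof -
  note ij = div_mod_less[OF assms(2)] div_mod_less[OF assms(3)]
  have "sym_mat k (map_mat of_rat g) $$ (i div q, j div q) = (of_rat (sym_mat k g $$ (i div q, j div q)) :: complex)"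
    using ij by (simp flip: map_mat_of_rat_sym_mat[OF assms(1)])
  moreover have "K.perm_mat l $$ (i mod q, j mod q) = (of_rat (K.perm_mat l $$ (i mod q, j mod q)) :: complex)"
    using ij by (simp add: K.perm_mat_def)
  ultimately show ?thesis
    by (simp add: sym_reg_index[OF assms(2,3)] of_rat_mult)
qed

lemma restrict_sym_reg_of_rat:
  assumes "\<gamma> \<in> carrier SL2_Z" "i < Suc k * q" "j < Suc k * q"
  shows "(restrict_rep N (sym_reg k) \<gamma> $$ (i, j) :: complex) = of_rat (restrict_rep N (sym_reg k) \<gamma> $$ (i, j))"
  using sym_reg_of_rat[of "map_mat of_int \<gamma>" i k j "reduce N \<gamma>"] assms
  by (simp add: restrict_rep_def map_mat_of_rat_of_int SL2_carrier del: mult_Suc)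

lemma regular_sym_reg:
  assumes "i < Suc k * q" "j < Suc k * q"
  shows "(\<lambda>g. sym_reg k (g, l) $$ (i, j)) \<in> regular_SL2"
  unfolding sym_reg_index[OF assms] fst_conv snd_conv
  by (intro regular_SL2.mult regular_SL2_sym_mat regular_SL2.const div_mod_less[OF assms(1)] div_mod_less[OF assms(2)])

text \<open>With C the sum of b c_b and P the sum of b' R_b' over finitely many basis elements, each
  pair of c_b and R_b' satisfies the hypotheses of \<open>period_class_element\<close>. The
  resulting class functions are combined with the coefficients b b'.\<close>

lemma period_Cl_C:
  fixes C :: "int mat \<Rightarrow> nat \<Rightarrow> complex" and P :: "nat \<Rightarrow> complex mat \<times> int mat \<Rightarrow> complex"
  assumes cocycle: "\<And>\<alpha> \<beta> i. \<alpha> \<in> carrier SL2_Z \<Longrightarrow> \<beta> \<in> carrier SL2_Z \<Longrightarrow> i < Suc k * q \<Longrightarrow>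
      C (\<alpha> * \<beta>) i = C \<alpha> i + (\<Sum>j<Suc k * q. restrict_rep N (sym_reg k) \<alpha> $$ (i, j) * C \<beta> j)"
    and regular: "\<And>i. i < Suc k * q \<Longrightarrow> P i \<in> regular_SL2_prod N"
    and equivariant: "\<And>g h i. g \<in> carrier (SL2 \<times>\<times> SL2_mod N) \<Longrightarrow> h \<in> carrier (SL2 \<times>\<times> SL2_mod N) \<Longrightarrow> i < Suc k * q \<Longrightarrow>
      (\<Sum>j<Suc k * q. sym_reg k g $$ (j, i) * P j h) =
      P i (inv\<^bsub>SL2 \<times>\<times> SL2_mod N\<^esub> g \<otimes>\<^bsub>SL2 \<times>\<times> SL2_mod N\<^esub> h \<otimes>\<^bsub>SL2 \<times>\<times> SL2_mod N\<^esub> g)"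
  shows "\<exists>\<Phi>\<in>Cl_C. \<forall>\<alpha>\<in>carrier SL2_Z.
    (\<Sum>i<Suc k * q. C \<alpha> i * P i (map_mat of_int \<alpha>, reduce N \<alpha>)) = \<Phi> (canonical_hom \<alpha>)"
proof -
  define D where "D = Suc k * q"
  obtain r :: "complex \<Rightarrow> complex \<Rightarrow> rat" where r_add: "\<And>b x y. r b (x + y) = r b x + r b y"
    and r_scale: "\<And>b s x. r b (of_rat s * x) = s * r b x"
    and r_finite: "\<And>x. finite {b. r b x \<noteq> 0}"
    and r_sum: "\<And>x. (\<Sum>b | r b x \<noteq> 0. b * of_rat (r b x)) = x"
    by (rule complex_rat_coordinates, rule that; assumption)
  have expand: "(\<Sum>b\<in>B. b * of_rat (r b x)) = x" if "finite B" "{b. r b x \<noteq> 0} \<subseteq> B" for B x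
    using sum.mono_neutral_left[OF that, of "\<lambda>b. b * of_rat (r b x)"] r_sum[of x] by auto
  define A where "A \<gamma> i j = (restrict_rep N (sym_reg k) \<gamma> $$ (i, j) :: rat)" for \<gamma> i j
  define c where "c b \<gamma> i = r b (C \<gamma> i)" for b \<gamma> i
  have c_cocycle: "c b (\<alpha> * \<beta>) i = c b \<alpha> i + (\<Sum>j<D. A \<alpha> i j * c b \<beta> j)"
    if "\<alpha> \<in> carrier SL2_Z" "\<beta> \<in> carrier SL2_Z" "i < D" for b \<alpha> \<beta> i
  proof -
    have "C (\<alpha> * \<beta>) i = C \<alpha> i + (\<Sum>j<D. of_rat (A \<alpha> i j) * C \<beta> j)"
      using cocycle[OF that(1,2)] that unfolding D_def A_def
      by (simp add: restrict_sym_reg_of_rat del: mult_Suc)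
    then show ?thesis
      unfolding c_def by (simp add: r_add coordinate_sum[of "r b", OF r_add r_scale])
  qed
  \<comment> \<open>The basis elements that occur in the values at the two generators. For any other
    one the coordinate cocycle vanishes on the generators, hence everywhere.\<close>
  define BC where "BC = (\<Union>i<D. {b. r b (C (mat2 1 1 0 1) i) \<noteq> 0} \<union> {b. r b (C (mat2 0 (-1) 1 0) i) \<noteq> 0})"
  have BC: "finite BC" unfolding BC_def using r_finite by blast
  have c_zero: "\<forall>i<D. c b \<gamma> i = 0" if b: "b \<notin> BC" and \<gamma>: "\<gamma> \<in> carrier SL2_Z" for b \<gamma>
    using \<gamma>
  proof (induction rule: SL2_Z_induct)
    case T
    then show ?case using b by (auto simp: BC_def c_def)
  next
    case S
    then show ?case using b by (auto simp: BC_def c_def)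
  next
    case (mult \<alpha> \<beta>)
    then show ?case by (simp add: c_cocycle)
  next
    case (inv \<alpha>)
    interpret Z: group SL2_Z by simp
    have i: "inv\<^bsub>SL2\<^esub> \<alpha> \<in> carrier SL2_Z" "inv\<^bsub>SL2\<^esub> \<alpha> * \<alpha> = 1\<^sub>m 2" "1\<^sub>m 2 * \<alpha> = \<alpha>" "1\<^sub>m 2 \<in> carrier SL2_Z"
      using inv(1) Z.inv_closed Z.l_inv[of \<alpha>] Z.l_one[of \<alpha>] Z.one_closed by simp_all
    show ?case
    proof (intro allI impI)
      fix m assume m: "m < D"
      have "c b (1\<^sub>m 2) m = 0"
        using c_cocycle[OF i(4) inv(1) m, of b] inv(2) m by (simp add: i(3))
      then show "c b (inv\<^bsub>SL2\<^esub> \<alpha>) m = 0"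
        using c_cocycle[OF i(1) inv(1) m, of b] inv(2) m by (simp add: i(2))
    qed
  qed
  have C_expand: "C \<gamma> i = (\<Sum>b\<in>BC. b * of_rat (c b \<gamma> i))" if "\<gamma> \<in> carrier SL2_Z" "i < D" for \<gamma> i
    unfolding c_def by (rule expand[symmetric]) (use BC c_zero that in \<open>auto simp: c_def\<close>)
  let ?K = "carrier (SL2_mod N)"
  have "\<exists>m co qq. \<forall>i l. i < D \<and> l \<in> ?K \<longrightarrow> (\<forall>j<m i l :: nat. qq i l j \<in> rat_regular_SL2) \<and>
      (\<forall>h\<in>carrier SL2. P i (h, l) = (\<Sum>j<m i l. co i l j * qq i l j h))"
  proof -
    have "\<exists>m co qq. i < D \<and> l \<in> ?K \<longrightarrow> (\<forall>j<m :: nat. qq j \<in> rat_regular_SL2) \<and>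
      (\<forall>h\<in>carrier SL2. P i (h, l) = (\<Sum>j<m. co j * qq j h))" for i l
    proof (cases "i < D \<and> l \<in> ?K")
      case True
      then obtain p where "p \<in> regular_SL2" "\<forall>h\<in>carrier SL2. P i (h, l) = p h"
        using regular[of i] unfolding D_def regular_SL2_prod_def by blast
      then show ?thesis using regular_SL2_rat_decomposition[of p] by metis
    qed blast
    then show ?thesis by metis
  qed
  then obtain m co qq where dec: "\<forall>i l. i < D \<and> l \<in> ?K \<longrightarrow> (\<forall>j<m i l :: nat. qq i l j \<in> rat_regular_SL2) \<and>
      (\<forall>h\<in>carrier SL2. P i (h, l) = (\<Sum>j<m i l. co i l j * qq i l j h))" by (elim exE)
  have qq: "qq i l j \<in> rat_regular_SL2" if "i < D" "l \<in> ?K" "j < m i l" for i l j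
    using dec that by simp
  have P_eq: "P i (h, l) = (\<Sum>j<m i l. co i l j * qq i l j h)" if "i < D" "l \<in> ?K" "h \<in> carrier SL2" for i l h
    using dec that by simp
  \<comment> \<open>A decomposition of \<open>P i\<close> into rational regular functions is not
    unique; the coordinates are taken of the coefficients in one fixed decomposition.\<close>
  define R where "R b i x = (\<Sum>j<m i (snd x). of_rat (r b (co i (snd x) j)) * qq i (snd x) j (fst x))" for b i x
  have R_rat_regular: "(\<lambda>h. R b i (h, l)) \<in> rat_regular_SL2" if "i < D" "l \<in> ?K" for b i l
    unfolding R_def using qq that
    by (auto intro!: rat_regular_SL2_sum rat_mult rat_const)
  note R_regular = rat_regular_SL2_regular[OF R_rat_regular]
  define BP where "BP = (\<Union>i<D. \<Union>l\<in>?K. \<Union>j<m i l. {b. r b (co i l j) \<noteq> 0})"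
  have BP: "finite BP" unfolding BP_def using r_finite SL2_mod_finite[OF N] by blast
  have P_expand: "P i (h, l) = (\<Sum>b\<in>BP. b * R b i (h, l))" if "i < D" "l \<in> ?K" "h \<in> carrier SL2" for i h l
  proof -
    have "co i l j = (\<Sum>b\<in>BP. b * of_rat (r b (co i l j)))" if "j < m i l" for j
      by (rule expand[symmetric]) (use BP \<open>i < D\<close> \<open>l \<in> ?K\<close> that in \<open>auto simp: BP_def\<close>)
    then have "(\<Sum>j<m i l. co i l j * qq i l j h) =
        (\<Sum>j<m i l. (\<Sum>b\<in>BP. b * of_rat (r b (co i l j))) * qq i l j h)"
      by (intro sum.cong refl arg_cong2[of _ _ _ _ "(*)"]) simp
    also have "\<dots> = (\<Sum>b\<in>BP. b * R b i (h, l))"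
      unfolding R_def sum_distrib_right sum_distrib_left by (subst sum.swap) (simp add: mult.assoc)
    finally show ?thesis using P_eq[OF that] by simp
  qed
  \<comment> \<open>At rational points \<open>R\<close> is the coordinate of the value of
    \<open>P\<close>, whatever decomposition was chosen; this is how equivariance is transferred
    from \<open>P\<close> to \<open>R\<close>.\<close>
  have R_value: "R b i (map_mat of_rat h, l) = of_rat (r b (P i (map_mat of_rat h, l)))"
    if il: "i < D" "l \<in> ?K" "h \<in> carrier SL2" for b i h l
  proof -
    have "\<exists>y. j < m i l \<longrightarrow> qq i l j (map_mat of_rat h) = of_rat y" for j
    proof (cases "j < m i l")
      case True
      then obtain f where "\<forall>h\<in>carrier_mat 2 2. qq i l j (map_mat of_rat h) = of_rat (f h)"
        using rat_regular_SL2_value[OF qq[OF il(1,2)]] by metis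
      then show ?thesis using il(3) by (auto simp: SL2_carrier)
    qed simp
    then obtain f where f: "\<And>j. j < m i l \<Longrightarrow> qq i l j (map_mat of_rat h) = of_rat (f j)" by metis
    have "P i (map_mat of_rat h, l) = (\<Sum>j<m i l. of_rat (f j) * co i l j)"
      using P_eq[OF il(1,2), of "map_mat of_rat h"] il(3) f by (simp add: mult.commute)
    then have "r b (P i (map_mat of_rat h, l)) = (\<Sum>j<m i l. f j * r b (co i l j))"
      by (simp add: coordinate_sum[of "r b", OF r_add r_scale])
    then show ?thesis
      unfolding R_def using f by (simp add: of_rat_sum of_rat_mult mult.commute)
  qed
  have R_equivariant: "(\<Sum>j<D. sym_reg k (g, \<kappa>) $$ (j, i) * R b j (h, l)) =
      R b i (conj_mat2 g h, inv\<^bsub>SL2_mod N\<^esub> \<kappa> \<otimes>\<^bsub>SL2_mod N\<^esub> l \<otimes>\<^bsub>SL2_mod N\<^esub> \<kappa>)"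
    if gh: "g \<in> carrier SL2" "h \<in> carrier SL2" and \<kappa>l: "\<kappa> \<in> ?K" "l \<in> ?K" and i: "i < D" for b g h \<kappa> l i
  proof -
    let ?l = "inv\<^bsub>SL2_mod N\<^esub> \<kappa> \<otimes>\<^bsub>SL2_mod N\<^esub> l \<otimes>\<^bsub>SL2_mod N\<^esub> \<kappa>"
    have l': "?l \<in> ?K" using \<kappa>l by (intro K.m_closed K.inv_closed)
    \<comment> \<open>The defect of equivariance, a regular function of each of its two
      arguments.\<close>
    define \<delta> where "\<delta> g h = (\<Sum>j<D. sym_reg k (g, \<kappa>) $$ (j, i) * R b j (h, l)) - R b i (conj_mat2 g h, ?l)" for g h
    have \<delta>_h: "(\<lambda>h. \<delta> g h) \<in> regular_SL2" for g
      unfolding \<delta>_def using i \<kappa>l l'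
      by (intro regular_SL2_diff regular_SL2_sum regular_SL2_cmult R_regular
          regular_SL2_conj_mat2(1)[of "\<lambda>h. R b i (h, ?l)"]) auto
    have \<delta>_g: "(\<lambda>g. \<delta> g h) \<in> regular_SL2" for h
      unfolding \<delta>_def using i \<kappa>l l'
      by (intro regular_SL2_diff regular_SL2_sum regular_SL2.mult regular_SL2.const R_regular regular_sym_reg
          regular_SL2_conj_mat2(2)[of "\<lambda>h. R b i (h, ?l)"]) (auto simp: D_def)
    have rational: "\<delta> (map_mat of_rat g) (map_mat of_rat h) = 0"
      if g: "g \<in> carrier SL2" and h: "h \<in> carrier SL2" for g h
    proof -
      let ?g = "map_mat of_rat g :: complex mat" and ?h = "map_mat of_rat h :: complex mat"
      have gh: "?g \<in> carrier SL2" "?h \<in> carrier SL2" using g h by simp_all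
      have conj: "conj_mat2 ?g ?h = map_mat of_rat (conj_mat2 g h)"
        using g h by (intro conj_mat2_of_rat) (auto simp: SL2_carrier)
      have conj_SL2: "conj_mat2 g h \<in> carrier SL2"
        unfolding conj_mat2_SL2[OF g h, symmetric]
        using group.inv_closed[OF SL2_group g] monoid.m_closed[OF group.is_monoid[OF SL2_group]] g h
        by (metis SL2_simps(1))
      define a where "a j = sym_reg k (g, \<kappa>) $$ (j, i)" for j
      have "sym_reg k (?g, \<kappa>) $$ (j, i) = of_rat (a j)" if "j < D" for j
        using g i that unfolding a_def D_def by (intro sym_reg_of_rat) (auto simp: SL2_carrier)
      then have "(\<Sum>j<D. sym_reg k (?g, \<kappa>) $$ (j, i) * R b j (?h, l)) =
          of_rat (\<Sum>j<D. a j * r b (P j (?h, l)))"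
        by (simp add: of_rat_sum of_rat_mult R_value[OF _ \<kappa>l(2) h])
      also have "(\<Sum>j<D. a j * r b (P j (?h, l))) = r b (\<Sum>j<D. of_rat (a j) * P j (?h, l))"
        by (simp add: coordinate_sum[of "r b", OF r_add r_scale])
      also have "(\<Sum>j<D. of_rat (a j) * P j (?h, l)) = (\<Sum>j<D. sym_reg k (?g, \<kappa>) $$ (j, i) * P j (?h, l))"
        using \<open>\<And>j. j < D \<Longrightarrow> sym_reg k (?g, \<kappa>) $$ (j, i) = of_rat (a j)\<close> by simp
      also have "\<dots> = P i (conj_mat2 ?g ?h, ?l)"
        using equivariant[of "(?g, \<kappa>)" "(?h, l)" i] i gh \<kappa>l
        unfolding D_def conj_prod[OF gh \<kappa>l] by simp
      also have "of_rat (r b (P i (conj_mat2 ?g ?h, ?l))) = R b i (conj_mat2 ?g ?h, ?l)"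
        unfolding conj by (rule R_value[OF i l' conj_SL2, symmetric])
      finally show ?thesis by (simp add: \<delta>_def)
    qed
    \<comment> \<open>Density is applied in the second argument for rational g, and then in the
      first argument for the given complex h.\<close>
    have "\<delta> (map_mat of_rat g) h = 0" if "g \<in> carrier SL2" for g
      by (rule regular_SL2_zero_of_rat[OF \<delta>_h _ gh(2)]) (rule rational[OF that])
    then have "\<delta> g h = 0"
      by (rule regular_SL2_zero_of_rat[OF \<delta>_g _ gh(1)])
    then show ?thesis by (simp add: \<delta>_def)
  qed
  have "\<exists>\<Psi>\<in>Cl. \<forall>\<alpha>\<in>carrier SL2_Z.
      \<Psi> (canonical_hom \<alpha>) = (\<Sum>i<D. of_rat (c b \<alpha> i) * R b' i (map_mat of_int \<alpha>, reduce N \<alpha>))" for b b'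
    unfolding D_def
  proof (rule period_class_element)
    fix g h :: "complex mat \<times> int mat" and i assume *: "g \<in> carrier (SL2 \<times>\<times> SL2_mod N)" "h \<in> carrier (SL2 \<times>\<times> SL2_mod N)" "i < Suc k * q"
    obtain g1 g2 h1 h2 where gh: "g = (g1, g2)" "h = (h1, h2)" by (cases g; cases h)
    show "(\<Sum>j<Suc k * q. sym_reg k g $$ (j, i) * R b' j h) =
        R b' i (inv\<^bsub>SL2 \<times>\<times> SL2_mod N\<^esub> g \<otimes>\<^bsub>SL2 \<times>\<times> SL2_mod N\<^esub> h \<otimes>\<^bsub>SL2 \<times>\<times> SL2_mod N\<^esub> g)"
      using R_equivariant[of g1 h1 g2 h2 i b'] conj_prod[of g1 h1 g2 N h2] * unfolding gh D_def by simp
  qed (use c_cocycle R_rat_regular in \<open>auto simp: D_def A_def simp del: mult_Suc\<close>)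
  then obtain \<Psi> where \<Psi>: "\<And>b b'. \<Psi> b b' \<in> Cl" "\<And>b b' \<alpha>. \<alpha> \<in> carrier SL2_Z \<Longrightarrow>
      \<Psi> b b' (canonical_hom \<alpha>) = (\<Sum>i<D. of_rat (c b \<alpha> i) * R b' i (map_mat of_int \<alpha>, reduce N \<alpha>))"
    by metis
  define \<Phi> where "\<Phi> = (\<lambda>\<eta>. \<Sum>x\<in>BC \<times> BP. (fst x * snd x) * \<Psi> (fst x) (snd x) \<eta>)"
  have "\<Phi> \<in> Cl_C" unfolding \<Phi>_def by (rule Cl_C_sum) (use BC BP \<Psi> in auto)
  moreover have "(\<Sum>i<D. C \<alpha> i * P i (map_mat of_int \<alpha>, reduce N \<alpha>)) = \<Phi> (canonical_hom \<alpha>)"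
    if \<alpha>: "\<alpha> \<in> carrier SL2_Z" for \<alpha>
  proof -
    let ?x = "(map_mat of_int \<alpha>, reduce N \<alpha>)"
    have "(\<Sum>i<D. C \<alpha> i * P i ?x) = (\<Sum>i<D. \<Sum>b\<in>BC. \<Sum>b'\<in>BP. (b * of_rat (c b \<alpha> i)) * (b' * R b' i ?x))"
      using \<alpha> by (intro sum.cong) (simp_all add: C_expand P_expand sum_product)
    also have "\<dots> = (\<Sum>b\<in>BC. \<Sum>b'\<in>BP. \<Sum>i<D. (b * of_rat (c b \<alpha> i)) * (b' * R b' i ?x))"
      by (subst sum.swap) (intro sum.cong refl sum.swap)
    also have "\<dots> = (\<Sum>b\<in>BC. \<Sum>b'\<in>BP. (b * b') * \<Psi> b b' (canonical_hom \<alpha>))"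
      by (intro sum.cong refl) (simp add: \<Psi>(2)[OF \<alpha>] sum_distrib_left mult_ac)
    also have "\<dots> = \<Phi> (canonical_hom \<alpha>)"
      unfolding \<Phi>_def by (simp add: sum.cartesian_product case_prod_unfold)
    finally show ?thesis .
  qed
  ultimately show ?thesis unfolding D_def by blast
qed

end

section \<open>Expansion of the highest weight vector\<close>

lemma infinite_minus_singleton: "infinite {x :: complex. x \<noteq> a}"
proof -
  have "{x. x \<noteq> a} = UNIV - {a}" by auto
  then show ?thesis using infinite_UNIV_char_0[where 'a = complex] by (simp add: finite_Diff_insert)
qed

text \<open>The bound on the degree compares the two affine charts of the projective line.\<close>

lemma degree_le_by_inversion:
  fixes r s :: "complex poly"
  assumes "\<And>x. x \<noteq> 0 \<Longrightarrow> poly r x = x ^ k * poly s (inverse x)"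
  shows "degree r \<le> k"
proof (cases "r = 0")
  case False
  \<comment> \<open>Multiplication by x^m with m the degree of s turns the identity into one between
    polynomials, because \<open>reflect_poly s\<close> is x^m s(1/x). The summand m then drops out
    of the comparison of degrees.\<close>
  let ?m = "degree s"
  have "poly (monom 1 ?m * r - monom 1 k * reflect_poly s) x = 0" if "x \<noteq> 0" for x
    using assms[OF that] poly_reflect_poly_nz[OF that, of s] by (simp add: poly_monom)
  then have "{x. x \<noteq> 0} \<subseteq> {x. poly (monom 1 ?m * r - monom 1 k * reflect_poly s) x = 0}" by auto
  then have "monom 1 ?m * r - monom 1 k * reflect_poly s = 0"
    using poly_roots_finite finite_subset infinite_minus_singleton[of 0] by blast
  then have "degree (monom 1 ?m * r) = degree (monom 1 k * reflect_poly s)" by simp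
  moreover have "degree (monom 1 ?m * r) = ?m + degree r"
    using False by (simp add: degree_mult_eq degree_monom_eq)
  moreover have "degree (monom 1 k * reflect_poly s) \<le> k + ?m"
    using degree_mult_le[of "monom 1 k" "reflect_poly s"] degree_reflect_poly_le[of s]
    by (simp add: degree_monom_eq)
  ultimately show ?thesis by simp
qed simp

text \<open>Lower unipotents fix v and the torus scales it, so \<sigma>(g) v is determined by the
  second column of g. Along upper unipotents it is a polynomial in \<tau> of degree at most k, and
  \<open>u j\<close> collects the coefficients of \<tau>^(k-j), in the order of the monomials of
  \<open>sym_mat\<close>. By the second claim, basis vector j \<mapsto> \<open>u j\<close> is an
  equivariant map from the symmetric power to the module.\<close>

lemma highest_weight_expansion:
  assumes hw: "highest_weight_module k d \<sigma> v"
  obtains u :: "nat \<Rightarrow> nat \<Rightarrow> complex" where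
    "\<And>\<tau> a. a < d \<Longrightarrow> (\<sigma> (mat2 1 \<tau> 0 1) *\<^sub>v v) $ a = (\<Sum>j<Suc k. \<tau> ^ (k - j) * u j a)"
    "\<And>g j a. g \<in> carrier SL2 \<Longrightarrow> j < Suc k \<Longrightarrow> a < d \<Longrightarrow>
      (\<Sum>b<d. \<sigma> g $$ (a, b) * u j b) = (\<Sum>l<Suc k. sym_mat k g $$ (l, j) * u l a)"
proof -
  have hom: "\<sigma> \<in> hom SL2 (GL d)" and v: "v \<in> carrier_vec d"
    and torus: "\<And>t. t \<noteq> 0 \<Longrightarrow> \<sigma> (mat2 (inverse t) 0 0 t) *\<^sub>v v = t ^ k \<cdot>\<^sub>v v"
    and lower: "\<And>s. \<sigma> (mat2 1 0 s 1) *\<^sub>v v = v"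
    and reg: "\<And>i j. i < d \<Longrightarrow> j < d \<Longrightarrow> \<exists>p\<in>regular_SL2. \<forall>g\<in>carrier SL2. \<sigma> g $$ (i, j) = p g"
    using hw unfolding highest_weight_module_def irreducible_rep_def by blast+
  have carr: "\<sigma> g \<in> carrier_mat d d" if "g \<in> carrier SL2" for g
    using hom_in_carrier[OF hom that] by auto
  have act: "\<sigma> (g * h) *\<^sub>v w = \<sigma> g *\<^sub>v (\<sigma> h *\<^sub>v w)"
    if "g \<in> carrier SL2" "h \<in> carrier SL2" "w \<in> carrier_vec d" for g h w
    using hom_mult[OF hom that(1,2)] assoc_mult_mat_vec[OF carr[OF that(1)] carr[OF that(2)] that(3)] by simp
  define F where "F a g = (\<sigma> g *\<^sub>v v) $ a" for a g
  have F_regular: "\<exists>p\<in>regular_SL2. \<forall>g\<in>carrier SL2. F a g = p g" if a: "a < d" for a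
  proof -
    obtain p where p: "\<And>b. b < d \<Longrightarrow> p b \<in> regular_SL2" "\<And>b g. b < d \<Longrightarrow> g \<in> carrier SL2 \<Longrightarrow> \<sigma> g $$ (a, b) = p b g"
      using reg[OF a] by metis
    have "(\<lambda>g. \<Sum>b<d. v $ b * p b g) \<in> regular_SL2"
      using p(1) by (intro regular_SL2_sum regular_SL2_cmult) auto
    moreover have "F a g = (\<Sum>b<d. v $ b * p b g)" if "g \<in> carrier SL2" for g
      unfolding F_def mult_mat_vec_index[OF carr[OF that] v a]
      using p(2) that by (intro sum.cong) auto
    ultimately show ?thesis by (intro bexI[of _ "\<lambda>g. \<Sum>b<d. v $ b * p b g"]) auto
  qed
  have line: "\<exists>P. \<forall>x. F a (G x) = poly P x"
    if "a < d" "\<And>x. G x \<in> carrier SL2" "\<And>i j. i < 2 \<Longrightarrow> j < 2 \<Longrightarrow> \<exists>P. \<forall>x. G x $$ (i, j) = poly P x"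
    for a and G :: "complex \<Rightarrow> complex mat"
    using F_regular[OF that(1)] regular_SL2_line[of _ G, OF _ that(3)] that(2) by metis
  have poly_entries: "\<exists>P. \<forall>x. mat2 (poly p1 x) (poly p2 x) (poly p3 x) (poly p4 x) $$ (i, j) = poly P x"
    if "i < 2" "j < 2" for p1 p2 p3 p4 :: "complex poly" and i j
  proof -
    have "i = 0 \<or> i = Suc 0" "j = 0 \<or> j = Suc 0" using that by auto
    then show ?thesis by (elim disjE) auto
  qed
  have "\<exists>P. \<forall>x. F a (mat2 1 x 0 1) = poly P x" if "a < d" for a
    using line[OF that, of "\<lambda>x. mat2 1 x 0 1"] poly_entries[of _ _ 1 "[:0, 1:]" 0 1] by simp
  then obtain r where r: "\<And>a x. a < d \<Longrightarrow> F a (mat2 1 x 0 1) = poly (r a) x" by metis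
  \<comment> \<open>The second chart: the second column is (1, x) here and (x, 1) for upper
    unipotents.\<close>
  have "\<exists>P. \<forall>x. F a (mat2 0 1 (-1) x) = poly P x" if "a < d" for a
    using line[OF that, of "\<lambda>x. mat2 0 1 (-1) x"] poly_entries[of _ _ 0 1 "[:-1:]" "[:0, 1:]"] by simp
  then obtain s where s: "\<And>a x. a < d \<Longrightarrow> F a (mat2 0 1 (-1) x) = poly (s a) x" by metis
  have degree: "degree (r a) \<le> k" if a: "a < d" for a
  proof (rule degree_le_by_inversion)
    fix x :: complex assume x: "x \<noteq> 0"
    have g: "mat2 0 1 (-1) (inverse x) \<in> carrier SL2" by simp
    have 1: "mat2 (inverse x) 0 0 x \<in> carrier SL2" "mat2 1 0 (inverse x) 1 \<in> carrier SL2"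
      "mat2 (inverse x) 0 0 x * mat2 1 0 (inverse x) 1 \<in> carrier SL2"
      using x by simp_all
    \<comment> \<open>The change of charts involves the torus element with t = x, whence the factor
      x^k.\<close>
    have "mat2 1 x 0 1 = mat2 0 1 (-1) (inverse x) * (mat2 (inverse x) 0 0 x * mat2 1 0 (inverse x) 1)"
      using x by (simp add: field_simps)
    then have "\<sigma> (mat2 1 x 0 1) *\<^sub>v v = x ^ k \<cdot>\<^sub>v (\<sigma> (mat2 0 1 (-1) (inverse x)) *\<^sub>v v)"
      using act[OF g 1(3) v] act[OF 1(1,2) v] lower torus[OF x] mult_mat_vec[OF carr[OF g] v] by simp
    then have "F a (mat2 1 x 0 1) = x ^ k * F a (mat2 0 1 (-1) (inverse x))"
      using a carr[OF g] by (simp add: F_def)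
    then show "poly (r a) x = x ^ k * poly (s a) (inverse x)" using r[OF a] s[OF a] by simp
  qed
  define u where "u j a = coeff (r a) (k - j)" for j a
  have expand: "poly (r a) x = (\<Sum>j<Suc k. x ^ (k - j) * u j a)" if "a < d" for a x
  proof -
    have "poly (r a) x = (\<Sum>l<Suc k. coeff (r a) l * x ^ l)"
      unfolding poly_altdef lessThan_Suc_atMost
      using degree[OF that] by (intro sum.mono_neutral_left) (auto simp: coeff_eq_0)
    also have "\<dots> = (\<Sum>j<Suc k. coeff (r a) (Suc k - Suc j) * x ^ (Suc k - Suc j))"
      by (rule sum.nat_diff_reindex[symmetric])
    finally show ?thesis by (simp add: u_def mult.commute)
  qed
  have F_expand: "F a g = (\<Sum>j<Suc k. g $$ (0, 1) ^ (k - j) * g $$ (1, 1) ^ j * u j a)"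
    if g: "g \<in> carrier SL2" "g $$ (1, 1) \<noteq> 0" and a: "a < d" for g a
  proof -
    obtain a' b c t where gm: "g = mat2 a' b c t" "a' * t - b * c = 1" using g(1) by (rule SL2_cases)
    then have t: "t \<noteq> 0" using g by simp
    have n: "mat2 1 (b / t) 0 1 \<in> carrier SL2" by simp
    have 1: "mat2 (inverse t) 0 0 t \<in> carrier SL2" "mat2 1 0 (c / t) 1 \<in> carrier SL2"
      "mat2 (inverse t) 0 0 t * mat2 1 0 (c / t) 1 \<in> carrier SL2"
      using t by simp_all
    \<comment> \<open>A nonzero lower right entry t allows this factorisation into upper unipotent,
      torus and lower unipotent parts, the last of which fixes v.\<close>
    have "g = mat2 1 (b / t) 0 1 * (mat2 (inverse t) 0 0 t * mat2 1 0 (c / t) 1)"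
      using t gm by (simp add: field_simps)
    then have "\<sigma> g *\<^sub>v v = t ^ k \<cdot>\<^sub>v (\<sigma> (mat2 1 (b / t) 0 1) *\<^sub>v v)"
      using act[OF n 1(3) v] act[OF 1(1,2) v] lower torus[OF t] mult_mat_vec[OF carr[OF n] v] by simp
    then have "F a g = t ^ k * poly (r a) (b / t)"
      using a carr[OF n] r[OF a, of "b / t"] by (simp add: F_def)
    also have "\<dots> = (\<Sum>j<Suc k. b ^ (k - j) * t ^ j * u j a)"
      unfolding expand[OF a] sum_distrib_left
    proof (rule sum.cong)
      fix j assume "j \<in> {..<Suc k}"
      then have "t ^ k = t ^ (k - j) * t ^ j" by (simp flip: power_add)
      then show "t ^ k * ((b / t) ^ (k - j) * u j a) = b ^ (k - j) * t ^ j * u j a"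
        using t by (simp add: power_divide)
    qed simp
    finally show ?thesis by (simp add: gm(1) del: sum.lessThan_Suc)
  qed
  show thesis
  proof (rule that)
    fix \<tau> a assume "a < d"
    then show "(\<sigma> (mat2 1 \<tau> 0 1) *\<^sub>v v) $ a = (\<Sum>j<Suc k. \<tau> ^ (k - j) * u j a)"
      using r expand by (simp add: F_def)
  next
    fix g :: "complex mat" and j a assume g: "g \<in> carrier SL2" and j: "j < Suc k" and a: "a < d"
    obtain a' b c t where gm: "g = mat2 a' b c t" "a' * t - b * c = 1" using g by (rule SL2_cases)
    define p where "p j = (\<Sum>b<d. \<sigma> g $$ (a, b) * u j b)" for j
    define p' where "p' j = (\<Sum>l<Suc k. sym_mat k g $$ (l, j) * u l a)" for j
    \<comment> \<open>Both sums express coordinate a of \<sigma>(g) applied to the vector at \<tau>.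
      The second one comes from \<open>F_expand\<close>, which requires the lower right entry c
      \<tau> + t of the product to be nonzero.\<close>
    have eq: "(\<Sum>j<Suc k. p j * \<tau> ^ (k - j)) = (\<Sum>j<Suc k. p' j * \<tau> ^ (k - j))" if "c * \<tau> + t \<noteq> 0" for \<tau>
    proof -
      have n: "mat2 1 \<tau> 0 1 \<in> carrier SL2" by simp
      have w: "\<sigma> (mat2 1 \<tau> 0 1) *\<^sub>v v \<in> carrier_vec d" using mult_mat_vec_carrier[OF carr[OF n] v] .
      have "(\<Sum>j<Suc k. p j * \<tau> ^ (k - j)) = (\<Sum>b<d. \<sigma> g $$ (a, b) * (\<Sum>j<Suc k. \<tau> ^ (k - j) * u j b))"
        unfolding p_def sum_distrib_left sum_distrib_right
        by (subst sum.swap) (simp add: mult_ac del: sum.lessThan_Suc)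
      also have "\<dots> = (\<Sum>b<d. \<sigma> g $$ (a, b) * (\<sigma> (mat2 1 \<tau> 0 1) *\<^sub>v v) $ b)"
        using r expand by (intro sum.cong) (auto simp: F_def simp del: sum.lessThan_Suc index_mult_mat_vec)
      also have "\<dots> = F a (g * mat2 1 \<tau> 0 1)"
        unfolding F_def act[OF g n v] by (rule mult_mat_vec_index[OF carr[OF g] w a, symmetric])
      also have "\<dots> = (\<Sum>l<Suc k. (a' * \<tau> + b) ^ (k - l) * (c * \<tau> + t) ^ l * u l a)"
      proof -
        have "g * mat2 1 \<tau> 0 1 \<in> carrier SL2" using gm by (simp add: algebra_simps)
        then show ?thesis
          using F_expand[of "g * mat2 1 \<tau> 0 1" a] a that by (simp add: gm(1) del: sum.lessThan_Suc)
      qed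
      also have "\<dots> = (\<Sum>l<Suc k. (\<Sum>j<Suc k. sym_mat k g $$ (l, j) * (\<tau> ^ (k - j) * 1 ^ j)) * u l a)"
      proof (rule sum.cong)
        fix l assume "l \<in> {..<Suc k}"
        then show "(a' * \<tau> + b) ^ (k - l) * (c * \<tau> + t) ^ l * u l a =
            (\<Sum>j<Suc k. sym_mat k g $$ (l, j) * (\<tau> ^ (k - j) * 1 ^ j)) * u l a"
          using sym_mat_monomials[of l k g \<tau> 1] by (simp add: gm(1) del: sum.lessThan_Suc)
      qed simp
      also have "\<dots> = (\<Sum>j<Suc k. p' j * \<tau> ^ (k - j))"
        unfolding p'_def sum_distrib_right
        by (subst sum.swap) (simp add: mult_ac del: sum.lessThan_Suc)
      finally show ?thesis .
    qed
    have inf: "infinite {x. c * x + t \<noteq> 0}"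
    proof (cases "c = 0")
      case True
      then have "{x. c * x + t \<noteq> 0} = UNIV" using gm(2) by auto
      then show ?thesis by (simp add: infinite_UNIV_char_0)
    next
      case False
      then have "{x. c * x + t \<noteq> 0} = {x. x \<noteq> - t / c}" by (auto simp: field_simps add_eq_0_iff)
      then show ?thesis using infinite_minus_singleton by simp
    qed
    \<comment> \<open>The order of summation is reversed so that coefficients are indexed by the
      power of x, as the uniqueness lemma expects.\<close>
    have eq': "(\<Sum>l<Suc k. p (k - l) * x ^ l) = (\<Sum>l<Suc k. p' (k - l) * x ^ l)" if "c * x + t \<noteq> 0" for x
    proof -
      have "(\<Sum>l<Suc k. h (k - l) * x ^ l) = (\<Sum>j<Suc k. h j * x ^ (k - j))" for h :: "nat \<Rightarrow> complex"
      proof -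
        have "(\<Sum>l<Suc k. h (k - l) * x ^ l) = (\<Sum>j<Suc k. h (k - (Suc k - Suc j)) * x ^ (Suc k - Suc j))"
          by (rule sum.nat_diff_reindex[symmetric])
        also have "\<dots> = (\<Sum>j<Suc k. h j * x ^ (k - j))" by (intro sum.cong) auto
        finally show ?thesis .
      qed
      then show ?thesis using eq[OF that] by simp
    qed
    have "infinite {x. (\<Sum>l<Suc k. p (k - l) * x ^ l) = (\<Sum>l<Suc k. p' (k - l) * x ^ l)}"
      by (rule infinite_super[OF _ inf]) (use eq' in blast)
    from polynomial_function_unique_infinite[OF this, of "k - j"]
    have "p (k - (k - j)) = p' (k - (k - j))" by simp
    then show "(\<Sum>b<d. \<sigma> g $$ (a, b) * u j b) = (\<Sum>l<Suc k. sym_mat k g $$ (l, j) * u l a)"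
      using j by (simp add: p_def p'_def del: sum.lessThan_Suc)
  qed
qed

section \<open>Periods on the upper half plane\<close>

lemma upper_half_plane_props: "open upper_half_plane" "convex upper_half_plane"
  unfolding upper_half_plane_def by (simp_all add: open_halfspace_Im_gt convex_halfspace_Im_gt)

lemma automorphy_nonzero:
  assumes "\<gamma> \<in> carrier SL2_Z" "\<tau> \<in> upper_half_plane"
  shows "automorphy \<gamma> \<tau> \<noteq> 0"
proof
  obtain a b c d where g: "\<gamma> = mat2 a b c d" "a * d - b * c = 1" using assms(1) by (rule SL2_cases)
  assume "automorphy \<gamma> \<tau> = 0"
  then have "Im (of_int c * \<tau> + of_int d) = 0" "Re (of_int c * \<tau> + of_int d) = 0"
    by (simp_all add: automorphy_def g)
  then have "c = 0" "d = 0" using assms(2) by (auto simp: upper_half_plane_def)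
  then show False using g(2) by simp
qed

lemma moebius_action_upper_half_plane:
  assumes "\<gamma> \<in> carrier SL2_Z" "\<tau> \<in> upper_half_plane"
  shows "moebius_action \<gamma> \<tau> \<in> upper_half_plane"
proof -
  obtain a b c d where g: "\<gamma> = mat2 a b c d" "a * d - b * c = 1" using assms(1) by (rule SL2_cases)
  let ?j = "automorphy \<gamma> \<tau>" and ?w = "of_int a * \<tau> + of_int b"
  have j: "?j \<noteq> 0" by (rule automorphy_nonzero[OF assms])
  have "Im (?w * cnj ?j) = of_int (a * d - b * c) * Im \<tau>"
    by (simp add: automorphy_def g(1) algebra_simps)
  also have "\<dots> > 0" using assms(2) g(2) by (simp add: upper_half_plane_def)
  finally have "Im (?w * cnj ?j) > 0" .
  moreover have "?w / ?j = ?w * cnj ?j / of_real ((norm ?j)\<^sup>2)"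
    unfolding complex_norm_square using j by simp
  then have "Im (?w / ?j) = Im (?w * cnj ?j) / (norm ?j)\<^sup>2"
    by (simp only: Im_divide_of_real)
  ultimately have "Im (?w / ?j) > 0" using j by simp
  then show ?thesis by (simp add: upper_half_plane_def moebius_action_def g(1))
qed

lemma moebius_action_mult:
  assumes "\<alpha> \<in> carrier SL2_Z" "\<beta> \<in> carrier SL2_Z" "\<tau> \<in> upper_half_plane"
  shows "moebius_action (\<alpha> * \<beta>) \<tau> = moebius_action \<alpha> (moebius_action \<beta> \<tau>)"
proof -
  obtain a b c d where g: "\<alpha> = mat2 a b c d" "a * d - b * c = 1" using assms(1) by (rule SL2_cases)
  obtain a' b' c' d' where h: "\<beta> = mat2 a' b' c' d'" "a' * d' - b' * c' = 1" using assms(2) by (rule SL2_cases)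
  have j: "of_int c' * \<tau> + of_int d' \<noteq> 0"
    using automorphy_nonzero[OF assms(2,3)] by (simp add: automorphy_def h(1))
  show ?thesis
    using j by (simp add: moebius_action_def automorphy_def g(1) h(1) divide_simps) (simp add: algebra_simps)
qed

lemma moebius_action_derivative:
  assumes "\<gamma> \<in> carrier SL2_Z" "\<tau> \<in> upper_half_plane"
  shows "(moebius_action \<gamma> has_field_derivative 1 / (automorphy \<gamma> \<tau>)\<^sup>2) (at \<tau>)"
proof -
  obtain a b c d where g: "\<gamma> = mat2 a b c d" "a * d - b * c = 1" using assms(1) by (rule SL2_cases)
  have j: "of_int c * \<tau> + of_int d \<noteq> 0"
    using automorphy_nonzero[OF assms] by (simp add: automorphy_def g(1))
  have det: "of_int a * of_int d - of_int b * of_int c = (1 :: complex)"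
    using g(2) by (metis of_int_1 of_int_diff of_int_mult)
  have "((\<lambda>\<tau>. (of_int a * \<tau> + of_int b) / (of_int c * \<tau> + of_int d)) has_field_derivative
      (of_int a * (of_int c * \<tau> + of_int d) - (of_int a * \<tau> + of_int b) * of_int c) /
      ((of_int c * \<tau> + of_int d) * (of_int c * \<tau> + of_int d))) (at \<tau>)"
    by (rule derivative_eq_intros refl | use j in simp)+
  moreover have "of_int a * (of_int c * \<tau> + of_int d) - (of_int a * \<tau> + of_int b) * of_int c = 1"
    using det by (simp add: algebra_simps)
  moreover have "moebius_action \<gamma> = (\<lambda>\<tau>. (of_int a * \<tau> + of_int b) / (of_int c * \<tau> + of_int d))"
    by (simp add: moebius_action_def automorphy_def g(1) fun_eq_iff)
  ultimately show ?thesis by (simp add: automorphy_def g(1) power2_eq_square)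
qed

text \<open>The half plane is convex, so each \<open>h j\<close> has a primitive \<open>H j\<close>
  and the integrals depend only on end points. The weight 2 factor cancels the derivative of the
  Moebius action; hence the difference between \<open>H i\<close> at \<alpha> \<tau> and its
  expected transform has derivative zero and is constant. Comparing its values at \<tau>0 and
  \<beta> \<tau>0 gives the relation.\<close>

lemma period_cocycle:
  fixes h :: "nat \<Rightarrow> complex \<Rightarrow> complex" and A :: "int mat \<Rightarrow> nat \<Rightarrow> nat \<Rightarrow> complex"
  assumes holomorphic: "\<And>i. i < D \<Longrightarrow> h i holomorphic_on upper_half_plane"
    and transform: "\<And>\<gamma> \<tau> i. \<gamma> \<in> carrier SL2_Z \<Longrightarrow> \<tau> \<in> upper_half_plane \<Longrightarrow> i < D \<Longrightarrow>
      h i (moebius_action \<gamma> \<tau>) = (automorphy \<gamma> \<tau>)\<^sup>2 * (\<Sum>j<D. A \<gamma> i j * h j \<tau>)"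
    and \<tau>0: "\<tau>0 \<in> upper_half_plane"
    and path: "\<And>\<alpha>. \<alpha> \<in> carrier SL2_Z \<Longrightarrow> valid_path (p \<alpha>) \<and> path_image (p \<alpha>) \<subseteq> upper_half_plane \<and>
      pathstart (p \<alpha>) = \<tau>0 \<and> pathfinish (p \<alpha>) = moebius_action \<alpha> \<tau>0"
    and ab: "\<alpha> \<in> carrier SL2_Z" "\<beta> \<in> carrier SL2_Z" and i: "i < D"
  shows "contour_integral (p (\<alpha> * \<beta>)) (h i) =
    contour_integral (p \<alpha>) (h i) + (\<Sum>j<D. A \<alpha> i j * contour_integral (p \<beta>) (h j))"
proof -
  have "\<exists>H. \<forall>\<tau>\<in>upper_half_plane. (H has_field_derivative h j \<tau>) (at \<tau>)" if "j < D" for j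
    using holomorphic_convex_primitive'[OF upper_half_plane_props(2,1) holomorphic[OF that]]
    by (metis at_within_open upper_half_plane_props(1))
  then obtain H where H: "\<And>j \<tau>. j < D \<Longrightarrow> \<tau> \<in> upper_half_plane \<Longrightarrow> (H j has_field_derivative h j \<tau>) (at \<tau>)"
    by metis
  have integral: "contour_integral (p \<gamma>) (h j) = H j (moebius_action \<gamma> \<tau>0) - H j \<tau>0"
    if "\<gamma> \<in> carrier SL2_Z" "j < D" for \<gamma> j
    using contour_integral_unique[OF contour_integral_primitive[of upper_half_plane "H j" "h j" "p \<gamma>"]]
      H[OF that(2)] path[OF that(1)] by (metis has_field_derivative_at_within)
  define \<Delta> where "\<Delta> \<tau> = H i (moebius_action \<alpha> \<tau>) - (\<Sum>j<D. A \<alpha> i j * H j \<tau>)" for \<tau>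
  have "(\<Delta> has_field_derivative 0) (at \<tau>)" if \<tau>: "\<tau> \<in> upper_half_plane" for \<tau>
  proof -
    have "((\<lambda>\<tau>. H i (moebius_action \<alpha> \<tau>)) has_field_derivative
        h i (moebius_action \<alpha> \<tau>) * (1 / (automorphy \<alpha> \<tau>)\<^sup>2)) (at \<tau>)"
      using DERIV_chain2[OF H[OF i moebius_action_upper_half_plane[OF ab(1) \<tau>]]
          moebius_action_derivative[OF ab(1) \<tau>]] .
    moreover have "h i (moebius_action \<alpha> \<tau>) * (1 / (automorphy \<alpha> \<tau>)\<^sup>2) = (\<Sum>j<D. A \<alpha> i j * h j \<tau>)"
      using transform[OF ab(1) \<tau> i] automorphy_nonzero[OF ab(1) \<tau>] by simp
    moreover have "((\<lambda>\<tau>. \<Sum>j<D. A \<alpha> i j * H j \<tau>) has_field_derivative (\<Sum>j<D. A \<alpha> i j * h j \<tau>)) (at \<tau>)"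
      using H \<tau> by (intro DERIV_sum DERIV_cmult) auto
    ultimately show ?thesis
      unfolding \<Delta>_def using DERIV_diff by fastforce
  qed
  then obtain c where c: "\<And>\<tau>. \<tau> \<in> upper_half_plane \<Longrightarrow> \<Delta> \<tau> = c"
    using has_field_derivative_zero_constant[OF upper_half_plane_props(2), of \<Delta>]
    by (metis has_field_derivative_at_within)
  have \<beta>\<tau>0: "moebius_action \<beta> \<tau>0 \<in> upper_half_plane"
    by (rule moebius_action_upper_half_plane[OF ab(2) \<tau>0])
  have "\<Delta> (moebius_action \<beta> \<tau>0) = \<Delta> \<tau>0" using c \<tau>0 \<beta>\<tau>0 by simp
  then have "H i (moebius_action (\<alpha> * \<beta>) \<tau>0) - H i (moebius_action \<alpha> \<tau>0) =
      (\<Sum>j<D. A \<alpha> i j * (H j (moebius_action \<beta> \<tau>0) - H j \<tau>0))"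
    by (simp add: \<Delta>_def moebius_action_mult[OF ab \<tau>0] right_diff_distrib sum_subtractf algebra_simps)
  moreover have "\<alpha> * \<beta> \<in> carrier SL2_Z"
    using monoid.m_closed[OF group.is_monoid[OF SL2_group] ab] by simp
  ultimately show ?thesis
    using ab i by (simp add: integral algebra_simps)
qed

lemma Cl_C_add: assumes "\<Phi> \<in> Cl_C" "\<Psi> \<in> Cl_C" shows "(\<lambda>\<eta>. \<Phi> \<eta> + \<Psi> \<eta>) \<in> Cl_C"
proof -
  obtain r r' :: nat and c c' X X' where *: "\<forall>i<r. X i \<in> Cl" "\<Phi> = (\<lambda>\<eta>. \<Sum>i<r. c i * X i \<eta>)"
    "\<forall>i<r'. X' i \<in> Cl" "\<Psi> = (\<lambda>\<eta>. \<Sum>i<r'. c' i * X' i \<eta>)"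
    using assms unfolding Cl_C_def mem_Collect_eq by (elim exE conjE)
  let ?c = "\<lambda>i. case i of Inl i \<Rightarrow> c i | Inr i \<Rightarrow> c' i" and ?X = "\<lambda>i. case i of Inl i \<Rightarrow> X i | Inr i \<Rightarrow> X' i"
  have "(\<lambda>\<eta>. \<Sum>i\<in>{..<r} <+> {..<r'}. ?c i * ?X i \<eta>) \<in> Cl_C"
    by (rule Cl_C_sum) (use * in auto)
  then show ?thesis by (simp add: * sum.Plus)
qed

lemma Cl_C_sum_closed:
  assumes "finite I" "\<And>i. i \<in> I \<Longrightarrow> \<Phi> i \<in> Cl_C" shows "(\<lambda>\<eta>. \<Sum>i\<in>I. \<Phi> i \<eta>) \<in> Cl_C"
  using assms
proof (induction I rule: finite_induct)
  case empty
  show ?case using Cl_C_sum[of "{}"] by simp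
next
  case (insert i I)
  then show ?case by (simp add: Cl_C_add)
qed

text \<open>Linearity of \<open>T\<close> is available for values on the carrier only, hence the
  pointwise form. The induction runs over the truncations of v to its first m coordinates.\<close>

lemma conj_hom_coordinates:
  fixes T :: "'k::field vec \<Rightarrow> 'g \<Rightarrow> 'k"
  assumes T: "T \<in> conj_hom G A n \<rho>" and v: "v \<in> carrier_vec n" and h: "h \<in> carrier G"
  shows "T v h = (\<Sum>a<n. v $ a * T (unit_vec n a) h)"
proof -
  have add: "T (u + w) h = T u h + T w h" if "u \<in> carrier_vec n" "w \<in> carrier_vec n" for u w
    using T that h unfolding conj_hom_def by blast
  have scale: "T (c \<cdot>\<^sub>v w) h = c * T w h" if "w \<in> carrier_vec n" for c w
    using T that h unfolding conj_hom_def by blast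
  have "T (vec n (\<lambda>a. if a < m then v $ a else 0)) h = (\<Sum>a<m. v $ a * T (unit_vec n a) h)" if "m \<le> n" for m
    using that
  proof (induction m)
    case 0
    have "vec n (\<lambda>a. if a < 0 then v $ a else 0) = 0 \<cdot>\<^sub>v 0\<^sub>v n" by (rule eq_vecI) auto
    then show ?case using scale[of "0\<^sub>v n" 0] by simp
  next
    case (Suc m)
    have "vec n (\<lambda>a. if a < Suc m then v $ a else 0) =
        vec n (\<lambda>a. if a < m then v $ a else 0) + v $ m \<cdot>\<^sub>v unit_vec n m"
      using Suc.prems by (intro eq_vecI) (auto simp: less_Suc_eq)
    then show ?case using Suc by (simp add: add scale)
  qed
  moreover have "vec n (\<lambda>a. if a < n then v $ a else 0) = v" using v by (intro eq_vecI) auto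
  ultimately show ?thesis by (metis order_refl)
qed

section \<open>Lifting the form to a rational representation\<close>

locale modular_period = level N e q for N and e :: "nat \<Rightarrow> int mat" and q +
  fixes k n d :: nat
    and \<rho> :: "int mat \<Rightarrow> complex mat" and f :: "complex \<Rightarrow> complex vec"
    and \<sigma> :: "complex mat \<Rightarrow> complex mat" and v :: "complex vec"
    and \<phi> :: "complex vec \<Rightarrow> complex mat \<times> int mat \<Rightarrow> complex"
  assumes \<rho>: "\<rho> \<in> hom (SL2_mod N) (GL n)"
    and modular: "vv_modular_form N n \<rho> (k + 2) f"
    and highest_weight: "highest_weight_module k d \<sigma> v"
    and \<phi>: "\<phi> \<in> conj_hom (SL2 \<times>\<times> SL2_mod N) (regular_SL2_prod N) (d * n) (\<lambda>(g, k). kron_mat (\<sigma> g) (\<rho> k))"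
begin

abbreviation K where "K \<equiv> carrier (SL2_mod N)"
abbreviation (input) kmult (infixl "\<odot>" 70) where "x \<odot> y \<equiv> x \<otimes>\<^bsub>SL2_mod N\<^esub> y"
abbreviation (input) kinv where "kinv x \<equiv> inv\<^bsub>SL2_mod N\<^esub> x"

lemma \<rho>_carrier: "x \<in> K \<Longrightarrow> \<rho> x \<in> carrier_mat n n"
  using hom_in_carrier[OF \<rho>] by auto

lemma \<rho>_mult: "x \<in> K \<Longrightarrow> y \<in> K \<Longrightarrow> \<rho> (x \<odot> y) = \<rho> x * \<rho> y"
  using hom_mult[OF \<rho>] by simp

lemma f_carrier: "\<tau> \<in> upper_half_plane \<Longrightarrow> f \<tau> \<in> carrier_vec n"
  using modular unfolding vv_modular_form_def by blast

text \<open>Coordinate i of \<rho>(x^-1) f(\<tau>), as a function of x in the finite group. These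
  matrix coefficients turn the action of \<gamma> through \<rho> into left translation of x, which
  has a rational matrix.\<close>

definition twist :: "nat \<Rightarrow> int mat \<Rightarrow> complex \<Rightarrow> complex" where
  "twist i x \<tau> = (\<Sum>b<n. \<rho> (kinv x) $$ (i, b) * f \<tau> $ b)"

lemma twist_eq: "x \<in> K \<Longrightarrow> \<tau> \<in> upper_half_plane \<Longrightarrow> i < n \<Longrightarrow> twist i x \<tau> = (\<rho> (kinv x) *\<^sub>v f \<tau>) $ i"
  unfolding twist_def by (rule mult_mat_vec_index[OF \<rho>_carrier f_carrier, symmetric]) (rule K.inv_closed)

lemma twist_holomorphic:
  assumes "i < n" shows "twist i x holomorphic_on upper_half_plane"
proof -
  have "(\<lambda>\<tau>. f \<tau> $ b) holomorphic_on upper_half_plane" if "b < n" for b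
    using modular that unfolding vv_modular_form_def by blast
  then show ?thesis unfolding twist_def by (intro holomorphic_intros) auto
qed

lemma twist_transform:
  assumes "\<gamma> \<in> carrier SL2_Z" "\<tau> \<in> upper_half_plane" "x \<in> K" "i < n"
  shows "twist i x (moebius_action \<gamma> \<tau>) = automorphy \<gamma> \<tau> ^ (k + 2) * twist i (kinv (reduce N \<gamma>) \<odot> x) \<tau>"
proof -
  let ?l = "reduce N \<gamma>"
  have l: "?l \<in> K" by (rule reduce_SL2_Z[OF assms(1)])
  have x: "kinv x \<in> K" using assms(3) by (rule K.inv_closed)
  have f: "f \<tau> \<in> carrier_vec n" by (rule f_carrier[OF assms(2)])
  have \<rho>f: "\<rho> ?l *\<^sub>v f \<tau> \<in> carrier_vec n" by (rule mult_mat_vec_carrier[OF \<rho>_carrier[OF l] f])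
  have "f (moebius_action \<gamma> \<tau>) = automorphy \<gamma> \<tau> ^ (k + 2) \<cdot>\<^sub>v (\<rho> ?l *\<^sub>v f \<tau>)"
    using modular assms unfolding vv_modular_form_def by blast
  then have "\<rho> (kinv x) *\<^sub>v f (moebius_action \<gamma> \<tau>) = automorphy \<gamma> \<tau> ^ (k + 2) \<cdot>\<^sub>v (\<rho> (kinv x) *\<^sub>v (\<rho> ?l *\<^sub>v f \<tau>))"
    using mult_mat_vec[OF \<rho>_carrier[OF x] \<rho>f] by simp
  also have "\<rho> (kinv x) *\<^sub>v (\<rho> ?l *\<^sub>v f \<tau>) = \<rho> (kinv x \<odot> ?l) *\<^sub>v f \<tau>"
    unfolding \<rho>_mult[OF x l] using assoc_mult_mat_vec[OF \<rho>_carrier[OF x] \<rho>_carrier[OF l] f] by simp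
  also have "kinv x \<odot> ?l = kinv (kinv ?l \<odot> x)"
    using K.inv_mult_group[of "kinv ?l" x] K.inv_inv[OF l] K.inv_closed[OF l] assms(3) by simp
  finally have "(\<rho> (kinv x) *\<^sub>v f (moebius_action \<gamma> \<tau>)) $ i =
      (automorphy \<gamma> \<tau> ^ (k + 2) \<cdot>\<^sub>v (\<rho> (kinv (kinv ?l \<odot> x)) *\<^sub>v f \<tau>)) $ i" by simp
  moreover have y: "kinv ?l \<odot> x \<in> K" using l assms(3) by (intro K.m_closed K.inv_closed)
  moreover have "dim_row (\<rho> (kinv (kinv ?l \<odot> x))) = n"
    using \<rho>_carrier[OF K.inv_closed[OF y]] by simp
  ultimately show ?thesis
    unfolding twist_eq[OF assms(3) moebius_action_upper_half_plane[OF assms(1,2)] assms(4)]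
      twist_eq[OF y assms(2,4)] using assms(4) by (simp del: index_mult_mat_vec)
qed

lemma twist_average:
  assumes "\<tau> \<in> upper_half_plane" "x \<in> K" "b < n"
  shows "(\<Sum>i<n. \<rho> x $$ (b, i) * twist i x \<tau>) = f \<tau> $ b"
proof -
  have x: "kinv x \<in> K" using assms(2) by (rule K.inv_closed)
  have f: "f \<tau> \<in> carrier_vec n" by (rule f_carrier[OF assms(1)])
  have "(\<Sum>i<n. \<rho> x $$ (b, i) * twist i x \<tau>) = (\<rho> x *\<^sub>v (\<rho> (kinv x) *\<^sub>v f \<tau>)) $ b"
    unfolding mult_mat_vec_index[OF \<rho>_carrier[OF assms(2)] mult_mat_vec_carrier[OF \<rho>_carrier[OF x] f] assms(3)]
    using twist_eq[OF assms(2,1)] by (intro sum.cong) auto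
  also have "\<rho> x *\<^sub>v (\<rho> (kinv x) *\<^sub>v f \<tau>) = \<rho> (x \<odot> kinv x) *\<^sub>v f \<tau>"
    unfolding \<rho>_mult[OF assms(2) x] using assoc_mult_mat_vec[OF \<rho>_carrier[OF assms(2)] \<rho>_carrier[OF x] f] by simp
  also have "\<dots> = f \<tau>"
    using K.r_inv[OF assms(2)] hom_GL_one[OF \<rho> K.is_group] f by simp
  finally show ?thesis .
qed

text \<open>The components of the form with values in copies of \<open>Sym\<^sup>k \<otimes> \<complex>[SL\<^sub>2(\<int>/N)]\<close>, one copy for each
  coordinate of the space of \<open>\<rho>\<close>. The projection back is obtained by averaging over
  \<open>SL\<^sub>2(\<int>/N)\<close>.\<close>

definition lift_form :: "nat \<Rightarrow> nat \<Rightarrow> complex \<Rightarrow> complex" where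
  "lift_form i J \<tau> = 2 * of_real pi * \<i> * \<tau> ^ (k - J div q) * twist i (e (J mod q)) \<tau>"

text \<open>The weight k + 2 splits: k powers of the automorphy factor clear the denominator of the
  power of \<gamma> \<tau> and produce the action on the symmetric power, and two remain for
  d\<tau>. The translation of the argument of \<open>twist\<close> is by the inverse of \<gamma>,
  which matches the rows of \<open>perm_mat\<close>.\<close>

lemma lift_form_transform:
  assumes \<gamma>: "\<gamma> \<in> carrier SL2_Z" and \<tau>: "\<tau> \<in> upper_half_plane" and i: "i < n" and J: "J < Suc k * q"
  shows "lift_form i J (moebius_action \<gamma> \<tau>) =
    (automorphy \<gamma> \<tau>)\<^sup>2 * (\<Sum>J'<Suc k * q. restrict_rep N (sym_reg k) \<gamma> $$ (J, J') * lift_form i J' \<tau>)"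
proof -
  let ?a = "automorphy \<gamma> \<tau>" and ?g = "map_mat of_int \<gamma> :: complex mat" and ?l = "reduce N \<gamma>"
  let ?j = "J div q" and ?x = "J mod q" and ?c = "2 * of_real pi * \<i> :: complex"
  note Jb = div_mod_less[OF J]
  have l: "?l \<in> K" by (rule reduce_SL2_Z[OF \<gamma>])
  have a: "?a \<noteq> 0" by (rule automorphy_nonzero[OF \<gamma> \<tau>])
  obtain a' b c t where g: "\<gamma> = mat2 a' b c t" using \<gamma> by (rule SL2_cases)
  have "?a ^ k * moebius_action \<gamma> \<tau> ^ (k - ?j) = (of_int a' * \<tau> + of_int b) ^ (k - ?j) * ?a ^ ?j"
  proof -
    have "?a ^ k = ?a ^ (k - ?j) * ?a ^ ?j" using Jb by (simp flip: power_add)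
    then show ?thesis using a by (simp add: moebius_action_def g power_divide)
  qed
  also have "\<dots> = (\<Sum>l<Suc k. sym_mat k ?g $$ (?j, l) * \<tau> ^ (k - l))"
    using sym_mat_monomials[of ?j k ?g \<tau> 1] Jb by (simp add: g automorphy_def del: sum.lessThan_Suc)
  finally have sym: "?a ^ k * moebius_action \<gamma> \<tau> ^ (k - ?j) = (\<Sum>l<Suc k. sym_mat k ?g $$ (?j, l) * \<tau> ^ (k - l))" .
  have perm: "twist i (kinv ?l \<odot> e ?x) \<tau> = (\<Sum>y<q. K.perm_mat ?l $$ (?x, y) * twist i (e y) \<tau>)"
    using K.perm_mat_sum_row[OF l Jb(2), of "\<lambda>y. twist i y \<tau>"] by simp
  have "lift_form i J (moebius_action \<gamma> \<tau>) =
      ?c * moebius_action \<gamma> \<tau> ^ (k - ?j) * (?a ^ (k + 2) * twist i (kinv ?l \<odot> e ?x) \<tau>)"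
    unfolding lift_form_def using twist_transform[OF \<gamma> \<tau> K.enum_closed[OF Jb(2)] i] by simp
  also have "\<dots> = ?a\<^sup>2 * (?c * ((?a ^ k * moebius_action \<gamma> \<tau> ^ (k - ?j)) * twist i (kinv ?l \<odot> e ?x) \<tau>))"
    by (simp add: power_add power2_eq_square mult_ac)
  also have "\<dots> = ?a\<^sup>2 * (\<Sum>l<Suc k. \<Sum>y<q. sym_mat k ?g $$ (?j, l) * K.perm_mat ?l $$ (?x, y) *
      (?c * \<tau> ^ (k - l) * twist i (e y) \<tau>))"
    unfolding sym perm sum_product by (simp add: sum_distrib_left mult_ac del: sum.lessThan_Suc)
  also have "(\<Sum>l<Suc k. \<Sum>y<q. sym_mat k ?g $$ (?j, l) * K.perm_mat ?l $$ (?x, y) *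
      (?c * \<tau> ^ (k - l) * twist i (e y) \<tau>)) =
      (\<Sum>J'<Suc k * q. sym_mat k ?g $$ (?j, J' div q) * K.perm_mat ?l $$ (?x, J' mod q) * lift_form i J' \<tau>)"
    unfolding lift_form_def by (rule sum_div_mod[symmetric])
  also have "\<dots> = (\<Sum>J'<Suc k * q. restrict_rep N (sym_reg k) \<gamma> $$ (J, J') * lift_form i J' \<tau>)"
    using J by (intro sum.cong) (auto simp: restrict_rep_def sym_reg_index simp del: mult_Suc)
  finally show ?thesis .
qed

text \<open>\<open>P i\<close> is \<phi> applied to the tensor products of \<open>u j\<close> with
  column i of \<rho>(x), indexed by the pairs (j, x). Equivariance holds because the
  \<open>u j\<close> transform by \<open>sym_mat\<close> and \<rho>(\<kappa>) \<rho>(x) =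
  \<rho>(\<kappa> x); the form is recovered because \<rho>(x) undoes the twist by
  \<rho>(x^-1).\<close>

lemma lift:
  obtains P :: "nat \<Rightarrow> nat \<Rightarrow> complex mat \<times> int mat \<Rightarrow> complex" where
    "\<And>i J. P i J \<in> regular_SL2_prod N"
    "\<And>i J g x. i < n \<Longrightarrow> J < Suc k * q \<Longrightarrow> g \<in> carrier (SL2 \<times>\<times> SL2_mod N) \<Longrightarrow> x \<in> carrier (SL2 \<times>\<times> SL2_mod N) \<Longrightarrow>
      (\<Sum>J'<Suc k * q. sym_reg k g $$ (J', J) * P i J' x) =
      P i J (inv\<^bsub>SL2 \<times>\<times> SL2_mod N\<^esub> g \<otimes>\<^bsub>SL2 \<times>\<times> SL2_mod N\<^esub> x \<otimes>\<^bsub>SL2 \<times>\<times> SL2_mod N\<^esub> g)"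
    "\<And>\<tau> x. \<tau> \<in> upper_half_plane \<Longrightarrow> x \<in> carrier (SL2 \<times>\<times> SL2_mod N) \<Longrightarrow>
      \<phi> (omega f \<sigma> v \<tau>) x = (\<Sum>i<n. \<Sum>J<Suc k * q. P i J x * lift_form i J \<tau>)"
proof -
  obtain u where u1: "\<And>\<tau> a. a < d \<Longrightarrow> (\<sigma> (mat2 1 \<tau> 0 1) *\<^sub>v v) $ a = (\<Sum>j<Suc k. \<tau> ^ (k - j) * u j a)"
    and u2: "\<And>g j a. g \<in> carrier SL2 \<Longrightarrow> j < Suc k \<Longrightarrow> a < d \<Longrightarrow>
      (\<Sum>b<d. \<sigma> g $$ (a, b) * u j b) = (\<Sum>l<Suc k. sym_mat k g $$ (l, j) * u l a)"
    by (rule highest_weight_expansion[OF highest_weight], rule that; assumption)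
  have \<sigma>: "\<sigma> \<in> hom SL2 (GL d)" and v: "v \<in> carrier_vec d"
    using highest_weight unfolding highest_weight_module_def irreducible_rep_def by blast+
  have q: "q > 0" using K.idx[OF K.one_closed] by auto
  let ?G = "SL2 \<times>\<times> SL2_mod N :: (complex mat \<times> int mat) monoid"
  \<comment> \<open>Every x in the finite group returns f itself in \<open>twist_average\<close>, so
    the sum over the group is divided by its order q.\<close>
  define t where "t i J a = u (J div q) (a div n) * \<rho> (e (J mod q)) $$ (a mod n, i) / of_nat q" for i J a
  define P where "P i J = \<phi> (vec (d * n) (t i J))" for i J
  define U where "U a = \<phi> (unit_vec (d * n) a)" for a
  have P_eq: "P i J x = (\<Sum>a<d * n. t i J a * U a x)" if "x \<in> carrier ?G" for i J x
    unfolding P_def U_def using conj_hom_coordinates[OF \<phi> _ that, of "vec (d * n) (t i J)"] by simp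
  show thesis
  proof (rule that)
    fix i J
    show "P i J \<in> regular_SL2_prod N" using \<phi> unfolding conj_hom_def P_def by auto
  next
    fix i J g x assume i: "i < n" and J: "J < Suc k * q" and g: "g \<in> carrier ?G" and x: "x \<in> carrier ?G"
    obtain g1 \<kappa> where gp: "g = (g1, \<kappa>)" and g1: "g1 \<in> carrier SL2" and \<kappa>: "\<kappa> \<in> K" using g by (cases g) auto
    let ?A = "kron_mat (\<sigma> g1) (\<rho> \<kappa>)"
    note Jb = div_mod_less[OF J]
    have \<sigma>g: "\<sigma> g1 \<in> carrier_mat d d" using hom_in_carrier[OF \<sigma> g1] by auto
    note A = kron_mat_carrier[OF \<sigma>g \<rho>_carrier[OF \<kappa>]]
    have w: "vec (d * n) (t i J) \<in> carrier_vec (d * n)" by simp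
    have entry: "(?A *\<^sub>v vec (d * n) (t i J)) $ a = (\<Sum>J'<Suc k * q. sym_reg k g $$ (J', J) * t i J' a)"
      if a: "a < d * n" for a
    proof -
      note ab = div_mod_less[OF a]
      have "(?A *\<^sub>v vec (d * n) (t i J)) $ a = (\<Sum>b<d * n. ?A $$ (a, b) * t i J b)"
        unfolding mult_mat_vec_index[OF A w a] by (intro sum.cong) auto
      also have "\<dots> = (\<Sum>b<d * n. (\<sigma> g1 $$ (a div n, b div n) * u (J div q) (b div n)) *
          (\<rho> \<kappa> $$ (a mod n, b mod n) * \<rho> (e (J mod q)) $$ (b mod n, i)) / of_nat q)"
        using a by (intro sum.cong) (auto simp: kron_mat_index[OF \<sigma>g \<rho>_carrier[OF \<kappa>]] t_def)
      also have "\<dots> = (\<Sum>b1<d. \<Sum>b2<n. (\<sigma> g1 $$ (a div n, b1) * u (J div q) b1) *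
          (\<rho> \<kappa> $$ (a mod n, b2) * \<rho> (e (J mod q)) $$ (b2, i)) / of_nat q)"
        by (rule sum_div_mod)
      also have "\<dots> = (\<Sum>b1<d. \<sigma> g1 $$ (a div n, b1) * u (J div q) b1) *
          (\<Sum>b2<n. \<rho> \<kappa> $$ (a mod n, b2) * \<rho> (e (J mod q)) $$ (b2, i)) / of_nat q"
        by (simp add: sum_product sum_divide_distrib)
      also have "(\<Sum>b1<d. \<sigma> g1 $$ (a div n, b1) * u (J div q) b1) =
          (\<Sum>l<Suc k. sym_mat k g1 $$ (l, J div q) * u l (a div n))"
        by (rule u2[OF g1 Jb(1) ab(1)])
      also have "(\<Sum>b2<n. \<rho> \<kappa> $$ (a mod n, b2) * \<rho> (e (J mod q)) $$ (b2, i)) = \<rho> (\<kappa> \<odot> e (J mod q)) $$ (a mod n, i)"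
        unfolding \<rho>_mult[OF \<kappa> K.enum_closed[OF Jb(2)]]
        by (rule mult_mat_index[OF \<rho>_carrier[OF \<kappa>] \<rho>_carrier[OF K.enum_closed[OF Jb(2)]] ab(2) i, symmetric])
      also have "\<dots> = (\<Sum>y<q. K.perm_mat \<kappa> $$ (y, J mod q) * \<rho> (e y) $$ (a mod n, i))"
        using K.perm_mat_sum[OF \<kappa> Jb(2), of "\<lambda>y. \<rho> y $$ (a mod n, i)"] by simp
      also have "(\<Sum>l<Suc k. sym_mat k g1 $$ (l, J div q) * u l (a div n)) *
          (\<Sum>y<q. K.perm_mat \<kappa> $$ (y, J mod q) * \<rho> (e y) $$ (a mod n, i)) / of_nat q =
          (\<Sum>l<Suc k. \<Sum>y<q. sym_mat k g1 $$ (l, J div q) * K.perm_mat \<kappa> $$ (y, J mod q) *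
            (u l (a div n) * \<rho> (e y) $$ (a mod n, i) / of_nat q))"
        by (simp add: sum_product sum_divide_distrib mult_ac del: sum.lessThan_Suc)
      also have "\<dots> = (\<Sum>J'<Suc k * q. sym_mat k g1 $$ (J' div q, J div q) * K.perm_mat \<kappa> $$ (J' mod q, J mod q) * t i J' a)"
        unfolding t_def by (rule sum_div_mod[symmetric])
      also have "\<dots> = (\<Sum>J'<Suc k * q. sym_reg k g $$ (J', J) * t i J' a)"
        using J by (intro sum.cong) (auto simp: sym_reg_index gp simp del: mult_Suc)
      finally show ?thesis .
    qed
    have "P i J (inv\<^bsub>?G\<^esub> g \<otimes>\<^bsub>?G\<^esub> x \<otimes>\<^bsub>?G\<^esub> g) = \<phi> (?A *\<^sub>v vec (d * n) (t i J)) x"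
      using \<phi> g x w unfolding conj_hom_def P_def gp by fastforce
    also have "\<dots> = (\<Sum>a<d * n. (?A *\<^sub>v vec (d * n) (t i J)) $ a * U a x)"
      unfolding U_def by (rule conj_hom_coordinates[OF \<phi> mult_mat_vec_carrier[OF A w] x])
    also have "\<dots> = (\<Sum>a<d * n. \<Sum>J'<Suc k * q. sym_reg k g $$ (J', J) * t i J' a * U a x)"
      using entry by (simp add: sum_distrib_right del: index_mult_mat_vec mult_Suc)
    also have "\<dots> = (\<Sum>J'<Suc k * q. sym_reg k g $$ (J', J) * P i J' x)"
      unfolding P_eq[OF x] sum_distrib_left by (subst sum.swap) (simp add: mult.assoc del: mult_Suc)
    finally show "(\<Sum>J'<Suc k * q. sym_reg k g $$ (J', J) * P i J' x) = P i J (inv\<^bsub>?G\<^esub> g \<otimes>\<^bsub>?G\<^esub> x \<otimes>\<^bsub>?G\<^esub> g)" ..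
  next
    fix \<tau> and x assume \<tau>: "\<tau> \<in> upper_half_plane" and x: "x \<in> carrier ?G"
    let ?c = "2 * of_real pi * \<i> :: complex"
    have n: "mat2 1 \<tau> 0 1 \<in> carrier SL2" by simp
    have \<sigma>v: "\<sigma> (mat2 1 \<tau> 0 1) *\<^sub>v v \<in> carrier_vec d"
      using hom_in_carrier[OF \<sigma> n] v by (intro mult_mat_vec_carrier) auto
    have carr: "omega f \<sigma> v \<tau> \<in> carrier_vec (d * n)"
      by (simp add: omega_def kron_vec_def carrier_vecD[OF \<sigma>v] carrier_vecD[OF f_carrier[OF \<tau>]]
          del: dim_mult_mat_vec)
    have "omega f \<sigma> v \<tau> $ a = (\<Sum>i<n. \<Sum>J<Suc k * q. t i J a * lift_form i J \<tau>)" if a: "a < d * n" for a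
    proof -
      note ab = div_mod_less[OF a]
      have "(\<Sum>i<n. \<Sum>J<Suc k * q. t i J a * lift_form i J \<tau>) =
          (\<Sum>i<n. \<Sum>j<Suc k. \<Sum>y<q. u j (a div n) * \<rho> (e y) $$ (a mod n, i) / of_nat q *
            (?c * \<tau> ^ (k - j) * twist i (e y) \<tau>))"
        unfolding t_def lift_form_def by (intro sum.cong refl sum_div_mod)
      also have "\<dots> = (\<Sum>j<Suc k. \<Sum>y<q. \<Sum>i<n. u j (a div n) * \<rho> (e y) $$ (a mod n, i) / of_nat q *
            (?c * \<tau> ^ (k - j) * twist i (e y) \<tau>))"
        by (subst sum.swap) (intro sum.cong refl sum.swap)
      also have "\<dots> = (\<Sum>j<Suc k. \<Sum>y<q. ?c * (\<tau> ^ (k - j) * u j (a div n)) / of_nat q *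
            (\<Sum>i<n. \<rho> (e y) $$ (a mod n, i) * twist i (e y) \<tau>))"
        by (intro sum.cong refl) (simp add: sum_distrib_left sum_divide_distrib mult_ac)
      also have "\<dots> = (\<Sum>j<Suc k. \<Sum>y<q. ?c * (\<tau> ^ (k - j) * u j (a div n)) / of_nat q * f \<tau> $ (a mod n))"
        using twist_average[OF \<tau> K.enum_closed ab(2)] by (intro sum.cong refl) simp
      also have "\<dots> = ?c * ((\<sigma> (mat2 1 \<tau> 0 1) *\<^sub>v v) $ (a div n) * f \<tau> $ (a mod n))"
        unfolding u1[OF ab(1)] using q
        by (simp add: sum_distrib_left sum_distrib_right mult_ac del: sum.lessThan_Suc)
      also have "\<dots> = omega f \<sigma> v \<tau> $ a"
        using a by (simp add: omega_def kron_vec_def carrier_vecD[OF \<sigma>v] carrier_vecD[OF f_carrier[OF \<tau>]]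
          del: index_mult_mat_vec dim_mult_mat_vec)
      finally show ?thesis ..
    qed
    then have "\<phi> (omega f \<sigma> v \<tau>) x = (\<Sum>a<d * n. \<Sum>i<n. \<Sum>J<Suc k * q. t i J a * lift_form i J \<tau> * U a x)"
      unfolding conj_hom_coordinates[OF \<phi> carr x] U_def by (simp add: sum_distrib_right del: mult_Suc)
    also have "\<dots> = (\<Sum>i<n. \<Sum>J<Suc k * q. \<Sum>a<d * n. t i J a * lift_form i J \<tau> * U a x)"
      by (subst sum.swap) (intro sum.cong refl sum.swap)
    also have "\<dots> = (\<Sum>i<n. \<Sum>J<Suc k * q. P i J x * lift_form i J \<tau>)"
      unfolding P_eq[OF x] by (simp add: sum_distrib_left sum_distrib_right mult_ac del: mult_Suc)
    finally show "\<phi> (omega f \<sigma> v \<tau>) x = (\<Sum>i<n. \<Sum>J<Suc k * q. P i J x * lift_form i J \<tau>)" .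
  qed
qed

text \<open>After the expansion by \<open>lift\<close>, the point (\<alpha>, \<alpha> mod N) enters
  only through \<open>P\<close> and the path only through the integrals \<open>C\<close>, so
  integration and evaluation separate.\<close>

lemma period_function_class:
  assumes \<tau>0: "\<tau>0 \<in> upper_half_plane"
    and path: "\<And>\<alpha>. \<alpha> \<in> carrier SL2_Z \<Longrightarrow> valid_path (p \<alpha>) \<and> path_image (p \<alpha>) \<subseteq> upper_half_plane \<and>
      pathstart (p \<alpha>) = \<tau>0 \<and> pathfinish (p \<alpha>) = moebius_action \<alpha> \<tau>0"
  shows "class_function SL2_Z (period_function N f \<sigma> v \<phi> p)"
    and "\<exists>\<Phi>\<in>Cl_C. \<forall>\<alpha>\<in>carrier SL2_Z. period_function N f \<sigma> v \<phi> p \<alpha> = \<Phi> (canonical_hom \<alpha>)"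
proof -
  let ?G = "SL2 \<times>\<times> SL2_mod N :: (complex mat \<times> int mat) monoid"
  let ?x = "\<lambda>\<alpha>. (map_mat of_int \<alpha>, reduce N \<alpha>) :: complex mat \<times> int mat"
  obtain P where P: "\<And>i J. P i J \<in> regular_SL2_prod N"
    and P_equiv: "\<And>i J g x. i < n \<Longrightarrow> J < Suc k * q \<Longrightarrow> g \<in> carrier ?G \<Longrightarrow> x \<in> carrier ?G \<Longrightarrow>
      (\<Sum>J'<Suc k * q. sym_reg k g $$ (J', J) * P i J' x) = P i J (inv\<^bsub>?G\<^esub> g \<otimes>\<^bsub>?G\<^esub> x \<otimes>\<^bsub>?G\<^esub> g)"
    and expand: "\<And>\<tau> x. \<tau> \<in> upper_half_plane \<Longrightarrow> x \<in> carrier ?G \<Longrightarrow>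
      \<phi> (omega f \<sigma> v \<tau>) x = (\<Sum>i<n. \<Sum>J<Suc k * q. P i J x * lift_form i J \<tau>)"
    by (rule lift, rule that; assumption)
  define C where "C i \<alpha> J = contour_integral (p \<alpha>) (lift_form i J)" for i \<alpha> J
  have hol: "lift_form i J holomorphic_on upper_half_plane" if "i < n" for i J
    unfolding lift_form_def by (intro holomorphic_intros twist_holomorphic that)
  have cocycle: "C i (\<alpha> * \<beta>) J = C i \<alpha> J + (\<Sum>J'<Suc k * q. restrict_rep N (sym_reg k) \<alpha> $$ (J, J') * C i \<beta> J')"
    if "i < n" "\<alpha> \<in> carrier SL2_Z" "\<beta> \<in> carrier SL2_Z" "J < Suc k * q" for i \<alpha> \<beta> J
    unfolding C_def
    by (rule period_cocycle[of "Suc k * q" "lift_form i" "\<lambda>\<gamma> J J'. restrict_rep N (sym_reg k) \<gamma> $$ (J, J')" \<tau>0])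
       (use hol lift_form_transform \<tau>0 path that in \<open>simp_all del: mult_Suc\<close>)
  have period: "period_function N f \<sigma> v \<phi> p \<alpha> = (\<Sum>i<n. \<Sum>J<Suc k * q. C i \<alpha> J * P i J (?x \<alpha>))"
    if \<alpha>: "\<alpha> \<in> carrier SL2_Z" for \<alpha>
  proof -
    have x: "?x \<alpha> \<in> carrier ?G" using \<alpha> by simp
    have int: "lift_form i J contour_integrable_on p \<alpha>" if "i < n" for i J
      using path[OF \<alpha>] hol[OF that] upper_half_plane_props(1)
      by (intro contour_integrable_holomorphic_simple) auto
    have "period_function N f \<sigma> v \<phi> p \<alpha> =
        contour_integral (p \<alpha>) (\<lambda>\<tau>. \<Sum>i<n. \<Sum>J<Suc k * q. P i J (?x \<alpha>) * lift_form i J \<tau>)"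
      unfolding period_function_def omega_integral_def
      by (rule contour_integral_eq) (use path[OF \<alpha>] expand x in blast)
    also have "\<dots> = (\<Sum>i<n. \<Sum>J<Suc k * q. P i J (?x \<alpha>) * C i \<alpha> J)"
    proof -
      have "contour_integral (p \<alpha>) (\<lambda>\<tau>. \<Sum>J<Suc k * q. P i J (?x \<alpha>) * lift_form i J \<tau>) =
          (\<Sum>J<Suc k * q. P i J (?x \<alpha>) * C i \<alpha> J)" if i: "i < n" for i
        unfolding C_def using int[OF i]
        by (subst contour_integral_sum) (auto intro: contour_integrable_lmul simp: contour_integral_lmul)
      moreover have "(\<lambda>\<tau>. \<Sum>J<Suc k * q. P i J (?x \<alpha>) * lift_form i J \<tau>) contour_integrable_on p \<alpha>"
        if i: "i < n" for i
        using int[OF i] by (intro contour_integrable_sum contour_integrable_lmul) auto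
      ultimately show ?thesis by (subst contour_integral_sum) auto
    qed
    finally show ?thesis by (simp add: mult.commute del: mult_Suc)
  qed
  \<comment> \<open>The class function property on the modular group is the same formal computation
    as on the relative completion, with \<open>?x\<close> in place of \<open>point\<close>.\<close>
  have hom: "?x \<in> hom SL2_Z ?G"
    by (rule homI) (auto simp: reduce_SL2_mult)
  interpret x: group_hom SL2_Z ?G ?x
    by (intro group_hom.intro group_hom_axioms.intro SL2_group SL2_prod_group hom)
  have cls: "class_function SL2_Z (\<lambda>\<alpha>. \<Sum>J<Suc k * q. C i \<alpha> J * P i J (?x \<alpha>))" if i: "i < n" for i
  proof (rule class_function_cocycle[OF SL2_group, where A = "\<lambda>\<gamma> J J'. restrict_rep N (sym_reg k) \<gamma> $$ (J, J')"])
    fix g h J assume "g \<in> carrier SL2_Z" "h \<in> carrier SL2_Z" "J < Suc k * q"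
    then show "C i (g \<otimes>\<^bsub>SL2\<^esub> h) J = C i g J + (\<Sum>j<Suc k * q. restrict_rep N (sym_reg k) g $$ (J, j) * C i h j)"
      using cocycle[OF i] by (simp del: mult_Suc)
  next
    fix g h J assume *: "g \<in> carrier SL2_Z" "h \<in> carrier SL2_Z" "J < Suc k * q"
    have "?x (inv\<^bsub>SL2\<^esub> g \<otimes>\<^bsub>SL2\<^esub> h \<otimes>\<^bsub>SL2\<^esub> g) = inv\<^bsub>?G\<^esub> (?x g) \<otimes>\<^bsub>?G\<^esub> ?x h \<otimes>\<^bsub>?G\<^esub> ?x g"
      using *(1,2) by (simp only: x.hom_mult x.hom_inv x.G.m_closed x.G.inv_closed)
    then show "(\<Sum>j<Suc k * q. restrict_rep N (sym_reg k) g $$ (j, J) * P i j (?x h)) =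
        P i J (?x (inv\<^bsub>SL2\<^esub> g \<otimes>\<^bsub>SL2\<^esub> h \<otimes>\<^bsub>SL2\<^esub> g))"
      using P_equiv[OF i *(3) x.hom_closed[OF *(1)] x.hom_closed[OF *(2)]] by (simp only: restrict_rep_def)
  qed
  show "class_function SL2_Z (period_function N f \<sigma> v \<phi> p)"
  proof (rule class_function_cong[OF SL2_group period])
    show "class_function SL2_Z (\<lambda>\<alpha>. \<Sum>i<n. \<Sum>J<Suc k * q. C i \<alpha> J * P i J (?x \<alpha>))"
      using cls unfolding class_function_def by (simp del: mult_Suc SL2_simps)
  qed
  have "\<exists>\<Phi>\<in>Cl_C. \<forall>\<alpha>\<in>carrier SL2_Z. (\<Sum>J<Suc k * q. C i \<alpha> J * P i J (?x \<alpha>)) = \<Phi> (canonical_hom \<alpha>)"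
    if "i < n" for i
    by (rule period_Cl_C) (use cocycle[OF that] P P_equiv[OF that] in \<open>simp_all del: mult_Suc\<close>)
  then obtain \<Phi> where \<Phi>: "\<And>i. i < n \<Longrightarrow> \<Phi> i \<in> Cl_C" "\<And>i \<alpha>. i < n \<Longrightarrow> \<alpha> \<in> carrier SL2_Z \<Longrightarrow>
      (\<Sum>J<Suc k * q. C i \<alpha> J * P i J (?x \<alpha>)) = \<Phi> i (canonical_hom \<alpha>)" by metis
  show "\<exists>\<Phi>\<in>Cl_C. \<forall>\<alpha>\<in>carrier SL2_Z. period_function N f \<sigma> v \<phi> p \<alpha> = \<Phi> (canonical_hom \<alpha>)"
    by (rule bexI[OF _ Cl_C_sum_closed[of "{..<n}" \<Phi>]]) (use \<Phi> period in \<open>auto simp del: mult_Suc\<close>)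
qed

end

theorem proposition23p7:
  fixes N m n d :: nat
    and \<chi> :: "int mat \<Rightarrow> complex"
    and \<rho> :: "int mat \<Rightarrow> complex mat"
    and f :: "complex \<Rightarrow> complex vec"
    and \<sigma> :: "complex mat \<Rightarrow> complex mat"
    and e :: "complex vec"
    and \<phi> :: "complex vec \<Rightarrow> complex mat \<times> int mat \<Rightarrow> complex"
    and \<tau>\<^sub>0 :: complex
    and p :: "int mat \<Rightarrow> real \<Rightarrow> complex"
  assumes "N \<ge> 1" and "m \<ge> 2" and "even m"
    and "irreducible_rep (SL2_mod N) n \<rho>"
    and "\<forall>k\<in>carrier (SL2_mod N). \<chi> k = (\<Sum>i<n. \<rho> k $$ (i, i))"
    and "appears_in_conj_rep (SL2_mod N) n \<rho>"
    and "vv_modular_form N n \<rho> m f"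
    and "highest_weight_module (m - 2) d \<sigma> e"
    and "\<phi> \<in> conj_hom (SL2 \<times>\<times> SL2_mod N) (regular_SL2_prod N) (d * n)
                (\<lambda>(g, k). kron_mat (\<sigma> g) (\<rho> k))"
    and "\<tau>\<^sub>0 \<in> upper_half_plane"
    and "\<forall>\<alpha>\<in>carrier SL2_Z. valid_path (p \<alpha>) \<and> path_image (p \<alpha>) \<subseteq> upper_half_plane \<and>
           pathstart (p \<alpha>) = \<tau>\<^sub>0 \<and> pathfinish (p \<alpha>) = moebius_action \<alpha> \<tau>\<^sub>0"
  shows "class_function SL2_Z (period_function N f \<sigma> e \<phi> p) \<and>
    (\<exists>\<Phi>\<in>Cl_C. \<forall>\<alpha>\<in>carrier SL2_Z. period_function N f \<sigma> e \<phi> p \<alpha> = \<Phi> (canonical_hom \<alpha>))"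
proof -
  obtain enum where enum: "bij_betw enum {..<card (carrier (SL2_mod N))} (carrier (SL2_mod N))"
    using ex_bij_betw_nat_finite[OF SL2_mod_finite[OF assms(1)]] by (auto simp: atLeast0LessThan)
  interpret modular_period N enum "card (carrier (SL2_mod N))" "m - 2" n d \<rho> f \<sigma> e \<phi>
  proof (intro modular_period.intro level.intro enumerated_group.intro enumerated_group_axioms.intro
      level_axioms.intro modular_period_axioms.intro SL2_mod_group enum)
    \<comment> \<open>Subtraction of natural numbers is truncated; the bound on m makes the weight k
      + 2 of the locale equal to m.\<close>
    have "m - 2 + 2 = m" using assms(2) by simp
    then show "vv_modular_form N n \<rho> (m - 2 + 2) f" using assms(7) by (simp only:)
    show "\<rho> \<in> hom (SL2_mod N) (GL n)" using assms unfolding irreducible_rep_def by blast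
  qed (fact assms)+
  show ?thesis using period_function_class[of "\<tau>\<^sub>0" p] assms by blast
qed

end
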